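(* Suppose the following hold. (Disutilities) For each $i\in\{1,\dots,n\}$, the function $f_i:\mathbb{R}\to\mathbb{R}$ is convex with a (not necessarily unique) minimum at $0$; it is coercive, i.e. $\{x\in\mathbb{R} : f_i(x)\le F\}$ is compact for every $F\ge 0$; it is continuously differentiable; and its derivative $\nabla f_i$ is Lipschitz. (Geometry) The domain $\Omega=\Omega_1\times\dots\times\Omega_n$ is compact; the graph $\mathcal{G}$ is connected; and $\Delta g[k]=\bar g$ for all $k\ge 0$, where $\bar g\in\mathbb{R}$ is a constant. (Technical) $\alpha[k]=c\,\gamma[k]$ for all $k$, for some constant $c>0$; $\gamma[k]\to 0$, $\sum_{k=0}^\infty\gamma[k]=\infty$ and $\sum_{k=0}^\infty(\gamma[k])^2<\infty$; the estimation error sequence $\boldsymbol{\epsilon}[k]$ is a martingale-difference sequence, i.e. $\mathbb{E}[\epsilon_i[k]\mid\mathcal{F}[k-1]]=0$ for all $i,k$, and $\lim_{k\to\infty}\mathbb{E}[(\epsilon_i[k])^2\mid\mathcal{F}[k-1]]$ exists (and is finite) almost surely for each $i$. Suppose further that the optimization problem $$\min_{x_1,\dots,x_n}\ \sum_{i=1}^n f_i(x_i)\quad\text{subject to}\quad \sum_{i=1}^n x_i=\bar g,\qquad x_i\in\Omega_i\ (i=1,\dots,n)$$ has a solution, and that all of its solutions are strictly feasible, i.e. lie in the interior of $\Omega$. Then the sequence $\boldsymbol{x}[k]$ generated by the DGP algorithm converges almost surely to a solution of this optimization problem.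
   Context: There are $n$ loads. $\Omega_i=[\underline{x}_i,\bar x_i]\subset\mathbb{R}$ is the interval of allowed values of the decision variable $x_i$ of load $i$, and $\Omega=\Omega_1\times\dots\times\Omega_n\subset\mathbb{R}^n$. $\mathcal{G}=(\mathcal{V},\mathcal{E})$ is an undirected graph (the communication graph) on $\mathcal{V}=\{1,\dots,n\}$; $\mathcal{N}_i=\{j : (i,j)\in\mathcal{E}\}$ is the neighbor set of $i$ and $n_i=|\mathcal{N}_i|$. $\nabla f_i$ denotes the derivative of $f_i$. $P_{\Omega_i}$ is the (Euclidean) projection of $\mathbb{R}$ onto $\Omega_i$. The DGP (Distributed Gradient Projection) algorithm: starting from $\boldsymbol{x}[0]\in\Omega$ (deterministic), for $k=0,1,2,\dots$ and each $i$, $$x_i[k+1]=P_{\Omega_i}\big[x_i[k]+\alpha[k]\,\Delta x_i[k]+\gamma[k]\,\hat u_i[k]\big],\qquad \Delta x_i[k]=-n_i\nabla f_i(x_i[k])+\sum_{j\in\mathcal{N}_i}\nabla f_j(x_j[k]),$$ where $\alpha[k],\gamma[k]>0$ are step sizes, $u[k]=\Delta g[k]-\sum_{i=1}^n x_i[k]$ is the mismatch, and $\hat u_i[k]$ is load $i$'s noisy estimate of $u[k]$, with estimation error $\epsilon_i[k]=\hat u_i[k]-u[k]$. Write $\boldsymbol{x}[k]=(x_1[k],\dots,x_n[k])^T$ and $\boldsymbol{\epsilon}[k]=(\epsilon_1[k],\dots,\epsilon_n[k])^T$. $\mathcal{F}[k-1]=\sigma(\epsilon_i[\ell-1] : i\in\mathcal{V},\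 1\le\ell\le k)$ is the $\sigma$-algebra generated by $\boldsymbol{\epsilon}[0],\dots,\boldsymbol{\epsilon}[k-1]$ (trivial for $k=0$). *)

theory Defs
  imports "HOL-Probability.Probability"
begin

text \<open>
  The loads are the elements of a finite type \<open>'n\<close>; a profile of decision variables is a vector in
  \<open>real^'n\<close>. The communication graph is a symmetric relation \<open>E\<close> on \<open>'n\<close>. Self-loops are not
  excluded: they cancel in \<open>consensus_dir\<close> and do not affect connectedness.
\<close>

definition box_domain :: "real^'n \<Rightarrow> real^'n \<Rightarrow> (real^'n) set" where
  "box_domain lo hi = {x. \<forall>i. x $ i \<in> {lo $ i..hi $ i}}"

definition nbrs :: "('n \<times> 'n) set \<Rightarrow> 'n \<Rightarrow> 'n set" where
  "nbrs E i = {j. (i, j) \<in> E}"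

definition connected_graph :: "('n \<times> 'n) set \<Rightarrow> bool" where
  "connected_graph E \<longleftrightarrow> (\<forall>i j. (i, j) \<in> E\<^sup>*)"

definition disutility :: "(real \<Rightarrow> real) \<Rightarrow> bool" where
  "disutility h \<longleftrightarrow>
     convex_on UNIV h \<and> (\<forall>x. h 0 \<le> h x) \<and>
     (\<forall>F\<ge>0. compact {x. h x \<le> F}) \<and>
     (\<forall>x. h field_differentiable (at x)) \<and> continuous_on UNIV (deriv h) \<and>
     (\<exists>L. L-lipschitz_on UNIV (deriv h))"

definition consensus_dir ::
    "('n::finite \<Rightarrow> real \<Rightarrow> real) \<Rightarrow> ('n \<times> 'n) set \<Rightarrow> real^'n \<Rightarrow> 'n \<Rightarrow> real" where
  "consensus_dir f E x i =
     - real (card (nbrs E i)) * deriv (f i) (x $ i) + (\<Sum>j\<in>nbrs E i. deriv (f j) (x $ j))"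

text \<open>
  One sample path of the DGP algorithm: \<open>uhat k $ i\<close> is the estimate used by load \<open>i\<close> at time \<open>k\<close>.
  On the real line \<open>closest_point\<close> is the Euclidean projection.
\<close>

primrec dgp ::
    "('n::finite \<Rightarrow> real \<Rightarrow> real) \<Rightarrow> ('n \<times> 'n) set \<Rightarrow> real^'n \<Rightarrow> real^'n \<Rightarrow>
     (nat \<Rightarrow> real) \<Rightarrow> (nat \<Rightarrow> real) \<Rightarrow> real^'n \<Rightarrow> (nat \<Rightarrow> real^'n) \<Rightarrow> nat \<Rightarrow> real^'n" where
  "dgp f E lo hi \<alpha> \<gamma> x0 uhat 0 = x0"
| "dgp f E lo hi \<alpha> \<gamma> x0 uhat (Suc k) =
     (let x = dgp f E lo hi \<alpha> \<gamma> x0 uhat k in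
      \<chi> i. closest_point {lo $ i..hi $ i}
             (x $ i + \<alpha> k * consensus_dir f E x i + \<gamma> k * (uhat k $ i)))"

definition mismatch :: "(nat \<Rightarrow> real) \<Rightarrow> (nat \<Rightarrow> real^'n::finite) \<Rightarrow> nat \<Rightarrow> real" where
  "mismatch \<Delta>g x k = \<Delta>g k - (\<Sum>i\<in>UNIV. x k $ i)"

text \<open>
  \<open>noise_filt M \<epsilon> k\<close> is the sigma-algebra generated by \<open>\<epsilon> 0, \<dots>, \<epsilon> (k - 1)\<close>, i.e. the
  sigma-algebra usually written with index \<open>k - 1\<close>; it is trivial for \<open>k = 0\<close>.
\<close>

definition noise_filt :: "'a measure \<Rightarrow> (nat \<Rightarrow> 'a \<Rightarrow> real^'n) \<Rightarrow> nat \<Rightarrow> 'a measure" where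
  "noise_filt M \<epsilon> k =
     sigma (space M) (\<Union>i. \<Union>l<k. {(\<lambda>\<omega>. \<epsilon> l \<omega> $ i) -` A \<inter> space M | A. A \<in> sets borel})"

definition martingale_difference :: "'a measure \<Rightarrow> (nat \<Rightarrow> 'a \<Rightarrow> real^'n) \<Rightarrow> bool" where
  "martingale_difference M \<epsilon> \<longleftrightarrow>
     (\<forall>k i. integrable M (\<lambda>\<omega>. \<epsilon> k \<omega> $ i) \<and>
            (AE \<omega> in M. real_cond_exp M (noise_filt M \<epsilon> k) (\<lambda>\<omega>. \<epsilon> k \<omega> $ i) \<omega> = 0))"

text \<open>
  No square integrability is assumed, so the conditional second moment is the extended nonnegative
  conditional expectation; \<open>real_cond_exp\<close> would turn infinite values into 0.
\<close>

definition cond_second_moment ::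
    "'a measure \<Rightarrow> (nat \<Rightarrow> 'a \<Rightarrow> real^'n) \<Rightarrow> 'n \<Rightarrow> nat \<Rightarrow> 'a \<Rightarrow> ennreal" where
  "cond_second_moment M \<epsilon> i k =
     nn_cond_exp M (noise_filt M \<epsilon> k) (\<lambda>\<omega>. ennreal ((\<epsilon> k \<omega> $ i)\<^sup>2))"

definition is_solution ::
    "('n::finite \<Rightarrow> real \<Rightarrow> real) \<Rightarrow> real^'n \<Rightarrow> real^'n \<Rightarrow> real \<Rightarrow> real^'n \<Rightarrow> bool" where
  "is_solution f lo hi g =
     is_arg_min (\<lambda>x. \<Sum>i\<in>UNIV. f i (x $ i))
                (\<lambda>x. (\<Sum>i\<in>UNIV. x $ i) = g \<and> x \<in> box_domain lo hi)"

end

theory Submission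
  imports Defs
begin

text \<open>
  Let \<open>\<mu>\<close> be the common value of the derivatives at a strictly feasible solution and put
  \<open>w i t = deriv (f i) t - \<mu>\<close>, so that a profile in the box is a solution as soon as all \<open>w i\<close> and the
  mismatch \<open>u\<close> vanish. The drift is \<open>- c L w + u 1\<close> with the graph Laplacian \<open>L\<close>.

  The function \<open>V x = sum \<psi>\<^sub>i (x i) + G (- u)\<close>, where \<open>G' s = clip (s / u0)\<close> and \<open>\<psi>\<^sub>i'\<close> is essentially
  \<open>clip (w i / m0)\<close>, strictly decreases along the drift off the solution set. Both gradients are
  truncated at the same height, so that at an end of the box the slope of \<open>\<psi>\<^sub>i\<close> dominates that of \<open>G\<close>
  and the projection can only decrease \<open>V\<close>, no matter how large the noise is. As the weighted noise
  sums converge almost surely, \<open>V (x k)\<close> tends to the minimum of \<open>V\<close>, and \<open>x k\<close> approaches the solution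
  set, which lies in the interior of the box.

  From then on the projection is inactive. The drift does not increase the quadratic form of
  \<open>(L + 1 1\<^sup>T)\<^sup>-\<^sup>1 + \<beta> 1 1\<^sup>T\<close> evaluated at the distance to any solution, since the derivatives are
  monotone and Lipschitz. Applied to a cluster point of \<open>x k\<close>, this gives convergence.

  The noise sums converge by Kolmogorov's maximal inequality, after restricting each summand to the
  event that its conditional second moment is at most \<open>B\<close>; almost surely, for some natural number \<open>B\<close>
  this changes only finitely many summands.
\<close>

section \<open>The drift inequality on a graph\<close>

text \<open>Two Lyapunov functions occur because neither does the whole job. The quadratic form
  couples the coordinates, so that clipping one coordinate may in general increase it, and with
  noise of unlimited size the projection may act at any time. \<open>V\<close> survives clipping,
  but its minimizers form the whole solution set, which need not be a single point as strict
  convexity is not assumed; so it cannot single out a limit. The same lack of strict convexity lets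
  \<open>w i\<close> vanish all the way from a solution to an end of the box. The slope required at
  that end then has to be produced by a bump that is unrelated to \<open>w i\<close> and can work
  against the drift. Strict feasibility of all solutions limits the damage: by compactness there is
  a margin \<theta> such that a bump is active only where some |w j| or the mismatch is at least
  \<theta> in size. This margin is the scale of the flatter truncation \<open>m1\<close>; then
  \<open>m0\<close> is taken small against it, and finally \<open>u0\<close> small against
  \<open>m0\<close>.\<close>

definition clip :: "real \<Rightarrow> real" where
  "clip t = max (-1) (min 1 t)"

lemma clip_mono: "s \<le> t \<Longrightarrow> clip s \<le> clip t"
  by (auto simp: clip_def)

lemma clip_bounds: "- 1 \<le> clip t" "clip t \<le> 1" "\<bar>clip t\<bar> \<le> 1"
  by (auto simp: clip_def)

lemma clip_0 [simp]: "clip 0 = 0"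
  by (simp add: clip_def)

lemma clip_minus [simp]: "clip (- t) = - clip t"
  by (auto simp: clip_def)

lemma clip_eq_1: "1 \<le> t \<Longrightarrow> clip t = 1"
  by (simp add: clip_def)

lemma clip_lipschitz: "\<bar>clip s - clip t\<bar> \<le> \<bar>s - t\<bar>"
  by (auto simp: clip_def)

text \<open>\<open>clip\<close> is the projection onto the interval from -1 to 1, hence firmly
  nonexpansive. Compared with mere monotonicity this leaves a square of truncated values, to which
  the Poincare inequality applies.\<close>

lemma clip_cocoercive: "(clip s - clip t)\<^sup>2 \<le> (clip s - clip t) * (s - t)"
proof (induct s t rule: linorder_wlog)
  case (le s t)
  then have "0 \<le> clip t - clip s" "clip t - clip s \<le> t - s"
    by (auto simp: clip_def)
  then have "(clip t - clip s) * (clip t - clip s) \<le> (clip t - clip s) * (t - s)"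
    by (intro mult_left_mono)
  then show ?case
    by (simp add: power2_eq_square algebra_simps)
next
  case (sym s t)
  then show ?case
    by (simp add: power2_eq_square algebra_simps)
qed

lemma clip_div_cocoercive:
  assumes "m > 0"
  shows "m * (clip (s / m) - clip (t / m))\<^sup>2 \<le> (clip (s / m) - clip (t / m)) * (s - t)"
proof -
  have "m * (clip (s / m) - clip (t / m))\<^sup>2 \<le> m * ((clip (s / m) - clip (t / m)) * (s / m - t / m))"
    using assms by (intro mult_left_mono clip_cocoercive) auto
  also have "\<dots> = (clip (s / m) - clip (t / m)) * (s - t)"
    using assms by (simp add: field_simps)
  finally show ?thesis .
qed

text \<open>The bilinear form of the graph Laplacian. For symmetric \<open>E\<close> every edge
  between distinct vertices is counted in both directions, which the factor 1/2 undoes; self-loops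
  contribute 0.\<close>

definition dirichlet :: "('n::finite \<times> 'n) set \<Rightarrow> ('n \<Rightarrow> real) \<Rightarrow> ('n \<Rightarrow> real) \<Rightarrow> real" where
  "dirichlet E p w = (\<Sum>i\<in>UNIV. \<Sum>j\<in>nbrs E i. (p i - p j) * (w i - w j)) / 2"

lemma sum_nbrs: "(\<Sum>j\<in>nbrs E (i::'n::finite). g j) = (\<Sum>j\<in>UNIV. if (i, j) \<in> E then g j else (0::real))"
  unfolding nbrs_def by (simp add: sum.If_cases)

text \<open>Summation by parts: exchanging the roles of \<open>i\<close> and \<open>j\<close> and
  averaging the two sums turns \<open>p i\<close> into \<open>p i - p j\<close>.\<close>

lemma sum_laplacian:
  fixes p w :: "'n::finite \<Rightarrow> real"
  assumes "sym E"
  shows "(\<Sum>i\<in>UNIV. p i * (\<Sum>j\<in>nbrs E i. w i - w j)) = dirichlet E p w"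
proof -
  let ?a = "\<lambda>i j. if (i, j) \<in> E then p i * (w i - w j) else 0"
  have s: "(i, j) \<in> E \<longleftrightarrow> (j, i) \<in> E" for i j
    using assms by (auto dest: symD)
  have l: "(\<Sum>i\<in>UNIV. p i * (\<Sum>j\<in>nbrs E i. w i - w j)) = (\<Sum>i\<in>UNIV. \<Sum>j\<in>UNIV. ?a i j)"
    by (simp add: sum_nbrs sum_distrib_left if_distrib cong: if_cong)
  have "(\<Sum>i\<in>UNIV. \<Sum>j\<in>UNIV. ?a i j) = (\<Sum>i\<in>UNIV. \<Sum>j\<in>UNIV. ?a j i)"
    by (rule sum.swap)
  then have "2 * (\<Sum>i\<in>UNIV. \<Sum>j\<in>UNIV. ?a i j) = (\<Sum>i\<in>UNIV. \<Sum>j\<in>UNIV. ?a i j + ?a j i)"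
    by (simp add: sum.distrib)
  also have "\<dots> = (\<Sum>i\<in>UNIV. \<Sum>j\<in>UNIV. if (i, j) \<in> E then (p i - p j) * (w i - w j) else 0)"
    using s by (intro sum.cong refl) (auto simp: algebra_simps)
  also have "\<dots> = 2 * dirichlet E p w"
    by (simp add: dirichlet_def sum_nbrs)
  finally show ?thesis
    using l by simp
qed

lemma dirichlet_mono:
  fixes p w q z :: "'n::finite \<Rightarrow> real"
  assumes "\<And>i j. (p i - p j) * (w i - w j) \<le> (q i - q j) * (z i - z j)"
  shows "dirichlet E p w \<le> dirichlet E q z"
  unfolding dirichlet_def by (intro divide_right_mono sum_mono assms) auto

lemma edge_le_dirichlet:
  fixes z :: "'n::finite \<Rightarrow> real"
  assumes "(a, b) \<in> E"
  shows "(z a - z b)\<^sup>2 \<le> 2 * dirichlet E z z"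
proof -
  have "(z a - z b)\<^sup>2 \<le> (\<Sum>j\<in>nbrs E a. (z a - z j)\<^sup>2)"
    by (rule member_le_sum) (use assms in \<open>auto simp: nbrs_def\<close>)
  also have "\<dots> \<le> (\<Sum>i\<in>UNIV. \<Sum>j\<in>nbrs E i. (z i - z j)\<^sup>2)"
    by (rule member_le_sum[where f = "\<lambda>i. \<Sum>j\<in>nbrs E i. (z i - z j)\<^sup>2"]) (auto intro!: sum_nonneg)
  finally show ?thesis
    by (simp add: dirichlet_def power2_eq_square)
qed

text \<open>Differences are chained along a path, each edge being controlled by
  \<open>edge_le_dirichlet\<close>. The bound (s + t)^2 \<le> 2 s^2 + 2 t^2 doubles the constant at
  every edge; only its independence of \<open>z\<close> matters.\<close>

lemma poincare:
  fixes E :: "('n::finite \<times> 'n) set"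
  assumes "connected_graph E"
  obtains C where "C > 0" and "\<And>z i j. (z i - z j)\<^sup>2 \<le> C * dirichlet E z z"
proof -
  have D0: "dirichlet E z z \<ge> 0" for z
    unfolding dirichlet_def by (auto intro!: sum_nonneg)
  have "\<exists>C\<ge>0. \<forall>z. (z i - z j)\<^sup>2 \<le> C * dirichlet E z z" for i j
  proof -
    have "(i, j) \<in> E\<^sup>*"
      using assms by (auto simp: connected_graph_def)
    then show ?thesis
    proof (induction rule: rtrancl_induct)
      case base
      show ?case
        by (rule exI[of _ 0]) simp
    next
      case (step a b)
      then obtain C where C: "C \<ge> 0" "\<And>z. (z i - z a)\<^sup>2 \<le> C * dirichlet E z z"
        by blast
      have "(z i - z b)\<^sup>2 \<le> (2 * C + 4) * dirichlet E z z" for z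
      proof -
        have "(z i - z b)\<^sup>2 \<le> 2 * (z i - z a)\<^sup>2 + 2 * (z a - z b)\<^sup>2"
          using sum_squares_bound[of "z i - z a" "z a - z b"]
          by (simp add: power2_eq_square algebra_simps)
        also have "\<dots> \<le> 2 * (C * dirichlet E z z) + 2 * (2 * dirichlet E z z)"
          using C(2)[of z] edge_le_dirichlet[OF step(2), of z] by simp
        finally show ?thesis
          by (simp add: algebra_simps)
      qed
      then show ?case
        using C(1) by (intro exI[of _ "2 * C + 4"]) auto
    qed
  qed
  then obtain C where C: "\<And>i j. C i j \<ge> 0" "\<And>i j z. (z i - z j)\<^sup>2 \<le> C i j * dirichlet E z z"
    by metis
  let ?C = "1 + (\<Sum>i\<in>UNIV. \<Sum>j\<in>UNIV. C i j)"
  have le: "C i j \<le> ?C" for i j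
  proof -
    have "C i j \<le> (\<Sum>j\<in>UNIV. C i j)"
      by (rule member_le_sum) (use C in auto)
    also have "\<dots> \<le> (\<Sum>i\<in>UNIV. \<Sum>j\<in>UNIV. C i j)"
      by (rule member_le_sum[where f = "\<lambda>i. \<Sum>j\<in>UNIV. C i j"]) (auto intro!: sum_nonneg C)
    finally show ?thesis
      by simp
  qed
  show thesis
  proof (rule that)
    show "?C > 0"
      using C(1) by (intro add_pos_nonneg sum_nonneg) auto
    show "(z i - z j)\<^sup>2 \<le> ?C * dirichlet E z z" for z i j
      using C(2)[of z i j] mult_right_mono[OF le[of i j] D0[of z]] by linarith
  qed
qed

text \<open>Without bumps the product is nonnegative by monotonicity. A bump sits where
  \<open>w\<close> is 0, so with one bump the product reduces to
  \<open>(clip (w / m) - b) * w\<close> at the other vertex: for |w| \<ge> m the truncation has size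
  1 and outweighs the bump, and below that the loss is at most |w| < m.\<close>

lemma bump_edge:
  fixes w1 w2 b1 b2 m :: real
  assumes "m > 0" "\<bar>b1\<bar> \<le> 1" "\<bar>b2\<bar> \<le> 1" "b1 \<noteq> 0 \<Longrightarrow> w1 = 0" "b2 \<noteq> 0 \<Longrightarrow> w2 = 0"
  shows "- m \<le> (clip (w1 / m) + b1 - (clip (w2 / m) + b2)) * (w1 - w2)"
proof -
  have one: "- m \<le> (clip (w / m) - b) * w" if "\<bar>b\<bar> \<le> 1" for b w
  proof -
    consider "w \<ge> m" | "w \<le> - m" | "\<bar>w\<bar> < m" by linarith
    then show ?thesis
    proof cases
      case 1
      then have "clip (w / m) = 1" using assms by (intro clip_eq_1) (simp add: field_simps)
      then have "0 \<le> (clip (w / m) - b) * w"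
        using that 1 assms by (intro mult_nonneg_nonneg) auto
      then show ?thesis using assms by linarith
    next
      case 2
      then have "clip (- (w / m)) = 1" using assms by (intro clip_eq_1) (simp add: field_simps)
      then have "0 \<le> (clip (w / m) - b) * w"
        using that 2 assms by (intro mult_nonpos_nonpos) auto
      then show ?thesis using assms by linarith
    next
      case 3
      have "\<bar>b * w\<bar> \<le> 1 * m"
        unfolding abs_mult using that 3 by (intro mult_mono) auto
      moreover have "0 \<le> clip (w / m) * w"
        using clip_div_cocoercive[OF assms(1), of w 0] assms(1)
        by simp (smt (verit) mult_nonneg_nonneg zero_le_power2)
      ultimately show ?thesis
        by (simp add: algebra_simps)
    qed
  qed
  consider "b1 = 0" "b2 = 0" | "b1 \<noteq> 0" "w1 = 0" "b2 \<noteq> 0" "w2 = 0"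
    | "b1 = 0" "b2 \<noteq> 0" "w2 = 0" | "b1 \<noteq> 0" "w1 = 0" "b2 = 0"
    using assms by blast
  then show ?thesis
  proof cases
    case 1
    have "0 \<le> m * (clip (w1 / m) - clip (w2 / m))\<^sup>2" using assms(1) by simp
    then show ?thesis
      using clip_div_cocoercive[OF assms(1), of w1 w2] assms(1) unfolding 1 add_0_right by linarith
  next
    case 2
    then show ?thesis using assms(1) by simp
  next
    case 3
    then show ?thesis using one[OF assms(3), of w1] by simp
  next
    case 4
    then show ?thesis using one[OF assms(2), of w2] by (simp add: algebra_simps)
  qed
qed

text \<open>
  If some \<open>B i\<close> is nonzero, the loss of at most \<open>n\<^sup>2 * m0\<close> that it causes in the Dirichlet form is paid for
  by the flatter summand \<open>clip (w i / m1)\<close> or by \<open>u\<close>. Otherwise, \<open>n * u\<close> dominates \<open>u * sum p\<close> for \<open>u0 \<le> u\<close>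
  because some \<open>p j\<close> is nonpositive, and the Poincare inequality handles \<open>u < u0\<close>.
\<close>

lemma drift_neg:
  fixes w B p :: "'n::finite \<Rightarrow> real" and u c m0 m1 u0 \<eta> C :: real
  defines "n \<equiv> real CARD('n)"
  assumes C: "C > 0" "\<And>z i j. (z i - z j)\<^sup>2 \<le> C * dirichlet E z z"
    and pos: "c > 0" "m0 > 0" "m0 \<le> m1" "u0 > 0" "u0 \<le> \<eta>"
    and small: "n\<^sup>2 * m0 \<le> m1 / (8 * n * C)" "2 * n * u0 \<le> c * (m1 / (8 * n * C))"
      "4 * c * (n\<^sup>2 * m0) \<le> \<eta>" "u0 * n * C < c * m0"
    and B: "\<And>i. B i \<noteq> 0 \<Longrightarrow> w i = 0" "\<And>i. \<bar>B i\<bar> \<le> 1"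
    and bump: "\<And>i. B i \<noteq> 0 \<Longrightarrow> (\<exists>j. m1 \<le> \<bar>w j\<bar>) \<or> \<eta> \<le> u"
    and u: "u \<ge> 0"
    and low: "\<exists>j. w j \<le> 0 \<and> B j \<le> 0"
    and high: "u = 0 \<Longrightarrow> \<exists>j. w j \<ge> 0"
    and nontriv: "u \<noteq> 0 \<or> (\<exists>i. w i \<noteq> 0)"
    and p: "\<And>i. p i = clip (w i / m0) + clip (w i / m1) / (2 * n) + B i"
  shows "- c * dirichlet E p w + u * (\<Sum>i\<in>UNIV. p i) - n * u * clip (u / u0) < 0"
proof -
  have n1: "n \<ge> 1"
    unfolding n_def by (simp add: Suc_leI)
  have m1: "m1 > 0" using pos by linarith
  define P1 where "P1 i = clip (w i / m0)" for i
  define P2 where "P2 i = clip (w i / m1)" for i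
  have T2: "m1 * dirichlet E P2 P2 \<le> dirichlet E P2 w"
  proof -
    have "dirichlet E (\<lambda>i. m1 * P2 i) P2 \<le> dirichlet E P2 w"
      using clip_div_cocoercive[OF m1] 
      by (intro dirichlet_mono) (simp add: P2_def power2_eq_square algebra_simps)
    then show ?thesis
      by (simp add: dirichlet_def sum_distrib_left right_diff_distrib' algebra_simps)
  qed
  have T1: "m0 * dirichlet E P1 P1 \<le> dirichlet E P1 w"
  proof -
    have "dirichlet E (\<lambda>i. m0 * P1 i) P1 \<le> dirichlet E P1 w"
      using clip_div_cocoercive[OF pos(2)] 
      by (intro dirichlet_mono) (simp add: P1_def power2_eq_square algebra_simps)
    then show ?thesis
      by (simp add: dirichlet_def sum_distrib_left right_diff_distrib' algebra_simps)
  qed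
  have split: "dirichlet E p w = dirichlet E (\<lambda>i. P1 i + B i) w + dirichlet E P2 w / (2 * n)"
    unfolding dirichlet_def p P1_def P2_def
    by (simp add: sum_divide_distrib sum.distrib[symmetric] add_divide_distrib[symmetric])
       (intro sum.cong refl, simp add: field_simps n_def)
  have dnn: "dirichlet E z z \<ge> 0" for z
    unfolding dirichlet_def by (auto intro!: sum_nonneg)
  have D2: "dirichlet E P2 w \<ge> 0"
    using T2 dnn[of P2] m1 by (smt (verit) mult_nonneg_nonneg)
  \<comment> \<open>The factor 1 / (2 n) of the flatter summand is tuned to this count: with one
    nonpositive weight, the sum of all weights stays 1/2 below \<open>n\<close>, so
    \<open>n * u * clip (u / u0)\<close> wins once it is saturated. Where there is a bump,
    \<open>w i = 0\<close> and the weight is the bump alone.\<close>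
  have p_le: "p i \<le> 1 + 1 / (2 * n)" for i
  proof (cases "B i = 0")
    case True
    have "clip (w i / m1) / (2 * n) \<le> 1 / (2 * n)"
      using clip_bounds n1 by (intro divide_right_mono) auto
    then show ?thesis
      using True clip_bounds(2)[of "w i / m0"] by (simp add: p)
  next
    case False
    then show ?thesis
      using B(1)[OF False] B(2)[of i] n1 by (simp add: p) (smt (verit) divide_nonneg_nonneg)
  qed
  obtain j where j: "w j \<le> 0" "B j \<le> 0"
    using low by blast
  have neg: "clip (w j / m) \<le> 0" if "m > 0" for m
    using clip_mono[of "w j / m" 0] that j by (simp add: divide_nonpos_pos)
  have pj: "p j \<le> 0"
    using neg[OF pos(2)] divide_nonpos_nonneg[OF neg[OF m1], of "2 * n"] j n1 unfolding p by linarith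
  have sum_p: "(\<Sum>i\<in>UNIV. p i) \<le> n - 1 / 2"
  proof -
    have "(\<Sum>i\<in>UNIV. p i) = p j + (\<Sum>i\<in>UNIV - {j}. p i)"
      by (simp add: sum.remove)
    also have "\<dots> \<le> 0 + (\<Sum>i\<in>UNIV - {j}. 1 + 1 / (2 * n))"
      by (intro add_mono pj sum_mono p_le)
    also have "\<dots> = (n - 1) * (1 + 1 / (2 * n))"
      by (simp add: n_def card_Diff_singleton of_nat_diff Suc_leI)
    also have "\<dots> = n - 1 + (n - 1) / (2 * n)"
      using n1 by (simp add: field_simps)
    also have "(n - 1) / (2 * n) \<le> 1 / 2"
      using n1 by (simp add: field_simps)
    finally show ?thesis
      by simp
  qed
  have large_u: "u * (\<Sum>i\<in>UNIV. p i) - n * u * clip (u / u0) \<le> - u / 2" if "u \<ge> u0"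
  proof -
    have "clip (u / u0) = 1"
      using that pos by (intro clip_eq_1) simp
    then show ?thesis
      using mult_left_mono[OF sum_p u] by (simp add: algebra_simps)
  qed
  show ?thesis
  proof (cases "\<exists>i. B i \<noteq> 0")
    case True
    then obtain i where i: "B i \<noteq> 0" "w i = 0"
      using B by blast
    have T1B: "- n\<^sup>2 * m0 \<le> dirichlet E (\<lambda>i. P1 i + B i) w"
    proof -
      have "(\<Sum>i\<in>UNIV. \<Sum>j\<in>nbrs E i. - m0)
          \<le> (\<Sum>i\<in>UNIV. \<Sum>j\<in>nbrs E i. (P1 i + B i - (P1 j + B j)) * (w i - w j))"
        unfolding P1_def by (intro sum_mono bump_edge pos B)
      then have a: "- (\<Sum>i\<in>UNIV. real (card (nbrs E i))) * m0 / 2 \<le> dirichlet E (\<lambda>i. P1 i + B i) w"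
        unfolding dirichlet_def by (intro divide_right_mono) (simp_all add: sum_distrib_right sum_negf)
      have "(\<Sum>i\<in>UNIV. real (card (nbrs E i))) \<le> (\<Sum>i\<in>(UNIV::'n set). n)"
        unfolding n_def by (intro sum_mono) (simp add: card_mono)
      then have "(\<Sum>i\<in>UNIV. real (card (nbrs E i))) \<le> n\<^sup>2"
        by (simp add: n_def power2_eq_square)
      then have "(\<Sum>i\<in>UNIV. real (card (nbrs E i))) * m0 \<le> n\<^sup>2 * m0"
        using pos by (intro mult_right_mono) auto
      moreover have "0 \<le> n\<^sup>2 * m0" using pos by simp
      ultimately show ?thesis using a by simp
    qed
    have D1: "- c * dirichlet E p w \<le> c * (n\<^sup>2 * m0) - c * (dirichlet E P2 w / (2 * n))"
    proof -
      have "c * (- n\<^sup>2 * m0 + dirichlet E P2 w / (2 * n)) \<le> c * dirichlet E p w"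
        unfolding split using pos T1B by (intro mult_left_mono) auto
      then show ?thesis by (simp add: algebra_simps)
    qed
    show ?thesis
    proof (cases "\<exists>j. m1 \<le> \<bar>w j\<bar>")
      case True
      then obtain k where k: "m1 \<le> \<bar>w k\<bar>" by blast
      have "P2 k = 1 \<or> P2 k = - 1"
      proof (cases "w k \<ge> 0")
        case True
        then have "P2 k = 1" unfolding P2_def using k m1 by (intro clip_eq_1) simp
        then show ?thesis ..
      next
        case False
        then have "clip (- (w k / m1)) = 1" using k m1 by (intro clip_eq_1) (simp add: field_simps)
        then show ?thesis by (simp add: P2_def)
      qed
      \<comment> \<open>The vertex with the bump has \<open>w i = 0\<close>, so \<open>P2\<close>
        varies by 1 over the graph, and the Poincare inequality yields a gain of
        \<open>4 * \<kappa>\<close> up to the factor \<open>c\<close>. One \<open>\<kappa>\<close>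
        pays for the bumps and one for the terms with \<open>u\<close>.\<close>
      then have "(P2 k - P2 i)\<^sup>2 = 1"
        using i by (auto simp: P2_def)
      then have "1 / C \<le> dirichlet E P2 P2"
        using C(2)[of P2 k i] C(1) by (simp add: field_simps)
      then have "m1 * (1 / C) \<le> m1 * dirichlet E P2 P2"
        using m1 by (intro mult_left_mono) auto
      then have "m1 / C \<le> dirichlet E P2 w"
        using T2 by simp
      then have "m1 / C / (2 * n) \<le> dirichlet E P2 w / (2 * n)"
        using n1 by (intro divide_right_mono) auto
      moreover define \<kappa> where "\<kappa> = m1 / (8 * n * C)"
      moreover have "m1 / C / (2 * n) = 4 * \<kappa>"
        using C(1) n1 by (simp add: \<kappa>_def field_simps)
      ultimately have "c * (4 * \<kappa>) \<le> c * (dirichlet E P2 w / (2 * n))"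
        using pos by (intro mult_left_mono) auto
      moreover have "c * (n\<^sup>2 * m0) \<le> c * \<kappa>"
        using small(1) pos unfolding \<kappa>_def by (intro mult_left_mono) auto
      moreover have "u * (\<Sum>i\<in>UNIV. p i) - n * u * clip (u / u0) \<le> c * \<kappa>"
      proof (cases "u \<ge> u0")
        case True
        have "0 \<le> c * \<kappa>" using pos m1 n1 C(1) by (simp add: \<kappa>_def)
        then show ?thesis using large_u[OF True] u by linarith
      next
        case False
        have "u * (\<Sum>i\<in>UNIV. p i) \<le> u * n"
          using sum_p u by (intro mult_left_mono) auto
        also have "\<dots> \<le> u0 * n"
          using False n1 by (intro mult_right_mono) auto
        also have "\<dots> \<le> 2 * n * u0"
          using n1 pos by simp
        finally have "u * (\<Sum>i\<in>UNIV. p i) \<le> c * \<kappa>"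
          using small(2) by (simp add: \<kappa>_def)
        moreover have "0 \<le> clip (u / u0)"
          using clip_mono[of 0 "u / u0"] u pos by simp
        then have "0 \<le> n * u * clip (u / u0)"
          using u n1 by simp
        ultimately show ?thesis by linarith
      qed
      moreover have "0 < c * \<kappa>" using pos m1 n1 C(1) by (simp add: \<kappa>_def)
      ultimately show ?thesis
        using D1 by linarith
    next
      case False
      then have "u \<ge> \<eta>" using bump[OF i(1)] by blast
      then have "u * (\<Sum>i\<in>UNIV. p i) - n * u * clip (u / u0) \<le> - u / 2"
        using large_u pos by linarith
      moreover have "0 \<le> c * (dirichlet E P2 w / (2 * n))"
        using D2 pos n1 by simp
      ultimately show ?thesis
        using D1 small(3) \<open>u \<ge> \<eta>\<close> pos by linarith
    qed
  next
    case False
    then have B0: "B i = 0" for i by blast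
    \<comment> \<open>The largest positive part of the steep truncations. Since some
      \<open>P1 j\<close> is nonpositive, \<open>\<omega>\<close> is at most the oscillation of
      \<open>P1\<close> over the graph, or 0, and is thus controlled by the Dirichlet form.\<close>
    define \<omega> where "\<omega> = Max (range (\<lambda>i. max 0 (P1 i)))"
    have \<omega>_ge: "max 0 (P1 i) \<le> \<omega>" for i
      unfolding \<omega>_def by (intro Max_ge) auto
    have "\<omega> \<in> range (\<lambda>i. max 0 (P1 i))"
      unfolding \<omega>_def by (intro Max_in) auto
    then obtain i where i: "\<omega> = max 0 (P1 i)" by blast
    have \<omega>0: "\<omega> \<ge> 0" using i by simp
    have P1j: "P1 j \<le> 0" unfolding P1_def by (rule neg[OF pos(2)])
    have D1: "c * (m0 * dirichlet E P1 P1) \<le> c * dirichlet E p w"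
    proof -
      have "dirichlet E p w = dirichlet E P1 w + dirichlet E P2 w / (2 * n)"
        unfolding split B0 by simp
      moreover have "0 \<le> dirichlet E P2 w / (2 * n)" using D2 n1 by simp
      ultimately show ?thesis
        using T1 pos by (intro mult_left_mono) auto
    qed
    have PC: "\<omega>\<^sup>2 \<le> C * dirichlet E P1 P1"
    proof (cases "P1 i \<ge> 0")
      case True
      then have "\<omega>\<^sup>2 \<le> (P1 i - P1 j)\<^sup>2"
        using i P1j by (intro power_mono) auto
      then show ?thesis using C(2)[of P1 i j] by linarith
    next
      case False
      then show ?thesis using i C(1) dnn[of P1] by simp
    qed
    show ?thesis
    proof (cases "u = 0")
      case True
      have "dirichlet E P1 P1 > 0"
      proof (rule ccontr)
        assume "\<not> dirichlet E P1 P1 > 0"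
        then have "(P1 a - P1 b)\<^sup>2 \<le> 0" for a b
          using C(2)[of P1 a b] dnn[of P1] C(1) by (smt (verit) mult_eq_0_iff)
        then have eq: "P1 a = P1 b" for a b
          by simp
        obtain k where "w k \<ge> 0" using high[OF True] by blast
        then have "P1 k \<ge> 0"
          unfolding P1_def using clip_mono[of 0 "w k / m0"] pos by simp
        then have "P1 a = 0" for a
          using P1j eq[of a j] eq[of k j] by linarith
        then have "clip (w a / m0) = 0" for a by (simp add: P1_def)
        then have "w a = 0" for a
          using pos by (simp add: clip_def) (smt (verit, best) divide_eq_0_iff)
        then show False using nontriv True by blast
      qed
      then have "0 < c * (m0 * dirichlet E P1 P1)" using pos by simp
      then show ?thesis using D1 True by simp
    next
      case False
      then have u0: "u > 0" using u by simp
      have lam: "0 \<le> c * (m0 * dirichlet E P1 P1)" using pos dnn by simp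
      show ?thesis
      proof (cases "u \<ge> u0")
        case True
        then show ?thesis using large_u[OF True] u0 D1 lam by linarith
      next
        case u_small: False
        have hu: "clip (u / u0) = u / u0"
          using u_small u pos by (simp add: clip_def) (smt (verit) divide_le_eq_1_pos divide_nonneg_pos)
        have p_om: "p i \<le> 2 * \<omega>" for i
        proof -
          have "P2 i \<le> max 0 (P1 i)"
          proof (cases "w i \<ge> 0")
            case True
            then have "w i / m1 \<le> w i / m0"
              using pos by (intro divide_left_mono) auto
            then show ?thesis unfolding P1_def P2_def by (smt (verit) clip_mono)
          next
            case False
            then have "P2 i \<le> 0"
              unfolding P2_def using clip_mono[of "w i / m1" 0] m1 by (simp add: divide_nonpos_pos)
            then show ?thesis by simp
          qed
          then have "P2 i \<le> \<omega>" using \<omega>_ge[of i] by linarith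
          then have "P2 i / (2 * n) \<le> \<omega> / (2 * n)" using n1 by (intro divide_right_mono) auto
          also have "\<dots> \<le> \<omega> / 1" using \<omega>0 n1 by (intro divide_left_mono) auto
          finally show ?thesis
            using \<omega>_ge[of i] B0 by (simp add: p P1_def P2_def)
        qed
        have "(\<Sum>i\<in>UNIV. p i) \<le> (\<Sum>i\<in>(UNIV::'n set). 2 * \<omega>)"
          by (intro sum_mono p_om)
        then have "(\<Sum>i\<in>UNIV. p i) \<le> 2 * n * \<omega>" by (simp add: n_def)
        then have sp: "u * (\<Sum>i\<in>UNIV. p i) \<le> u * (2 * n * \<omega>)"
          using u by (intro mult_left_mono)
        have dC: "c * m0 * \<omega>\<^sup>2 / C \<le> c * (m0 * dirichlet E P1 P1)"
        proof -
          have "c * m0 * \<omega>\<^sup>2 \<le> c * m0 * (C * dirichlet E P1 P1)"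
            using PC pos by (intro mult_left_mono) auto
          then show ?thesis using C(1) by (simp add: field_simps)
        qed
        \<comment> \<open>Completing the square in \<open>u - \<omega> * u0\<close> splits the mixed
          term; the leftover \<open>n * u0\<close> times the square of \<open>\<omega>\<close> is
          beaten by the Poincare term because \<open>u0 * n * C < c * m0\<close>. For
          \<open>\<omega> = 0\<close> strictness comes from \<open>u > 0\<close>.\<close>
        have key: "u * (2 * n * \<omega>) < n * u * (u / u0) + c * m0 * \<omega>\<^sup>2 / C"
        proof (cases "\<omega> = 0")
          case True
          then show ?thesis using u0 pos n1 by simp
        next
          case False
          have "n * \<omega>\<^sup>2 * u0 < c * m0 * \<omega>\<^sup>2 / C"
          proof -
            have "u0 * n * C * \<omega>\<^sup>2 < c * m0 * \<omega>\<^sup>2"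
              using small(4) False by (intro mult_strict_right_mono) auto
            then show ?thesis using C(1) by (simp add: field_simps)
          qed
          moreover have "u * (2 * n * \<omega>) \<le> n * u * (u / u0) + n * \<omega>\<^sup>2 * u0"
          proof -
            have "0 \<le> n * (u - \<omega> * u0)\<^sup>2 / u0" using n1 pos by simp
            also have "\<dots> = n * u * (u / u0) + n * \<omega>\<^sup>2 * u0 - u * (2 * n * \<omega>)"
              using pos by (simp add: field_simps power2_eq_square)
            finally show ?thesis by simp
          qed
          ultimately show ?thesis by linarith
        qed
        show ?thesis using key sp dC D1 unfolding hu by linarith
      qed
    qed
  qed
qed

section \<open>Weights of the Lyapunov function\<close>

lemma mem_box_domain: "x \<in> box_domain lo hi \<longleftrightarrow> (\<forall>i. lo $ i \<le> x $ i \<and> x $ i \<le> hi $ i)"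
  by (simp add: box_domain_def)

lemma compact_box_domain: "compact (box_domain lo hi)"
proof -
  have "box_domain lo hi = cbox lo hi"
    by (auto simp: mem_box_domain mem_box_cart)
  then show ?thesis
    by simp
qed

text \<open>Subtracting the multiplier from the derivatives leaves monotone Lipschitz functions
  whose common zeros on the constraint set are solutions. Strict feasibility becomes the assumption
  \<open>interior\<close>; \<open>xs\<close> is one fixed solution, the reference point for
  signs.\<close>

locale consensus_flow =
  fixes w :: "'n::finite \<Rightarrow> real \<Rightarrow> real" and E :: "('n \<times> 'n) set"
    and lo hi xs :: "real^'n" and c gbar \<Lambda> :: real
  assumes sym: "sym E" and connected: "connected_graph E" and c_pos: "c > 0"
    and mono: "\<And>i. mono (w i)" and lip: "\<And>i. \<Lambda>-lipschitz_on UNIV (w i)"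
    and xs_interior: "\<And>i. lo $ i < xs $ i" "\<And>i. xs $ i < hi $ i"
    and xs_zero: "\<And>i. w i (xs $ i) = 0" and xs_sum: "(\<Sum>i\<in>UNIV. xs $ i) = gbar"
    and interior: "\<And>x i. x \<in> box_domain lo hi \<Longrightarrow> (\<And>j. w j (x $ j) = 0) \<Longrightarrow>
      (\<Sum>j\<in>UNIV. x $ j) = gbar \<Longrightarrow> lo $ i < x $ i \<and> x $ i < hi $ i"
begin

definition excess :: "real^'n \<Rightarrow> real" where
  "excess x = (\<Sum>i\<in>UNIV. x $ i) - gbar"

definition vel :: "real^'n \<Rightarrow> 'n \<Rightarrow> real" where
  "vel x i = - c * (\<Sum>j\<in>nbrs E i. w i (x $ i) - w j (x $ j)) - excess x"

lemma w_mono: "s \<le> t \<Longrightarrow> w i s \<le> w i t"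
  using mono[of i] by (rule monoD)

lemma w_lip: "\<bar>w i s - w i t\<bar> \<le> \<Lambda> * \<bar>s - t\<bar>"
  using lipschitz_onD[OF lip[of i], of s t] by (simp add: dist_real_def)

lemma Lambda_nonneg: "\<Lambda> \<ge> 0"
  using lipschitz_on_nonneg[OF lip] .

lemma w_continuous: "continuous_on A (w i)"
  using lipschitz_on_continuous_on[OF lip] continuous_on_subset by blast

lemma w_continuous_nth [continuous_intros]: "continuous_on A (\<lambda>x. w i (x $ i))"
  by (rule continuous_on_compose2[OF w_continuous[of UNIV]]) (auto intro!: continuous_intros)

lemma excess_continuous [continuous_intros]: "continuous_on A excess"
  unfolding excess_def by (intro continuous_intros)

lemma vel_continuous [continuous_intros]: "continuous_on A (\<lambda>x. vel x i)"
  unfolding vel_def by (intro continuous_intros)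

lemma w_zero_between:
  assumes "w i a = 0" "w i b = 0" "a \<le> t" "t \<le> b"
  shows "w i t = 0"
  using w_mono[OF assms(3), of i] w_mono[OF assms(4), of i] assms by linarith

text \<open>
  Otherwise coordinates could be moved along intervals where \<open>w\<close> vanishes so as to reach a solution on
  the boundary.
\<close>

lemma not_saturated:
  assumes "w i (hi $ i) = 0" "x \<in> box_domain lo hi" "x $ i = hi $ i"
    "\<And>j. w j (x $ j) \<ge> 0"
  shows "excess x > 0"
proof (rule ccontr)
  assume "\<not> excess x > 0"
  then have le: "(\<Sum>j\<in>UNIV. x $ j) \<le> gbar"
    by (simp add: excess_def)
  \<comment> \<open>Two profiles with coordinate \<open>i\<close> at the upper end, all
    \<open>w j\<close> zero, and totals on either side of \<open>gbar\<close>; the point between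
    them with total \<open>gbar\<close> is a solution on the boundary. At \<open>a\<close>, where
    \<open>x $ j\<close> is below \<open>xs $ j\<close>, the value \<open>w j (x $ j)\<close> is
    nonnegative by assumption and nonpositive by monotonicity.\<close>
  define a where "a = (\<chi> j. if j = i then hi $ i else min (x $ j) (xs $ j))"
  define b where "b = (\<chi> j. if j = i then hi $ i else xs $ j)"
  have "(\<Sum>j\<in>UNIV. a $ j) \<le> (\<Sum>j\<in>UNIV. x $ j)"
    by (intro sum_mono) (auto simp: a_def assms(3))
  then have sa: "(\<Sum>j\<in>UNIV. a $ j) \<le> gbar"
    using le by linarith
  have "(\<Sum>j\<in>UNIV. xs $ j) < (\<Sum>j\<in>UNIV. b $ j)"
    using xs_interior by (intro sum_strict_mono2[where b = i] sum_strict_mono_ex1) (auto simp: b_def less_imp_le intro!: bexI[of _ i])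
  then have sb: "gbar < (\<Sum>j\<in>UNIV. b $ j)"
    by (simp add: xs_sum)
  have wa: "w j (a $ j) = 0" for j
  proof -
    have "w j (x $ j) = 0" if "x $ j \<le> xs $ j"
      using w_mono[OF that, of j] assms(4)[of j] xs_zero[of j] by linarith
    then show ?thesis
      by (auto simp: a_def assms(1) xs_zero min_def)
  qed
  have wb: "w j (b $ j) = 0" for j
    by (auto simp: b_def assms(1) xs_zero)
  have ab: "lo $ j \<le> a $ j" "a $ j \<le> b $ j" "b $ j \<le> hi $ j" for j
    using assms(2) xs_interior(1)[of j] xs_interior(2)[of j]
    by (auto simp: a_def b_def mem_box_domain intro: less_imp_le order_trans)
  define t where "t = (gbar - (\<Sum>j\<in>UNIV. a $ j)) / ((\<Sum>j\<in>UNIV. b $ j) - (\<Sum>j\<in>UNIV. a $ j))"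
  have t: "0 \<le> t" "t \<le> 1"
    using sa sb by (auto simp: t_def field_simps)
  define z where "z = a + t *\<^sub>R (b - a)"
  have z: "a $ j \<le> z $ j" "z $ j \<le> b $ j" for j
  proof -
    show "a $ j \<le> z $ j"
      using t ab[of j] by (simp add: z_def)
    have "t * (b $ j - a $ j) \<le> 1 * (b $ j - a $ j)"
      using t ab[of j] by (intro mult_right_mono) auto
    then show "z $ j \<le> b $ j"
      by (simp add: z_def)
  qed
  have "lo $ i < z $ i \<and> z $ i < hi $ i"
  proof (rule interior)
    show "z \<in> box_domain lo hi"
      unfolding mem_box_domain using order_trans[OF ab(1) z(1)] order_trans[OF z(2) ab(3)] by blast
    show "w j (z $ j) = 0" for j
      using w_zero_between[OF wa wb z] .
    have "(\<Sum>j\<in>UNIV. z $ j) = (\<Sum>j\<in>UNIV. a $ j) + t * ((\<Sum>j\<in>UNIV. b $ j) - (\<Sum>j\<in>UNIV. a $ j))"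
      by (simp add: z_def sum.distrib sum_distrib_left[symmetric] sum_subtractf)
    then show "(\<Sum>j\<in>UNIV. z $ j) = gbar"
      using sa sb by (simp add: t_def)
  qed
  moreover have "z $ i = hi $ i"
    by (simp add: z_def a_def b_def)
  ultimately show False
    by simp
qed

text \<open>Compactness makes \<open>not_saturated\<close> quantitative: the function
  \<open>g\<close> in the proof measures the violation of its conditions and is positive and
  continuous on the box. Dividing its minimum by the number of loads accounts for the sum over
  \<open>j\<close>. The claim covers all small \<theta>, so that one value can later serve every
  coordinate and both ends.\<close>

lemma top_margin:
  assumes "w i (hi $ i) = 0"
  shows "\<exists>T>0. \<forall>\<theta>. 0 < \<theta> \<and> \<theta> \<le> T \<longrightarrow> (\<forall>x\<in>box_domain lo hi. hi $ i - \<theta> < x $ i \<longrightarrow>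
    (\<exists>j. w j (x $ j) \<le> - \<theta>) \<or> \<theta> \<le> excess x)"
proof -
  define g where "g x = max (hi $ i - x $ i) (max (excess x) (\<Sum>j\<in>UNIV. max 0 (- w j (x $ j))))" for x
  have g_pos: "g x > 0" if x: "x \<in> box_domain lo hi" for x
  proof (rule ccontr)
    assume "\<not> g x > 0"
    then have *: "hi $ i - x $ i \<le> 0" "excess x \<le> 0" "(\<Sum>j\<in>UNIV. max 0 (- w j (x $ j))) \<le> 0"
      by (auto simp: g_def)
    have "max 0 (- w j (x $ j)) \<le> (\<Sum>j\<in>UNIV. max 0 (- w j (x $ j)))" for j
      by (rule member_le_sum) auto
    then have "w j (x $ j) \<ge> 0" for j
      using *(3) by (smt (verit) max.cobounded2)
    moreover have "x $ i = hi $ i"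
      using *(1) x by (auto simp: mem_box_domain intro: antisym)
    ultimately show False
      using not_saturated[OF assms x] *(2) by auto
  qed
  have "xs \<in> box_domain lo hi"
    using xs_interior by (auto simp: mem_box_domain less_imp_le)
  moreover have "continuous_on (box_domain lo hi) g"
    unfolding g_def by (intro continuous_intros)
  ultimately obtain x0 where x0: "x0 \<in> box_domain lo hi" "\<forall>x\<in>box_domain lo hi. g x0 \<le> g x"
    using continuous_attains_inf[OF compact_box_domain] by blast
  define n where "n = real CARD('n)"
  have n: "n \<ge> 1"
    unfolding n_def by (simp add: Suc_leI)
  have "(\<exists>j. w j (x $ j) \<le> - \<theta>) \<or> \<theta> \<le> excess x"
    if \<theta>: "0 < \<theta>" "\<theta> \<le> g x0 / n" and x: "x \<in> box_domain lo hi" "hi $ i - \<theta> < x $ i" for \<theta> x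
  proof (rule ccontr)
    assume neg: "\<not> ?thesis"
    have "\<theta> * n \<le> g x0"
      using \<theta> n by (simp add: field_simps)
    moreover have "\<theta> \<le> \<theta> * n"
      using \<theta> n by simp
    moreover have "(\<Sum>j\<in>UNIV. max 0 (- w j (x $ j))) < (\<Sum>j\<in>(UNIV::'n set). \<theta>)"
      using neg \<theta> by (intro sum_strict_mono) (auto simp: not_le minus_less_iff)
    then have "(\<Sum>j\<in>UNIV. max 0 (- w j (x $ j))) < \<theta> * n"
      by (simp add: n_def mult.commute)
    ultimately have "g x < g x0"
      using neg x unfolding g_def[of x] by auto
    then show False
      using x0 x by fastforce
  qed
  moreover have "g x0 / n > 0"
    using g_pos[OF x0(1)] n by simp
  ultimately show ?thesis
    by blast
qed

end

text \<open>Changing the sign of all variables preserves the setting and exchanges the two ends of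
  the box; facts about lower ends follow from those about upper ends.\<close>

lemma (in consensus_flow) reflect:
  "consensus_flow (\<lambda>i t. - w i (- t)) E (- hi) (- lo) (- xs) c (- gbar) \<Lambda>"
proof (unfold_locales, goal_cases)
  case 1 show ?case by (rule sym)
next
  case 2 show ?case by (rule connected)
next
  case 3 show ?case by (rule c_pos)
next
  case (4 i) show ?case by (auto simp: mono_def w_mono)
next
  case (5 i) show ?case
  proof (rule lipschitz_onI)
    show "dist (- w i (- s)) (- w i (- t)) \<le> \<Lambda> * dist s t" for s t
      using w_lip[of i "- s" "- t"] by (simp add: dist_real_def abs_minus_commute)
  qed (rule Lambda_nonneg)
next
  case (6 i) show ?case using xs_interior[of i] by simp
next
  case (7 i) show ?case using xs_interior[of i] by simp
next
  case (8 i) show ?case by (simp add: xs_zero)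
next
  case 9 show ?case by (simp add: sum_negf xs_sum)
next
  case (10 x i)
  have "- x \<in> box_domain lo hi"
    using 10(1) by (auto simp: mem_box_domain le_minus_iff minus_le_iff)
  then have "lo $ i < (- x) $ i \<and> (- x) $ i < hi $ i"
    using 10 by (intro interior) (auto simp: sum_negf)
  then show ?case by auto
qed

context consensus_flow
begin

lemma bottom_margin:
  assumes "w i (lo $ i) = 0"
  shows "\<exists>T>0. \<forall>\<theta>. 0 < \<theta> \<and> \<theta> \<le> T \<longrightarrow> (\<forall>x\<in>box_domain lo hi. x $ i < lo $ i + \<theta> \<longrightarrow>
    (\<exists>j. \<theta> \<le> w j (x $ j)) \<or> \<theta> \<le> - excess x)"
proof -
  interpret r: consensus_flow "\<lambda>i t. - w i (- t)" E "- hi" "- lo" "- xs" c "- gbar" \<Lambda>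
    by (rule reflect)
  obtain T where T: "T > 0" "\<And>\<theta> x. 0 < \<theta> \<Longrightarrow> \<theta> \<le> T \<Longrightarrow> x \<in> box_domain (- hi) (- lo) \<Longrightarrow>
      (- lo) $ i - \<theta> < x $ i \<Longrightarrow> (\<exists>j. - w j (- x $ j) \<le> - \<theta>) \<or> \<theta> \<le> r.excess x"
    using r.top_margin[of i] assms by auto
  show ?thesis
  proof (intro exI[of _ T] conjI allI impI ballI)
    fix \<theta> x assume *: "0 < \<theta> \<and> \<theta> \<le> T" "x \<in> box_domain lo hi" "x $ i < lo $ i + \<theta>"
    then have "- x \<in> box_domain (- hi) (- lo)"
      by (auto simp: mem_box_domain)
    moreover have "r.excess (- x) = - excess x"
      by (simp add: r.excess_def excess_def sum_negf)
    ultimately show "(\<exists>j. \<theta> \<le> w j (x $ j)) \<or> \<theta> \<le> - excess x"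
      using T(2)[of \<theta> "- x"] * by auto
  qed (rule T(1))
qed

text \<open>Where \<open>w i\<close> does not vanish at an end of the box, monotonicity and the
  interior zero \<open>xs $ i\<close> fix its sign there. Finitely many positive thresholds then
  have a common positive lower bound.\<close>

lemma margin:
  obtains \<theta> where "\<theta> > 0"
    "\<And>i x. w i (hi $ i) = 0 \<Longrightarrow> x \<in> box_domain lo hi \<Longrightarrow> hi $ i - \<theta> < x $ i \<Longrightarrow>
      (\<exists>j. w j (x $ j) \<le> - \<theta>) \<or> \<theta> \<le> excess x"
    "\<And>i x. w i (lo $ i) = 0 \<Longrightarrow> x \<in> box_domain lo hi \<Longrightarrow> x $ i < lo $ i + \<theta> \<Longrightarrow>
      (\<exists>j. \<theta> \<le> w j (x $ j)) \<or> \<theta> \<le> - excess x"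
    "\<And>i. w i (hi $ i) \<noteq> 0 \<Longrightarrow> \<theta> \<le> w i (hi $ i)"
    "\<And>i. w i (lo $ i) \<noteq> 0 \<Longrightarrow> w i (lo $ i) \<le> - \<theta>"
    "\<And>i. \<theta> \<le> hi $ i - xs $ i" "\<And>i. \<theta> \<le> xs $ i - lo $ i"
proof -
  have "\<exists>T>0. w i (hi $ i) = 0 \<longrightarrow> (\<forall>\<theta>. 0 < \<theta> \<and> \<theta> \<le> T \<longrightarrow>
      (\<forall>x\<in>box_domain lo hi. hi $ i - \<theta> < x $ i \<longrightarrow> (\<exists>j. w j (x $ j) \<le> - \<theta>) \<or> \<theta> \<le> excess x))" for i
    by (cases "w i (hi $ i) = 0") (use top_margin[of i] in \<open>auto intro: zero_less_one\<close>)
  then obtain T1 where T1: "\<And>i. T1 i > 0" "\<And>i \<theta> x. w i (hi $ i) = 0 \<Longrightarrow> 0 < \<theta> \<Longrightarrow> \<theta> \<le> T1 i \<Longrightarrow>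
      x \<in> box_domain lo hi \<Longrightarrow> hi $ i - \<theta> < x $ i \<Longrightarrow> (\<exists>j. w j (x $ j) \<le> - \<theta>) \<or> \<theta> \<le> excess x"
    by metis
  have "\<exists>T>0. w i (lo $ i) = 0 \<longrightarrow> (\<forall>\<theta>. 0 < \<theta> \<and> \<theta> \<le> T \<longrightarrow>
      (\<forall>x\<in>box_domain lo hi. x $ i < lo $ i + \<theta> \<longrightarrow> (\<exists>j. \<theta> \<le> w j (x $ j)) \<or> \<theta> \<le> - excess x))" for i
    by (cases "w i (lo $ i) = 0") (use bottom_margin[of i] in \<open>auto intro: zero_less_one\<close>)
  then obtain T2 where T2: "\<And>i. T2 i > 0" "\<And>i \<theta> x. w i (lo $ i) = 0 \<Longrightarrow> 0 < \<theta> \<Longrightarrow> \<theta> \<le> T2 i \<Longrightarrow>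
      x \<in> box_domain lo hi \<Longrightarrow> x $ i < lo $ i + \<theta> \<Longrightarrow> (\<exists>j. \<theta> \<le> w j (x $ j)) \<or> \<theta> \<le> - excess x"
    by metis
  define T3 where "T3 i = (if w i (hi $ i) = 0 then 1 else w i (hi $ i))" for i
  define T4 where "T4 i = (if w i (lo $ i) = 0 then 1 else - w i (lo $ i))" for i
  have T3: "T3 i > 0" for i
    using w_mono[OF less_imp_le[OF xs_interior(2)[of i]], of i] by (simp add: T3_def xs_zero)
  have T4: "T4 i > 0" for i
    using w_mono[OF less_imp_le[OF xs_interior(1)[of i]], of i] by (simp add: T4_def xs_zero)
  define T where "T i = Min {T1 i, T2 i, T3 i, T4 i, hi $ i - xs $ i, xs $ i - lo $ i}" for i
  have T: "T i \<le> T1 i" "T i \<le> T2 i" "T i \<le> T3 i" "T i \<le> T4 i" "T i \<le> hi $ i - xs $ i"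
      "T i \<le> xs $ i - lo $ i" "T i > 0" for i
    using T1(1)[of i] T2(1)[of i] T3[of i] T4[of i] xs_interior[of i] by (auto simp: T_def)
  define \<theta> where "\<theta> = Min (range T)"
  have \<theta>: "\<theta> \<le> T i" for i
    unfolding \<theta>_def by (rule Min_le) auto
  have "\<theta> > 0"
    unfolding \<theta>_def using T(7) by (subst Min_gr_iff) auto
  show thesis
  proof (rule that[of \<theta>])
    show "\<theta> > 0" by fact
    show "(\<exists>j. w j (x $ j) \<le> - \<theta>) \<or> \<theta> \<le> excess x"
      if "w i (hi $ i) = 0" "x \<in> box_domain lo hi" "hi $ i - \<theta> < x $ i" for i x
      using T1(2)[OF that(1) \<open>\<theta> > 0\<close> order_trans[OF \<theta> T(1)] that(2,3)] .
    show "(\<exists>j. \<theta> \<le> w j (x $ j)) \<or> \<theta> \<le> - excess x"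
      if "w i (lo $ i) = 0" "x \<in> box_domain lo hi" "x $ i < lo $ i + \<theta>" for i x
      using T2(2)[OF that(1) \<open>\<theta> > 0\<close> order_trans[OF \<theta> T(2)] that(2,3)] .
    show "\<theta> \<le> w i (hi $ i)" if "w i (hi $ i) \<noteq> 0" for i
      using order_trans[OF \<theta> T(3)[of i]] that by (simp add: T3_def)
    show "w i (lo $ i) \<le> - \<theta>" if "w i (lo $ i) \<noteq> 0" for i
      using order_trans[OF \<theta> T(4)[of i]] that by (simp add: T4_def)
    show "\<theta> \<le> hi $ i - xs $ i" for i
      using order_trans[OF \<theta> T(5)[of i]] .
    show "\<theta> \<le> xs $ i - lo $ i" for i
      using order_trans[OF \<theta> T(6)[of i]] .
  qed
qed

text \<open>A constant \<open>h\<close> added to the weights drops out of the Dirichlet form and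
  meets only the total drift, to which the Laplacian contributes 0. This is how the slope of
  \<open>G\<close> enters.\<close>

lemma sum_vel:
  "(\<Sum>i\<in>UNIV. (q i + h) * vel x i)
    = - c * dirichlet E q (\<lambda>i. w i (x $ i)) - excess x * (\<Sum>i\<in>UNIV. q i) - real CARD('n) * h * excess x"
proof -
  let ?w = "\<lambda>i. w i (x $ i)"
  define S where "S i = (\<Sum>j\<in>nbrs E i. ?w i - ?w j)" for i
  have "(\<Sum>i\<in>UNIV. (q i + h) * vel x i) = (\<Sum>i\<in>UNIV. - c * ((q i + h) * S i) - (q i + h) * excess x)"
    by (intro sum.cong refl) (simp add: vel_def S_def[symmetric] algebra_simps)
  also have "\<dots> = - c * (\<Sum>i\<in>UNIV. (q i + h) * (\<Sum>j\<in>nbrs E i. ?w i - ?w j)) - (\<Sum>i\<in>UNIV. (q i + h) * excess x)"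
    by (simp only: sum_subtractf sum_distrib_left S_def)
  also have "(\<Sum>i\<in>UNIV. (q i + h) * (\<Sum>j\<in>nbrs E i. ?w i - ?w j)) = dirichlet E q ?w"
    using sum_laplacian[OF sym, of "\<lambda>i. q i + h" ?w] by (simp add: dirichlet_def)
  also have "(\<Sum>i\<in>UNIV. (q i + h) * excess x) = excess x * (\<Sum>i\<in>UNIV. q i) + real CARD('n) * h * excess x"
    by (simp add: sum_distrib_right sum.distrib distrib_right mult.commute[of "excess x"])
  finally show ?thesis
    by simp
qed

lemma exists_le_xs:
  assumes "excess x \<le> 0"
  shows "\<exists>j. x $ j \<le> xs $ j"
proof (rule ccontr)
  assume "\<not> ?thesis"
  then have "(\<Sum>j\<in>UNIV. xs $ j) < (\<Sum>j\<in>UNIV. x $ j)"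
    by (intro sum_strict_mono) (auto simp: not_le)
  then show False
    using assms by (simp add: excess_def xs_sum)
qed

lemma exists_ge_xs:
  assumes "excess x \<ge> 0"
  shows "\<exists>j. x $ j \<ge> xs $ j"
proof (rule ccontr)
  assume "\<not> ?thesis"
  then have "(\<Sum>j\<in>UNIV. x $ j) < (\<Sum>j\<in>UNIV. xs $ j)"
    by (intro sum_strict_mono) (auto simp: not_le)
  then show False
    using assms by (simp add: excess_def xs_sum)
qed

text \<open>
  The bounds \<open>1 \<le> p i (hi $ i)\<close> and \<open>p i (lo $ i) \<le> - 1\<close> are what makes the projection harmless. A term
  vanishing with \<open>w i\<close> cannot satisfy them if \<open>w i\<close> is zero at an end of the box, hence the bumps \<open>Bt\<close>
  and \<open>Bb\<close> there.
\<close>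

lemma lyapunov_weights:
  obtains p :: "'n \<Rightarrow> real \<Rightarrow> real" and u0 K where "u0 > 0" "K \<ge> 0"
    "\<And>i s t. s \<le> t \<Longrightarrow> p i s \<le> p i t"
    "\<And>i s t. \<bar>p i s - p i t\<bar> \<le> K * \<bar>s - t\<bar>"
    "\<And>i. p i (hi $ i) \<ge> 1" "\<And>i. p i (lo $ i) \<le> - 1"
    "\<And>x i. x \<in> box_domain lo hi \<Longrightarrow> excess x = 0 \<Longrightarrow> (\<And>j. w j (x $ j) = 0) \<Longrightarrow> p i (x $ i) = 0"
    "\<And>x. x \<in> box_domain lo hi \<Longrightarrow> excess x \<noteq> 0 \<or> (\<exists>i. w i (x $ i) \<noteq> 0) \<Longrightarrow>
      (\<Sum>i\<in>UNIV. (p i (x $ i) + clip (excess x / u0)) * vel x i) < 0"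
proof -
  obtain \<theta> where \<theta>: "\<theta> > 0" and
    top: "\<And>i x. w i (hi $ i) = 0 \<Longrightarrow> x \<in> box_domain lo hi \<Longrightarrow> hi $ i - \<theta> < x $ i \<Longrightarrow>
      (\<exists>j. w j (x $ j) \<le> - \<theta>) \<or> \<theta> \<le> excess x" and
    bottom: "\<And>i x. w i (lo $ i) = 0 \<Longrightarrow> x \<in> box_domain lo hi \<Longrightarrow> x $ i < lo $ i + \<theta> \<Longrightarrow>
      (\<exists>j. \<theta> \<le> w j (x $ j)) \<or> \<theta> \<le> - excess x" and
    w_hi: "\<And>i. w i (hi $ i) \<noteq> 0 \<Longrightarrow> \<theta> \<le> w i (hi $ i)" and
    w_lo: "\<And>i. w i (lo $ i) \<noteq> 0 \<Longrightarrow> w i (lo $ i) \<le> - \<theta>" and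
    gap: "\<And>i. \<theta> \<le> hi $ i - xs $ i" "\<And>i. \<theta> \<le> xs $ i - lo $ i"
    by (rule margin) blast
  obtain C where C: "C > 0" "\<And>z i j. (z i - z j)\<^sup>2 \<le> C * dirichlet E z z"
    using poincare[OF connected] by metis
  define n where "n = real CARD('n)"
  have n: "n \<ge> 1"
    unfolding n_def by (simp add: Suc_leI)
  \<comment> \<open>The entries of the minima are the smallness conditions of
    \<open>drift_neg\<close>, with \<open>m1\<close> and \<open>\<eta>\<close> both equal to
    \<theta>, solved for \<open>m0\<close> and then for \<open>u0\<close>. The 2 in the last entry
    of \<open>u0\<close> makes that inequality strict.\<close>
  define m0 where "m0 = min \<theta> (min (\<theta> / (8 * n * C) / n\<^sup>2) (\<theta> / (4 * c * n\<^sup>2)))"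
  have m0_le: "m0 \<le> \<theta>" "m0 \<le> \<theta> / (8 * n * C) / n\<^sup>2" "m0 \<le> \<theta> / (4 * c * n\<^sup>2)" and m0_pos: "m0 > 0"
    using \<theta> n C(1) c_pos by (auto simp: m0_def)
  define u0 where "u0 = min \<theta> (min (c * (\<theta> / (8 * n * C)) / (2 * n)) (c * m0 / (2 * n * C)))"
  have u0_le: "u0 \<le> \<theta>" "u0 \<le> c * (\<theta> / (8 * n * C)) / (2 * n)" "u0 \<le> c * m0 / (2 * n * C)"
    and u0_pos: "u0 > 0"
    using \<theta> n C(1) c_pos m0_pos by (auto simp: u0_def)
  have small: "n\<^sup>2 * m0 \<le> \<theta> / (8 * n * C)" "2 * n * u0 \<le> c * (\<theta> / (8 * n * C))"
      "4 * c * (n\<^sup>2 * m0) \<le> \<theta>" "u0 * n * C < c * m0"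
  proof -
    have n2: "n\<^sup>2 > 0"
      using n by simp
    show "n\<^sup>2 * m0 \<le> \<theta> / (8 * n * C)"
      using mult_left_mono[OF m0_le(2), of "n\<^sup>2"] n2 by simp
    show "2 * n * u0 \<le> c * (\<theta> / (8 * n * C))"
      using mult_left_mono[OF u0_le(2), of "2 * n"] n by (simp add: mult_ac)
    show "4 * c * (n\<^sup>2 * m0) \<le> \<theta>"
      using mult_left_mono[OF m0_le(3), of "4 * c * n\<^sup>2"] n2 c_pos by (simp add: mult.assoc)
    have "u0 * (n * C) \<le> c * m0 / (2 * n * C) * (n * C)"
      using u0_le(3) n C(1) by (intro mult_right_mono) auto
    also have "\<dots> = c * m0 / 2"
      using n C(1) by simp
    also have "\<dots> < c * m0"
      using c_pos m0_pos by simp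
    finally show "u0 * n * C < c * m0"
      by (simp add: mult.assoc)
  qed
  \<comment> \<open>Ramps of width \<theta> that reach height 1 at the end, just enough to dominate
    the slope of \<open>G\<close>. Inside the box they live between \<open>xs $ i\<close> and that
    end, where \<open>w i\<close> vanishes because it does so at both points.\<close>
  define Bt where "Bt i t = (if w i (hi $ i) = 0 then max 0 (1 - (hi $ i - t) / \<theta>) else 0)" for i t
  define Bb where "Bb i t = (if w i (lo $ i) = 0 then max 0 (1 - (t - lo $ i) / \<theta>) else 0)" for i t
  define B where "B i t = Bt i t - Bb i t" for i t
  define p where "p i t = clip (w i t / m0) + clip (w i t / \<theta>) / (2 * n) + B i t" for i t
  have Bt_zero: "Bt i t = 0" if "t \<le> hi $ i - \<theta>" for i t
    using that \<theta> by (auto simp: Bt_def field_simps max_def)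
  have Bb_zero: "Bb i t = 0" if "lo $ i + \<theta> \<le> t" for i t
    using that \<theta> by (auto simp: Bb_def field_simps max_def)
  have B_range: "0 \<le> Bt i t" "0 \<le> Bb i t" for i t
    by (auto simp: Bt_def Bb_def)
  have B_le1: "Bt i t \<le> 1" if "t \<le> hi $ i" for i t
    using that \<theta> by (auto simp: Bt_def)
  have B_le1': "Bb i t \<le> 1" if "lo $ i \<le> t" for i t
    using that \<theta> by (auto simp: Bb_def)
  have Bt_D: "w i (hi $ i) = 0" "hi $ i - \<theta> < t" if "Bt i t \<noteq> 0" for i t
    using that Bt_zero[of t i] by (auto simp: Bt_def not_le[symmetric] split: if_splits)
  have Bb_D: "w i (lo $ i) = 0" "t < lo $ i + \<theta>" if "Bb i t \<noteq> 0" for i t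
    using that Bb_zero[of i t] by (auto simp: Bb_def not_le[symmetric] split: if_splits)
  have B_w: "w i t = 0" if "B i t \<noteq> 0" "lo $ i \<le> t" "t \<le> hi $ i" for i t
  proof -
    consider "Bt i t \<noteq> 0" | "Bb i t \<noteq> 0"
      using \<open>B i t \<noteq> 0\<close> unfolding B_def by linarith
    then show ?thesis
    proof cases
      case 1
      show ?thesis
        using w_zero_between[OF xs_zero Bt_D(1)[OF 1]] Bt_D(2)[OF 1] gap(1)[of i] that by auto
    next
      case 2
      show ?thesis
        using w_zero_between[OF Bb_D(1)[OF 2] xs_zero] Bb_D(2)[OF 2] gap(2)[of i] that by auto
    qed
  qed
  have B_abs: "\<bar>B i t\<bar> \<le> 1" if "lo $ i \<le> t" "t \<le> hi $ i" for i t
    using B_le1[OF that(2)] B_le1'[OF that(1)] B_range[of i t] by (simp add: B_def)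
  have B_low: "B i t \<le> 0" if "t \<le> xs $ i" for i t
    using B_range[of i t] Bt_zero[of t i] gap(1)[of i] that by (simp add: B_def)
  have B_high: "B i t \<ge> 0" if "xs $ i \<le> t" for i t
    using B_range[of i t] Bb_zero[of i t] gap(2)[of i] that by (simp add: B_def)
  have B_big: "(\<exists>j. \<theta> \<le> \<bar>w j (x $ j)\<bar>) \<or> (Bt i (x $ i) \<noteq> 0 \<and> \<theta> \<le> excess x) \<or> (Bb i (x $ i) \<noteq> 0 \<and> \<theta> \<le> - excess x)"
    if x: "x \<in> box_domain lo hi" and B: "B i (x $ i) \<noteq> 0" for x i
  proof -
    have abs: "\<theta> \<le> \<bar>s\<bar>" if "s \<le> - \<theta> \<or> \<theta> \<le> s" for s
      using that by linarith
    consider "Bt i (x $ i) \<noteq> 0" | "Bb i (x $ i) \<noteq> 0"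
      using B unfolding B_def by linarith
    then show ?thesis
    proof cases
      case 1
      then show ?thesis using top[OF Bt_D(1)[OF 1] x Bt_D(2)[OF 1]] abs by blast
    next
      case 2
      then show ?thesis using bottom[OF Bb_D(1)[OF 2] x Bb_D(2)[OF 2]] abs by blast
    qed
  qed
  have clip_w_mono: "clip (w i s / m) \<le> clip (w i t / m)" if "s \<le> t" "m > 0" for i s t m
    using that by (intro clip_mono divide_right_mono w_mono) auto
  have clip_w_lip: "\<bar>clip (w i s / m) - clip (w i t / m)\<bar> \<le> \<Lambda> / m * \<bar>s - t\<bar>" if "m > 0" for i s t m
  proof -
    have "\<bar>clip (w i s / m) - clip (w i t / m)\<bar> \<le> \<bar>w i s / m - w i t / m\<bar>"
      by (rule clip_lipschitz)
    also have "\<dots> = \<bar>w i s - w i t\<bar> / m"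
      using that by (simp add: diff_divide_distrib[symmetric])
    also have "\<dots> \<le> \<Lambda> * \<bar>s - t\<bar> / m"
      using that by (intro divide_right_mono w_lip) auto
    finally show ?thesis by simp
  qed
  have Bt_lip: "\<bar>Bt i s - Bt i t\<bar> \<le> 1 / \<theta> * \<bar>s - t\<bar>" for i s t
  proof -
    have "\<bar>Bt i s - Bt i t\<bar> \<le> \<bar>(hi $ i - t) / \<theta> - (hi $ i - s) / \<theta>\<bar>"
      by (auto simp: Bt_def)
    also have "\<dots> = 1 / \<theta> * \<bar>s - t\<bar>"
      using \<theta> by (simp add: diff_divide_distrib[symmetric])
    finally show ?thesis .
  qed
  have Bb_lip: "\<bar>Bb i s - Bb i t\<bar> \<le> 1 / \<theta> * \<bar>s - t\<bar>" for i s t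
  proof -
    have "\<bar>Bb i s - Bb i t\<bar> \<le> \<bar>(t - lo $ i) / \<theta> - (s - lo $ i) / \<theta>\<bar>"
      by (auto simp: Bb_def)
    also have "\<dots> = 1 / \<theta> * \<bar>s - t\<bar>"
      using \<theta> by (simp add: diff_divide_distrib[symmetric] abs_minus_commute)
    finally show ?thesis .
  qed
  have Bt_mono: "Bt i s \<le> Bt i t" and Bb_anti: "Bb i t \<le> Bb i s" if "s \<le> t" for i s t
    unfolding Bt_def Bb_def using that \<theta>
    by (auto simp del: max.bounded_iff intro!: max.mono diff_mono divide_right_mono)
  have neg_ok: "(\<Sum>i\<in>UNIV. (p i (x $ i) + clip (excess x / u0)) * vel x i) < 0"
    if x: "x \<in> box_domain lo hi" and nt: "excess x \<noteq> 0 \<or> (\<exists>i. w i (x $ i) \<noteq> 0)" for x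
  proof -
    have xb: "lo $ i \<le> x $ i" "x $ i \<le> hi $ i" for i
      using x by (auto simp: mem_box_domain)
    let ?w = "\<lambda>i. w i (x $ i)" and ?B = "\<lambda>i. B i (x $ i)" and ?p = "\<lambda>i. p i (x $ i)"
    \<comment> \<open>\<open>drift_neg\<close> is stated for a nonnegative mismatch. If the total is
      too large, it is applied to the negated \<open>w\<close> and \<open>B\<close>; since
      \<open>clip\<close> is odd and the Dirichlet form bilinear, the outcome is the same
      inequality.\<close>
    have main: "- c * dirichlet E ?p ?w + - excess x * (\<Sum>i\<in>UNIV. ?p i) - n * - excess x * clip (- excess x / u0) < 0"
    proof (cases "excess x \<le> 0")
      case True
      show ?thesis unfolding n_def
      proof (rule drift_neg[where w = ?w and B = ?B and \<eta> = \<theta> and ?m0.0 = m0 and ?m1.0 = \<theta>, OF C c_pos m0_pos m0_le(1) u0_pos u0_le(1)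
             small[unfolded n_def]])
        show "?w i = 0" if "?B i \<noteq> 0" for i
          using B_w[OF that xb] .
        show "\<bar>?B i\<bar> \<le> 1" for i
          using B_abs[OF xb] .
        show "(\<exists>j. \<theta> \<le> \<bar>?w j\<bar>) \<or> \<theta> \<le> - excess x" if "?B i \<noteq> 0" for i
          using B_big[OF x that] True \<theta> by auto
        show "0 \<le> - excess x" using True by simp
        \<comment> \<open>Some coordinate is at or below that of \<open>xs\<close>, as the total
          does not exceed \<open>gbar\<close>; there neither \<open>w\<close> nor the bump is
          positive.\<close>
        show "\<exists>j. ?w j \<le> 0 \<and> ?B j \<le> 0"
          using exists_le_xs[OF True] by (metis B_low w_mono xs_zero)
        show "\<exists>j. 0 \<le> ?w j" if "- excess x = 0"
          using exists_ge_xs[of x] that by (metis add.inverse_neutral equation_minus_iff order_refl w_mono xs_zero)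
        show "- excess x \<noteq> 0 \<or> (\<exists>i. ?w i \<noteq> 0)" using nt by simp
        show "?p i = clip (?w i / m0) + clip (?w i / \<theta>) / (2 * real CARD('n)) + ?B i" for i
          by (simp add: p_def n_def)
      qed
    next
      case False
      have "- c * dirichlet E (\<lambda>i. - ?p i) (\<lambda>i. - ?w i) + excess x * (\<Sum>i\<in>UNIV. - ?p i)
          - n * excess x * clip (excess x / u0) < 0" unfolding n_def
      proof (rule drift_neg[where w = "\<lambda>i. - ?w i" and B = "\<lambda>i. - ?B i" and \<eta> = \<theta> and ?m0.0 = m0 and ?m1.0 = \<theta>,
             OF C c_pos m0_pos m0_le(1) u0_pos u0_le(1) small[unfolded n_def]])
        show "- ?w i = 0" if "- ?B i \<noteq> 0" for i
          using B_w[OF _ xb] that by auto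
        show "\<bar>- ?B i\<bar> \<le> 1" for i
          using B_abs[OF xb] by simp
        show "(\<exists>j. \<theta> \<le> \<bar>- ?w j\<bar>) \<or> \<theta> \<le> excess x" if "- ?B i \<noteq> 0" for i
          using B_big[OF x, of i] that False \<theta> by auto
        show "0 \<le> excess x" using False by simp
        show "\<exists>j. - ?w j \<le> 0 \<and> - ?B j \<le> 0"
          using exists_ge_xs[of x] False by (metis B_high w_mono xs_zero neg_le_0_iff_le nle_le)
        show "\<exists>j. 0 \<le> - ?w j" if "excess x = 0"
          using False that by simp
        show "excess x \<noteq> 0 \<or> (\<exists>i. - ?w i \<noteq> 0)" using nt by simp
        show "- ?p i = clip (- ?w i / m0) + clip (- ?w i / \<theta>) / (2 * real CARD('n)) + - ?B i" for i
          by (simp add: p_def n_def)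
      qed
      moreover have "dirichlet E (\<lambda>i. - ?p i) (\<lambda>i. - ?w i) = dirichlet E ?p ?w"
        unfolding dirichlet_def by (simp add: algebra_simps)
      ultimately show ?thesis
        by (simp add: sum_negf)
    qed
    show ?thesis
      using main unfolding sum_vel n_def by (simp add: algebra_simps)
  qed
  show thesis
  proof (rule that[of u0 "\<Lambda> / m0 + \<Lambda> / \<theta> + 1 / \<theta> + 1 / \<theta>" p])
    show "u0 > 0" by (rule u0_pos)
    show "0 \<le> \<Lambda> / m0 + \<Lambda> / \<theta> + 1 / \<theta> + 1 / \<theta>"
      using Lambda_nonneg m0_pos \<theta> by simp
    show "p i s \<le> p i t" if "s \<le> t" for i s t
      unfolding p_def B_def using that m0_pos \<theta> n
      by (intro add_mono diff_mono divide_right_mono clip_w_mono Bt_mono Bb_anti) auto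
    show "\<bar>p i s - p i t\<bar> \<le> (\<Lambda> / m0 + \<Lambda> / \<theta> + 1 / \<theta> + 1 / \<theta>) * \<bar>s - t\<bar>" for i s t
    proof -
      have "\<bar>clip (w i s / \<theta>) - clip (w i t / \<theta>)\<bar> / (2 * n) \<le> \<bar>clip (w i s / \<theta>) - clip (w i t / \<theta>)\<bar> / 1"
        using n by (intro divide_left_mono) auto
      then have "\<bar>clip (w i s / \<theta>) / (2 * n) - clip (w i t / \<theta>) / (2 * n)\<bar> \<le> \<Lambda> / \<theta> * \<bar>s - t\<bar>"
        using clip_w_lip[OF \<theta>, of i s t] n by (simp add: diff_divide_distrib[symmetric])
      then have "\<bar>p i s - p i t\<bar> \<le> \<Lambda> / m0 * \<bar>s - t\<bar> + \<Lambda> / \<theta> * \<bar>s - t\<bar> + 1 / \<theta> * \<bar>s - t\<bar> + 1 / \<theta> * \<bar>s - t\<bar>"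
        using clip_w_lip[OF m0_pos, of i s t] Bt_lip[of i s t] Bb_lip[of i s t]
        unfolding p_def B_def by linarith
      then show ?thesis by (simp add: algebra_simps)
    qed
    show "1 \<le> p i (hi $ i)" for i
    proof (cases "w i (hi $ i) = 0")
      case True
      then have "Bt i (hi $ i) = 1" by (simp add: Bt_def)
      moreover have "Bb i (hi $ i) = 0" using Bb_zero[of i "hi $ i"] gap[of i] \<theta> by auto
      ultimately show ?thesis using True by (simp add: p_def B_def)
    next
      case False
      then have "\<theta> \<le> w i (hi $ i)" by (rule w_hi)
      then have "clip (w i (hi $ i) / m0) = 1" "clip (w i (hi $ i) / \<theta>) = 1"
        using m0_pos m0_le(1) \<theta> by (intro clip_eq_1; simp)+
      moreover have "B i (hi $ i) \<ge> 0"
        using B_high xs_interior(2)[of i] by (simp add: less_imp_le)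
      ultimately show ?thesis using n by (simp add: p_def)
    qed
    show "p i (lo $ i) \<le> - 1" for i
    proof (cases "w i (lo $ i) = 0")
      case True
      then have "Bb i (lo $ i) = 1" by (simp add: Bb_def)
      moreover have "Bt i (lo $ i) = 0" using Bt_zero[of "lo $ i" i] gap[of i] \<theta> by auto
      ultimately show ?thesis using True by (simp add: p_def B_def)
    next
      case False
      then have "w i (lo $ i) \<le> - \<theta>" by (rule w_lo)
      then have "clip (- (w i (lo $ i) / m0)) = 1" "clip (- (w i (lo $ i) / \<theta>)) = 1"
        using m0_pos m0_le(1) \<theta> by (intro clip_eq_1; simp add: field_simps)+
      moreover have "B i (lo $ i) \<le> 0"
        using B_low xs_interior(1)[of i] by (simp add: less_imp_le)
      ultimately show ?thesis using n by (simp add: p_def) (rule order_trans[of _ 0], simp_all)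
    qed
    show "p i (x $ i) = 0" if "x \<in> box_domain lo hi" "excess x = 0" "\<And>j. w j (x $ j) = 0" for x i
      using B_big[OF that(1), of i] \<theta> that by (auto simp: p_def)
  qed (rule neg_ok)
qed

end

section \<open>Convergence of a sample path\<close>

text \<open>The antiderivative of a nondecreasing function is convex and has that function as a
  subgradient. This inequality is the only form in which convexity of the Lyapunov function is used;
  no derivative of the potential is taken.\<close>

lemma subgradient_potential:
  fixes q :: "real \<Rightarrow> real"
  assumes mono: "\<And>s t. s \<le> t \<Longrightarrow> q s \<le> q t" and cont: "continuous_on UNIV q"
  obtains \<psi> where "\<And>s t. s \<in> {a..b} \<Longrightarrow> t \<in> {a..b} \<Longrightarrow> \<psi> s + q s * (t - s) \<le> \<psi> t"
proof -
  define \<psi> where "\<psi> t = integral {a..t} q" for t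
  have int: "q integrable_on {s..t}" for s t
    using continuous_on_subset[OF cont] by (intro integrable_continuous_real) auto
  have diff: "q s * (t - s) \<le> \<psi> t - \<psi> s \<and> \<psi> t - \<psi> s \<le> q t * (t - s)" if "a \<le> s" "s \<le> t" for s t
  proof -
    have "\<psi> s + integral {s..t} q = \<psi> t"
      unfolding \<psi>_def by (rule Henstock_Kurzweil_Integration.integral_combine[OF that int])
    moreover have "integral {s..t} (\<lambda>_. q s) \<le> integral {s..t} q"
      by (rule integral_le) (use int mono in auto)
    moreover have "integral {s..t} q \<le> integral {s..t} (\<lambda>_. q t)"
      by (rule integral_le) (use int mono in auto)
    ultimately show ?thesis
      using that by (simp add: mult.commute)
  qed
  show thesis
  proof (rule that[of \<psi>])
    fix s t assume st: "s \<in> {a..b}" "t \<in> {a..b}"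
    show "\<psi> s + q s * (t - s) \<le> \<psi> t"
    proof (cases "s \<le> t")
      case True
      then show ?thesis using diff[of s t] st by simp
    next
      case False
      then show ?thesis using diff[of t s] st by (simp add: algebra_simps)
    qed
  qed
qed

text \<open>Subtracting the partial sums of \<open>s\<close> from \<open>V\<close> gives a
  decreasing sequence that is bounded below. The perturbations may have both signs and need not be
  absolutely summable, which suits noise whose sums converge by cancellation.\<close>

lemma quasi_decreasing:
  fixes V d s :: "nat \<Rightarrow> real"
  assumes step: "\<And>k. V (Suc k) \<le> V k - d k + s k" and d: "\<And>k. d k \<ge> 0"
    and lb: "\<And>k. b \<le> V k" and s: "summable s"
  shows "convergent V" "summable d"
proof -
  define F where "F n = V n - (\<Sum>l<n. s l)" for n
  have F_step: "F (Suc n) \<le> F n - d n" for n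
    using step[of n] by (simp add: F_def)
  have "F (Suc n) \<le> F n" for n
    using F_step[of n] d[of n] by linarith
  then have dec: "decseq F"
    by (rule decseq_SucI)
  have "Bseq (\<lambda>n. \<Sum>l<n. s l)"
    using s by (simp add: summable_iff_convergent convergent_imp_Bseq)
  then obtain B where B: "\<And>n. \<bar>\<Sum>l<n. s l\<bar> \<le> B"
    by (auto simp: Bseq_def)
  have F_lb: "b - B \<le> F n" for n
    using lb[of n] B[of n] by (simp add: F_def)
  obtain L where L: "F \<longlonglongrightarrow> L"
    using decseq_convergent[OF dec, of "b - B"] F_lb by blast
  have "(\<lambda>n. F n + (\<Sum>l<n. s l)) \<longlonglongrightarrow> L + suminf s"
    using L summable_LIMSEQ[OF s] by (rule tendsto_add)
  then show "convergent V"
    by (auto simp: F_def convergent_def)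
  have "(\<Sum>l<n. d l) \<le> F 0 - F n" for n
  proof (induction n)
    case (Suc n)
    then show ?case
      using F_step[of n] by simp
  qed simp
  then have "(\<Sum>l<n. d l) \<le> F 0 - (b - B)" for n
    using F_lb[of n] by (meson diff_left_mono order_trans)
  then show "summable d"
    by (intro summableI_nonneg_bounded[where x = "F 0 - (b - B)"] d)
qed

lemma quadratic_error:
  fixes v e :: "'n::finite \<Rightarrow> real"
  assumes "\<And>i. (v i)\<^sup>2 \<le> B"
  shows "(\<Sum>i\<in>UNIV. (\<gamma> * (v i + e i))\<^sup>2) \<le> 2 * \<gamma>\<^sup>2 * (real CARD('n) * B + (\<Sum>i\<in>UNIV. (e i)\<^sup>2))"
proof -
  have "(\<Sum>i\<in>UNIV. (\<gamma> * (v i + e i))\<^sup>2) \<le> (\<Sum>i\<in>UNIV. 2 * \<gamma>\<^sup>2 * (B + (e i)\<^sup>2))"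
  proof (rule sum_mono)
    fix i
    have "(v i + e i)\<^sup>2 \<le> 2 * (v i)\<^sup>2 + 2 * (e i)\<^sup>2"
      using sum_squares_bound[of "v i" "e i"] by (simp add: power2_sum)
    also have "\<dots> \<le> 2 * (B + (e i)\<^sup>2)"
      using assms[of i] by simp
    finally have "\<gamma>\<^sup>2 * (v i + e i)\<^sup>2 \<le> \<gamma>\<^sup>2 * (2 * (B + (e i)\<^sup>2))"
      by (rule mult_left_mono) simp
    then show "(\<gamma> * (v i + e i))\<^sup>2 \<le> 2 * \<gamma>\<^sup>2 * (B + (e i)\<^sup>2)"
      by (simp only: power_mult_distrib mult_ac)
  qed
  also have "\<dots> = 2 * \<gamma>\<^sup>2 * (real CARD('n) * B + (\<Sum>i\<in>UNIV. (e i)\<^sup>2))"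
    by (simp add: sum_distrib_left[symmetric] sum.distrib)
  finally show ?thesis .
qed

section \<open>Descent of the truncated Lyapunov function and confinement to the interior of the
  box\<close>

context consensus_flow
begin

abbreviation Box :: "(real^'n) set" where
  "Box \<equiv> box_domain lo hi"

definition proj :: "real^'n \<Rightarrow> real^'n" where
  "proj z = (\<chi> i. max (lo $ i) (min (hi $ i) (z $ i)))"

definition Sol :: "(real^'n) set" where
  "Sol = {x \<in> Box. excess x = 0 \<and> (\<forall>i. w i (x $ i) = 0)}"

lemma lo_le_hi: "lo $ i \<le> hi $ i"
  using xs_interior[of i] by linarith

lemma proj_in_box: "proj z \<in> Box"
  using lo_le_hi by (simp add: proj_def mem_box_domain)

lemma proj_interior:
  assumes "\<And>i. lo $ i < proj z $ i" "\<And>i. proj z $ i < hi $ i"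
  shows "proj z = z"
proof (rule vec_eq_iff[THEN iffD2], rule allI)
  fix i show "proj z $ i = z $ i"
    using assms[of i] by (auto simp: proj_def split: if_splits)
qed

lemma proj_contract:
  assumes "x \<in> Box"
  shows "\<bar>proj z $ i - x $ i\<bar> \<le> \<bar>z $ i - x $ i\<bar>"
  using assms[unfolded mem_box_domain, THEN spec, of i] by (auto simp: proj_def min_def max_def)

lemma Sol_interior: "x \<in> Sol \<Longrightarrow> lo $ i < x $ i \<and> x $ i < hi $ i"
  using interior[of x i] by (simp add: Sol_def excess_def)

lemma xs_Sol: "xs \<in> Sol"
  using xs_interior xs_sum xs_zero by (auto simp: Sol_def mem_box_domain excess_def less_imp_le)

lemma excess_diff: "excess y - excess x = (\<Sum>i\<in>UNIV. y $ i - x $ i)"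
  by (simp add: excess_def sum_subtractf)

lemma vel_bounded: obtains B where "\<And>x i. x \<in> Box \<Longrightarrow> (vel x i)\<^sup>2 \<le> B"
proof -
  have "\<exists>B. \<forall>x\<in>Box. (vel x i)\<^sup>2 \<le> B" for i
  proof -
    have "compact ((\<lambda>x. (vel x i)\<^sup>2) ` Box)"
      by (intro compact_continuous_image compact_box_domain continuous_intros)
    then show ?thesis
      by (auto dest!: compact_imp_bounded bounded_imp_bdd_above simp: bdd_above_def)
  qed
  then obtain B where B: "\<And>i x. x \<in> Box \<Longrightarrow> (vel x i)\<^sup>2 \<le> B i"
    by metis
  have "(vel x i)\<^sup>2 \<le> Max (range B)" if "x \<in> Box" for x i
    using B[OF that, of i] by (rule order_trans) (intro Max_ge; simp)
  then show thesis
    by (rule that)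
qed

text \<open>\<open>V\<close> is convex with subgradient \<open>g\<close>, and the Lipschitz constant
  of \<open>g\<close> governs the second-order error collected in \<open>R\<close>. To first order
  the noise enters only as \<open>g x i * e i\<close> with \<open>g\<close> at the old point, that
  is, with a weight that is known before the noise.\<close>

lemma lyapunov_function:
  obtains V :: "real^'n \<Rightarrow> real" and g :: "real^'n \<Rightarrow> 'n \<Rightarrow> real" and R where
    "continuous_on Box V" "\<And>i. continuous_on UNIV (\<lambda>x. g x i)"
    "\<And>x \<gamma> e. x \<in> Box \<Longrightarrow> V (proj (\<chi> i. x $ i + \<gamma> * (vel x i + e i)))
        \<le> V x + \<gamma> * (\<Sum>i\<in>UNIV. g x i * vel x i) + (\<Sum>i\<in>UNIV. \<gamma> * (g x i * e i))
          + R * (\<gamma>\<^sup>2 * (1 + (\<Sum>i\<in>UNIV. (e i)\<^sup>2)))"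
    "\<And>x. x \<in> Box - Sol \<Longrightarrow> (\<Sum>i\<in>UNIV. g x i * vel x i) < 0"
    "\<And>x. x \<in> Sol \<Longrightarrow> (\<Sum>i\<in>UNIV. g x i * vel x i) = 0"
    "\<And>x y. x \<in> Sol \<Longrightarrow> y \<in> Box \<Longrightarrow> V x \<le> V y"
proof -
  obtain p :: "'n \<Rightarrow> real \<Rightarrow> real" and u0 K where u0: "u0 > 0" and K: "K \<ge> 0" and
    p_mono: "\<And>i s t. s \<le> t \<Longrightarrow> p i s \<le> p i t" and
    p_lip: "\<And>i s t. \<bar>p i s - p i t\<bar> \<le> K * \<bar>s - t\<bar>" and
    p_hi: "\<And>i. p i (hi $ i) \<ge> 1" and p_lo: "\<And>i. p i (lo $ i) \<le> - 1" and
    p_zero: "\<And>x i. x \<in> Box \<Longrightarrow> excess x = 0 \<Longrightarrow> (\<And>j. w j (x $ j) = 0) \<Longrightarrow> p i (x $ i) = 0" and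
    p_neg: "\<And>x. x \<in> Box \<Longrightarrow> excess x \<noteq> 0 \<or> (\<exists>i. w i (x $ i) \<noteq> 0) \<Longrightarrow>
      (\<Sum>i\<in>UNIV. (p i (x $ i) + clip (excess x / u0)) * vel x i) < 0"
    by (rule lyapunov_weights) blast
  have p_cont: "continuous_on UNIV (p i)" for i
    using p_lip K by (intro lipschitz_on_continuous_on[where L = K] lipschitz_onI) (auto simp: dist_real_def)
  have "\<exists>\<psi>. \<forall>s\<in>{lo $ i..hi $ i}. \<forall>t\<in>{lo $ i..hi $ i}. \<psi> s + p i s * (t - s) \<le> \<psi> t" for i
    using subgradient_potential[of "p i" "lo $ i" "hi $ i", OF p_mono p_cont] by metis
  then obtain \<psi> where \<psi>: "\<And>i s t. s \<in> {lo $ i..hi $ i} \<Longrightarrow> t \<in> {lo $ i..hi $ i} \<Longrightarrow>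
      \<psi> i s + p i s * (t - s) \<le> \<psi> i t"
    by metis
  define a where "a = (\<Sum>i\<in>UNIV. lo $ i) - gbar"
  define b where "b = (\<Sum>i\<in>UNIV. hi $ i) - gbar"
  have excess_ab: "excess x \<in> {a..b}" if "x \<in> Box" for x
    using that by (auto simp: excess_def a_def b_def mem_box_domain intro!: sum_mono)
  define h where "h s = clip (s / u0)" for s
  have h_mono: "h s \<le> h t" if "s \<le> t" for s t
    unfolding h_def using that u0 by (intro clip_mono divide_right_mono) auto
  have h_lip: "\<bar>h s - h t\<bar> \<le> 1 / u0 * \<bar>s - t\<bar>" for s t
  proof -
    have "\<bar>h s - h t\<bar> \<le> \<bar>s / u0 - t / u0\<bar>"
      unfolding h_def by (rule clip_lipschitz)
    then show ?thesis
      using u0 by (simp add: diff_divide_distrib[symmetric])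
  qed
  have h_cont: "continuous_on UNIV h"
    using h_lip u0 by (intro lipschitz_on_continuous_on[where L = "1 / u0"] lipschitz_onI) (auto simp: dist_real_def)
  obtain G where G: "\<And>s t. s \<in> {a..b} \<Longrightarrow> t \<in> {a..b} \<Longrightarrow> G s + h s * (t - s) \<le> G t"
    using subgradient_potential[OF h_mono h_cont] by metis
  define V where "V x = (\<Sum>i\<in>UNIV. \<psi> i (x $ i)) + G (excess x)" for x
  define g where "g x i = p i (x $ i) + h (excess x)" for x i
  have g_cont: "continuous_on A (\<lambda>x. g x i)" for i A
    unfolding g_def
    by (intro continuous_intros continuous_on_compose2[OF p_cont] continuous_on_compose2[OF h_cont]) auto
  have V_conv: "V x + (\<Sum>i\<in>UNIV. g x i * (y $ i - x $ i)) \<le> V y" if "x \<in> Box" "y \<in> Box" for x y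
  proof -
    have "(\<Sum>i\<in>UNIV. \<psi> i (x $ i) + p i (x $ i) * (y $ i - x $ i)) \<le> (\<Sum>i\<in>UNIV. \<psi> i (y $ i))"
      using that by (intro sum_mono \<psi>) (auto simp: mem_box_domain)
    moreover have "G (excess x) + h (excess x) * (excess y - excess x) \<le> G (excess y)"
      using that by (intro G excess_ab)
    moreover have "(\<Sum>i\<in>UNIV. g x i * (y $ i - x $ i))
        = (\<Sum>i\<in>UNIV. p i (x $ i) * (y $ i - x $ i)) + h (excess x) * (excess y - excess x)"
      by (simp add: g_def distrib_right sum.distrib excess_diff sum_distrib_left)
    ultimately show ?thesis
      by (simp add: V_def sum.distrib)
  qed
  define n where "n = real CARD('n)"
  obtain B where B: "\<And>x i. x \<in> Box \<Longrightarrow> (vel x i)\<^sup>2 \<le> B"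
    using vel_bounded by metis
  have B0: "B \<ge> 0"
    using order_trans[OF zero_le_power2 B[of xs]] xs_Sol by (auto simp: Sol_def)
  define K' where "K' = K + 1 / u0"
  have K'0: "K' \<ge> 0" using K u0 by (simp add: K'_def)
  define R where "R = K' * n * (2 * (n * B + 1))"
  have step: "V (proj z) \<le> V x + (\<Sum>i\<in>UNIV. g x i * (z $ i - x $ i)) + K' * n * (\<Sum>i\<in>UNIV. (z $ i - x $ i)\<^sup>2)"
    if x: "x \<in> Box" for x z
  proof -
    define y where "y = proj z"
    have y: "y \<in> Box" by (simp add: y_def proj_in_box)
    \<comment> \<open>The subgradient is taken at the projected point \<open>y\<close>, since its
      sign is known there in every coordinate that has been clipped.\<close>
    have "V y \<le> V x + (\<Sum>i\<in>UNIV. g y i * (y $ i - x $ i))"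
      using V_conv[OF y x] by (simp add: right_diff_distrib sum_subtractf)
    also have "(\<Sum>i\<in>UNIV. g y i * (y $ i - x $ i)) \<le> (\<Sum>i\<in>UNIV. g y i * (z $ i - x $ i))"
    proof (rule sum_mono)
      fix i
      have h1: "\<bar>h (excess y)\<bar> \<le> 1" by (simp add: h_def clip_bounds)
      \<comment> \<open>At the upper end \<open>p\<close> is at least 1 while |h| \<le> 1, so
        \<open>g y i\<close> is nonnegative, as is the part \<open>z $ i - y $ i\<close> cut off;
        both signs change at the lower end.\<close>
      consider "y $ i = z $ i" | "y $ i = hi $ i" "z $ i > hi $ i" | "y $ i = lo $ i" "z $ i < lo $ i"
        using lo_le_hi[of i] by (fastforce simp: y_def proj_def min_def max_def split: if_splits)
      then have "0 \<le> g y i * (z $ i - y $ i)"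
      proof cases
        case 1 then show ?thesis by simp
      next
        case 2
        then show ?thesis using p_hi[of i] h1 by (intro mult_nonneg_nonneg) (auto simp: g_def)
      next
        case 3
        then show ?thesis using p_lo[of i] h1 by (intro mult_nonpos_nonpos) (auto simp: g_def)
      qed
      then show "g y i * (y $ i - x $ i) \<le> g y i * (z $ i - x $ i)"
        by (simp add: algebra_simps)
    qed
    also have "(\<Sum>i\<in>UNIV. g y i * (z $ i - x $ i))
        = (\<Sum>i\<in>UNIV. g x i * (z $ i - x $ i)) + (\<Sum>i\<in>UNIV. (g y i - g x i) * (z $ i - x $ i))"
      by (simp add: left_diff_distrib sum_subtractf)
    \<comment> \<open>Returning from the subgradient at \<open>y\<close> to that at \<open>x\<close>
      costs only a quadratic term, because clipping brings each coordinate no farther from the point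
      \<open>x\<close> of the box.\<close>
    also have "(\<Sum>i\<in>UNIV. (g y i - g x i) * (z $ i - x $ i)) \<le> K' * n * (\<Sum>i\<in>UNIV. (z $ i - x $ i)\<^sup>2)"
    proof -
      define T where "T = (\<Sum>i\<in>UNIV. \<bar>z $ i - x $ i\<bar>)"
      have zT: "\<bar>z $ i - x $ i\<bar> \<le> T" for i
        unfolding T_def by (rule member_le_sum[where f = "\<lambda>i. \<bar>z $ i - x $ i\<bar>"]) auto
      have "\<bar>g y i - g x i\<bar> \<le> K' * T" for i
      proof -
        have "\<bar>excess y - excess x\<bar> \<le> (\<Sum>i\<in>UNIV. \<bar>y $ i - x $ i\<bar>)"
          unfolding excess_diff by (rule sum_abs)
        also have "\<dots> \<le> T"
          unfolding T_def y_def by (intro sum_mono proj_contract x)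
        finally have "1 / u0 * \<bar>excess y - excess x\<bar> \<le> 1 / u0 * T"
          using u0 by (intro mult_left_mono) auto
        moreover have "K * \<bar>y $ i - x $ i\<bar> \<le> K * T"
          using order_trans[OF proj_contract[OF x] zT] K unfolding y_def by (rule mult_left_mono)
        ultimately show ?thesis
          using p_lip[of i "y $ i" "x $ i"] h_lip[of "excess y" "excess x"]
          unfolding g_def K'_def distrib_right by linarith
      qed
      then have "(\<Sum>i\<in>UNIV. (g y i - g x i) * (z $ i - x $ i)) \<le> (\<Sum>i\<in>UNIV. K' * T * \<bar>z $ i - x $ i\<bar>)"
      proof (intro sum_mono)
        fix i
        have "(g y i - g x i) * (z $ i - x $ i) \<le> \<bar>g y i - g x i\<bar> * \<bar>z $ i - x $ i\<bar>"
          by (simp add: abs_mult[symmetric])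
        also have "\<dots> \<le> K' * T * \<bar>z $ i - x $ i\<bar>"
          using \<open>\<And>i. \<bar>g y i - g x i\<bar> \<le> K' * T\<close> by (intro mult_right_mono) auto
        finally show "(g y i - g x i) * (z $ i - x $ i) \<le> K' * T * \<bar>z $ i - x $ i\<bar>" .
      qed
      also have "\<dots> = K' * T\<^sup>2"
        by (simp add: T_def sum_distrib_left[symmetric] power2_eq_square)
      also have "\<dots> \<le> K' * (n * (\<Sum>i\<in>UNIV. (z $ i - x $ i)\<^sup>2))"
      proof (rule mult_left_mono[OF _ K'0])
        show "T\<^sup>2 \<le> n * (\<Sum>i\<in>UNIV. (z $ i - x $ i)\<^sup>2)"
          using sum_squared_le_sum_of_squares[of "\<lambda>i. \<bar>z $ i - x $ i\<bar>" UNIV]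
          by (simp add: T_def n_def mult.commute)
      qed
      finally show ?thesis by (simp add: mult.assoc)
    qed
    finally show ?thesis by (simp add: y_def)
  qed
  have descent: "V (proj (\<chi> i. x $ i + \<gamma> * (vel x i + e i)))
        \<le> V x + \<gamma> * (\<Sum>i\<in>UNIV. g x i * vel x i) + (\<Sum>i\<in>UNIV. \<gamma> * (g x i * e i))
          + R * (\<gamma>\<^sup>2 * (1 + (\<Sum>i\<in>UNIV. (e i)\<^sup>2)))" if x: "x \<in> Box" for x \<gamma> e
  proof -
    let ?z = "\<chi> i. x $ i + \<gamma> * (vel x i + e i)"
    let ?e = "\<Sum>i\<in>UNIV. (e i)\<^sup>2"
    have "(\<Sum>i\<in>UNIV. g x i * (?z $ i - x $ i)) = \<gamma> * (\<Sum>i\<in>UNIV. g x i * vel x i) + (\<Sum>i\<in>UNIV. \<gamma> * (g x i * e i))"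
      by (simp add: sum_distrib_left sum.distrib[symmetric] algebra_simps)
    moreover have "K' * n * (\<Sum>i\<in>UNIV. (?z $ i - x $ i)\<^sup>2) \<le> R * (\<gamma>\<^sup>2 * (1 + ?e))"
    proof -
      have e0: "?e \<ge> 0" by (simp add: sum_nonneg)
      have "0 \<le> n * B * ?e"
        using e0 B0 by (simp add: n_def)
      then have "n * B + ?e \<le> (n * B + 1) * (1 + ?e)"
        by (simp add: algebra_simps)
      then have "2 * \<gamma>\<^sup>2 * (n * B + ?e) \<le> 2 * \<gamma>\<^sup>2 * ((n * B + 1) * (1 + ?e))"
        by (intro mult_left_mono) auto
      then have "(\<Sum>i\<in>UNIV. (?z $ i - x $ i)\<^sup>2) \<le> 2 * \<gamma>\<^sup>2 * ((n * B + 1) * (1 + ?e))"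
        using quadratic_error[of "vel x" B \<gamma> e, OF B[OF x]] by (simp add: n_def)
      then have "K' * n * (\<Sum>i\<in>UNIV. (?z $ i - x $ i)\<^sup>2) \<le> K' * n * (2 * \<gamma>\<^sup>2 * ((n * B + 1) * (1 + ?e)))"
        using K'0 by (intro mult_left_mono) (auto simp: n_def)
      then show ?thesis
        unfolding R_def by (simp only: mult_ac)
    qed
    ultimately show ?thesis
      using step[OF x, of ?z] by linarith
  qed
  have g_zero: "g x i = 0" if "x \<in> Sol" for x i
    using that p_zero[of x i] by (auto simp: g_def h_def Sol_def)
  have V_cont: "continuous_on Box V"
  proof -
    \<comment> \<open>The subgradient inequalities at the two points bound the increment from both
      sides, and by monotonicity the subgradients are bounded on the interval.\<close>
    have \<psi>_cont: "continuous_on {lo $ i..hi $ i} (\<psi> i)" for i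
    proof (rule lipschitz_on_continuous_on[where L = "\<bar>p i (lo $ i)\<bar> + \<bar>p i (hi $ i)\<bar>"], rule lipschitz_onI)
      fix s t assume st: "s \<in> {lo $ i..hi $ i}" "t \<in> {lo $ i..hi $ i}"
      have P: "\<bar>p i r\<bar> \<le> \<bar>p i (lo $ i)\<bar> + \<bar>p i (hi $ i)\<bar>" if "r \<in> {lo $ i..hi $ i}" for r
        using p_mono[of "lo $ i" r i] p_mono[of r "hi $ i" i] that by auto
      have "\<bar>p i r * (t - s)\<bar> \<le> (\<bar>p i (lo $ i)\<bar> + \<bar>p i (hi $ i)\<bar>) * \<bar>s - t\<bar>" if "r \<in> {lo $ i..hi $ i}" for r
        unfolding abs_mult abs_minus_commute[of t s] using P[OF that] by (intro mult_right_mono) auto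
      from this[OF st(1)] this[OF st(2)] \<psi>[OF st] \<psi>[OF st(2,1)]
      show "dist (\<psi> i s) (\<psi> i t) \<le> (\<bar>p i (lo $ i)\<bar> + \<bar>p i (hi $ i)\<bar>) * dist s t"
        unfolding dist_real_def right_diff_distrib by linarith
    qed simp
    have G_cont: "continuous_on {a..b} G"
    proof (rule lipschitz_on_continuous_on[where L = 1], rule lipschitz_onI)
      fix s t assume st: "s \<in> {a..b}" "t \<in> {a..b}"
      have "\<bar>h r * (t - s)\<bar> \<le> 1 * \<bar>s - t\<bar>" for r
        unfolding abs_mult abs_minus_commute[of t s] h_def using clip_bounds by (intro mult_right_mono) auto
      from this[of s] this[of t] G[OF st] G[OF st(2,1)]
      show "dist (G s) (G t) \<le> 1 * dist s t"
        unfolding dist_real_def right_diff_distrib by linarith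
    qed simp
    show ?thesis
      unfolding V_def
      by (intro continuous_intros continuous_on_compose2[OF \<psi>_cont] continuous_on_compose2[OF G_cont])
         (use excess_ab in \<open>auto simp: mem_box_domain\<close>)
  qed
  show thesis
  proof (rule that[OF V_cont g_cont descent])
    show "(\<Sum>i\<in>UNIV. g x i * vel x i) < 0" if "x \<in> Box - Sol" for x
      using p_neg[of x] that by (auto simp: g_def h_def Sol_def)
    show "(\<Sum>i\<in>UNIV. g x i * vel x i) = 0" if "x \<in> Sol" for x
      using g_zero[OF that] by simp
    show "V x \<le> V y" if "x \<in> Sol" "y \<in> Box" for x y
      using V_conv[of x y] g_zero[OF that(1)] that by (auto simp: Sol_def)
  qed
qed

text \<open>The weights \<open>g\<close> are obtained before the path \<open>X\<close>: summability
  of the noise against \<open>g (X k)\<close> will be an almost sure statement, for which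
  \<open>g\<close> must not depend on the sample point.\<close>

lemma confinement:
  obtains g :: "real^'n \<Rightarrow> 'n \<Rightarrow> real" where "\<And>i. continuous_on UNIV (\<lambda>x. g x i)"
    "\<And>X e \<gamma>. X 0 \<in> Box \<Longrightarrow> (\<And>k. X (Suc k) = proj (\<chi> i. X k $ i + \<gamma> k * (vel (X k) i + e k i))) \<Longrightarrow>
      (\<And>k. \<gamma> k > 0) \<Longrightarrow> \<not> summable \<gamma> \<Longrightarrow> summable (\<lambda>k. (\<gamma> k)\<^sup>2) \<Longrightarrow>
      (\<And>i. summable (\<lambda>k. (\<gamma> k)\<^sup>2 * (e k i)\<^sup>2)) \<Longrightarrow> (\<And>i. summable (\<lambda>k. \<gamma> k * (g (X k) i * e k i))) \<Longrightarrow>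
      (\<forall>k. X k \<in> Box) \<and> eventually (\<lambda>k. \<forall>i. lo $ i < X k $ i \<and> X k $ i < hi $ i) sequentially \<and>
      (\<exists>x r. x \<in> Sol \<and> strict_mono r \<and> (X \<circ> r) \<longlonglongrightarrow> x)"
proof -
  obtain V :: "real^'n \<Rightarrow> real" and g :: "real^'n \<Rightarrow> 'n \<Rightarrow> real" and R where
    V_cont: "continuous_on Box V" and g_cont: "\<And>i. continuous_on UNIV (\<lambda>x. g x i)" and
    descent: "\<And>x \<gamma> e. x \<in> Box \<Longrightarrow> V (proj (\<chi> i. x $ i + \<gamma> * (vel x i + e i)))
        \<le> V x + \<gamma> * (\<Sum>i\<in>UNIV. g x i * vel x i) + (\<Sum>i\<in>UNIV. \<gamma> * (g x i * e i))
          + R * (\<gamma>\<^sup>2 * (1 + (\<Sum>i\<in>UNIV. (e i)\<^sup>2)))" and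
    neg: "\<And>x. x \<in> Box - Sol \<Longrightarrow> (\<Sum>i\<in>UNIV. g x i * vel x i) < 0" and
    zero: "\<And>x. x \<in> Sol \<Longrightarrow> (\<Sum>i\<in>UNIV. g x i * vel x i) = 0" and
    minimal: "\<And>x y. x \<in> Sol \<Longrightarrow> y \<in> Box \<Longrightarrow> V x \<le> V y"
    by (rule lyapunov_function) blast
  define W where "W x = - (\<Sum>i\<in>UNIV. g x i * vel x i)" for x
  have W_cont: "continuous_on A W" for A
    unfolding W_def by (intro continuous_intros continuous_on_subset[OF g_cont]) auto
  have W0: "W x \<ge> 0" if "x \<in> Box" for x
    using neg[of x] zero[of x] that by (cases "x \<in> Sol") (auto simp: W_def)
  \<comment> \<open>A point outside \<open>Sol\<close> cannot minimize \<open>V\<close>: a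
    noise-free step of size \<gamma> changes \<open>V\<close> by at most
    \<open>- \<gamma> * W x\<close> plus a term of order \<gamma>^2, which is negative for the small
    \<gamma> chosen below.\<close>
  have strict: "V xs < V x" if x: "x \<in> Box" "x \<notin> Sol" for x
  proof (rule ccontr)
    assume "\<not> V xs < V x"
    then have le: "V x \<le> V y" if "y \<in> Box" for y
      using minimal[OF xs_Sol that] by simp
    have Wx: "W x > 0"
      using neg[of x] x by (simp add: W_def)
    define \<gamma> where "\<gamma> = W x / (2 * (\<bar>R\<bar> + 1))"
    have \<gamma>: "\<gamma> > 0" using Wx by (simp add: \<gamma>_def)
    have "V x \<le> V (proj (\<chi> i. x $ i + \<gamma> * (vel x i + 0)))"
      by (rule le[OF proj_in_box])
    also have "\<dots> \<le> V x - \<gamma> * W x + R * \<gamma>\<^sup>2"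
      using descent[OF x(1), of \<gamma> "\<lambda>_. 0"] by (simp add: W_def)
    finally have "\<gamma> * W x \<le> \<gamma> * (R * \<gamma>)"
      by (simp add: power2_eq_square algebra_simps)
    then have "W x \<le> R * \<gamma>"
      using \<gamma> by simp
    also have "\<dots> \<le> (\<bar>R\<bar> + 1) * \<gamma>"
      using \<gamma> by (intro mult_right_mono) auto
    also have "\<dots> = W x / 2"
      by (simp add: \<gamma>_def field_simps)
    finally show False
      using Wx by simp
  qed
  show thesis
  proof (rule that[OF g_cont])
    fix X :: "nat \<Rightarrow> real^'n" and e :: "nat \<Rightarrow> 'n \<Rightarrow> real" and \<gamma> :: "nat \<Rightarrow> real"
    assume X0: "X 0 \<in> Box" and X: "\<And>k. X (Suc k) = proj (\<chi> i. X k $ i + \<gamma> k * (vel (X k) i + e k i))"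
      and \<gamma>: "\<And>k. \<gamma> k > 0" "\<not> summable \<gamma>" "summable (\<lambda>k. (\<gamma> k)\<^sup>2)"
      and e2: "\<And>i. summable (\<lambda>k. (\<gamma> k)\<^sup>2 * (e k i)\<^sup>2)"
      and ge: "\<And>i. summable (\<lambda>k. \<gamma> k * (g (X k) i * e k i))"
    have XB: "X k \<in> Box" for k
      by (cases k) (auto simp: X0 X proj_in_box)
    have step: "V (X (Suc k)) \<le> V (X k) - \<gamma> k * W (X k) + ((\<Sum>i\<in>UNIV. \<gamma> k * (g (X k) i * e k i))
        + R * ((\<gamma> k)\<^sup>2 + (\<Sum>i\<in>UNIV. (\<gamma> k)\<^sup>2 * (e k i)\<^sup>2)))" for k
      using descent[OF XB, of k "\<gamma> k" "e k"] unfolding X[of k]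
      by (simp add: W_def distrib_left sum_distrib_left)
    have s: "summable (\<lambda>k. (\<Sum>i\<in>UNIV. \<gamma> k * (g (X k) i * e k i))
        + R * ((\<gamma> k)\<^sup>2 + (\<Sum>i\<in>UNIV. (\<gamma> k)\<^sup>2 * (e k i)\<^sup>2)))"
      by (intro summable_add summable_mult summable_sum ge e2 \<gamma>)
    have d0: "0 \<le> \<gamma> k * W (X k)" for k
      using \<gamma>(1)[of k] W0[OF XB] by simp
    have lbV: "V xs \<le> V (X k)" for k
      by (rule minimal[OF xs_Sol XB])
    have conv: "convergent (\<lambda>k. V (X k))" and sum_d: "summable (\<lambda>k. \<gamma> k * W (X k))"
      using quasi_decreasing[of "\<lambda>k. V (X k)", OF step d0 lbV s] by auto
    obtain l where l: "(\<lambda>k. V (X k)) \<longlonglongrightarrow> l"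
      using conv by (auto simp: convergent_def)
    have "V xs \<le> l"
      using l lbV by (intro LIMSEQ_le_const) auto
    have compact_level: "compact {x \<in> Box. r \<le> V x}" for r
    proof -
      have "closedin (top_of_set Box) (Box \<inter> V -` {r..})"
        by (intro continuous_closedin_preimage V_cont) auto
      then have "compact (Box \<inter> V -` {r..})"
        by (rule closedin_compact[OF compact_box_domain])
      then show ?thesis
        by (simp add: vimage_def Int_def)
    qed
    \<comment> \<open>Otherwise the path ends up in a compact set disjoint from \<open>Sol\<close>,
      where \<open>W\<close> has a positive minimum. Summability of
      \<open>\<gamma> k * W (X k)\<close> would then carry over to \<open>\<gamma>\<close>.\<close>
    have l_eq: "l = V xs"
    proof (rule ccontr)
      assume "l \<noteq> V xs"
      then have "V xs < l" using \<open>V xs \<le> l\<close> by simp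
      define r where "r = (V xs + l) / 2"
      have r: "V xs < r" "r < l" using \<open>V xs < l\<close> by (auto simp: r_def)
      define D where "D = {x \<in> Box. r \<le> V x}"
      have ev: "eventually (\<lambda>k. X k \<in> D) sequentially"
        using order_tendstoD(1)[OF l r(2)] by eventually_elim (simp add: D_def XB)
      then have "D \<noteq> {}"
        by (auto simp: eventually_sequentially)
      then obtain x0 where x0: "x0 \<in> D" "\<And>x. x \<in> D \<Longrightarrow> W x0 \<le> W x"
        using continuous_attains_inf[of D W] compact_level W_cont unfolding D_def by blast
      have "x0 \<notin> Sol"
        using x0(1) r(1) minimal[of x0 xs] xs_Sol by (auto simp: D_def Sol_def)
      then have W_pos: "W x0 > 0"
        using neg[of x0] x0(1) by (simp add: W_def D_def)
      have "summable (\<lambda>k. \<gamma> k * W x0)"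
      proof (rule summable_comparison_test_ev[OF _ sum_d])
        show "eventually (\<lambda>k. norm (\<gamma> k * W x0) \<le> \<gamma> k * W (X k)) sequentially"
          using ev
        proof eventually_elim
          case (elim k)
          then show ?case
            using x0(2)[OF elim] \<gamma>(1)[of k] W_pos by (simp add: abs_mult less_imp_le mult_left_mono)
        qed
      qed
      then have "summable (\<lambda>k. \<gamma> k * W x0 / W x0)"
        by (rule summable_divide)
      then show False
        using W_pos \<gamma>(2) by simp
    qed
    have ev_int: "eventually (\<lambda>k. \<forall>i. lo $ i < X k $ i \<and> X k $ i < hi $ i) sequentially"
    proof -
      \<comment> \<open>The boundary of the box is compact and misses \<open>Sol\<close>, so
        \<open>V\<close> stays above its minimum there by a fixed amount, and a path with
        \<open>V (X k)\<close> tending to the minimum leaves it for good.\<close>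
      define D where "D = {x \<in> Box. \<exists>i. x $ i = lo $ i \<or> x $ i = hi $ i}"
      have "D = Box \<inter> (\<Union>i. {x. x $ i = lo $ i} \<union> {x. x $ i = hi $ i})"
        by (auto simp: D_def)
      moreover have "closed (\<Union>i. {x::real^'n. x $ i = lo $ i} \<union> {x. x $ i = hi $ i})"
      proof (rule closed_UN)
        show "\<forall>i\<in>UNIV. closed ({x::real^'n. x $ i = lo $ i} \<union> {x. x $ i = hi $ i})"
          by (intro ballI closed_Un closed_Collect_eq continuous_intros)
      qed simp
      ultimately have "compact D"
        by (simp add: compact_Int_closed compact_box_domain)
      have "\<exists>r>l. \<forall>x\<in>D. r \<le> V x"
      proof (cases "D = {}")
        case True
        then show ?thesis by (intro exI[of _ "l + 1"]) simp
      next
        case False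
        moreover have "continuous_on D V"
          using V_cont by (rule continuous_on_subset) (auto simp: D_def)
        ultimately obtain x0 where x0: "x0 \<in> D" "\<And>x. x \<in> D \<Longrightarrow> V x0 \<le> V x"
          using continuous_attains_inf[OF \<open>compact D\<close>] by blast
        have "x0 \<notin> Sol"
        proof -
          obtain i where "x0 $ i = lo $ i \<or> x0 $ i = hi $ i"
            using x0(1) by (auto simp: D_def)
          then show ?thesis
            using Sol_interior[of x0 i] by auto
        qed
        then have "l < V x0"
          using strict[of x0] x0(1) by (simp add: l_eq D_def)
        then show ?thesis using x0(2) by blast
      qed
      then obtain r where r: "l < r" "\<And>x. x \<in> D \<Longrightarrow> r \<le> V x" by blast
      show ?thesis
        using order_tendstoD(2)[OF l r(1)]
      proof eventually_elim
        case (elim k)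
        then have "X k \<notin> D" using r(2) by force
        show ?case
        proof
          fix i
          have "lo $ i \<le> X k $ i" "X k $ i \<le> hi $ i"
            using XB[of k] by (auto simp: mem_box_domain)
          moreover have "X k $ i \<noteq> lo $ i" "X k $ i \<noteq> hi $ i"
            using \<open>X k \<notin> D\<close> XB[of k] by (auto simp: D_def)
          ultimately show "lo $ i < X k $ i \<and> X k $ i < hi $ i" by simp
        qed
      qed
    qed
    obtain x r where xr: "x \<in> Box" "strict_mono r" "(X \<circ> r) \<longlonglongrightarrow> x"
      using compact_box_domain[of lo hi] XB unfolding compact_def by blast
    have "(\<lambda>k. V ((X \<circ> r) k)) \<longlonglongrightarrow> V x"
      using continuous_on_tendsto_compose[OF V_cont xr(3) xr(1)] XB by simp
    moreover have "(\<lambda>k. V ((X \<circ> r) k)) \<longlonglongrightarrow> l"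
      using LIMSEQ_subseq_LIMSEQ[OF l xr(2)] by (simp add: o_def)
    ultimately have "V x = V xs"
      using LIMSEQ_unique l_eq by blast
    then have "x \<in> Sol"
      using strict[OF xr(1)] by force
    then show "(\<forall>k. X k \<in> Box) \<and> eventually (\<lambda>k. \<forall>i. lo $ i < X k $ i \<and> X k $ i < hi $ i) sequentially \<and>
      (\<exists>x r. x \<in> Sol \<and> strict_mono r \<and> (X \<circ> r) \<longlonglongrightarrow> x)"
      using XB ev_int xr by blast
  qed
qed

end

section \<open>A quadratic form that the drift does not increase\<close>

lemma laplacian_inverse:
  fixes E :: "('n::finite \<times> 'n) set"
  assumes "sym E" "connected_graph E"
  obtains q :: "real^'n \<Rightarrow> real^'n" where "linear q" "\<And>a b. q a \<bullet> b = a \<bullet> q b"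
    "\<And>a. a \<noteq> 0 \<Longrightarrow> 0 < a \<bullet> q a"
    "\<And>z. q (\<chi> i. \<Sum>j\<in>nbrs E i. z i - z j) = (\<chi> i. z i - (\<Sum>i\<in>UNIV. z i) / real CARD('n))"
    "\<And>s. q (\<chi> i. s) = (\<chi> i. s / real CARD('n))"
proof -
  \<comment> \<open>The Laplacian plus the all-ones matrix: on a connected graph the Laplacian
    vanishes only on constants, where the second part is positive. Its inverse \<open>q\<close>
    removes the coupling from the drift, taking the Laplacian of \<open>z\<close> back to
    \<open>z\<close> minus its mean.\<close>
  define A :: "real^'n \<Rightarrow> real^'n"
    where "A x = (\<chi> i. (\<Sum>j\<in>nbrs E i. x $ i - x $ j) + (\<Sum>j\<in>UNIV. x $ j))" for x
  have lin: "linear A"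
  proof (rule linearI)
    show "A (x + y) = A x + A y" for x y
      by (simp add: A_def vec_eq_iff sum.distrib[symmetric]) (simp add: sum.distrib sum_subtractf algebra_simps)
    show "A (r *\<^sub>R x) = r *\<^sub>R A x" for r x
      by (simp add: A_def vec_eq_iff distrib_left sum_distrib_left right_diff_distrib)
  qed
  have inner: "x \<bullet> A y = dirichlet E (\<lambda>i. x $ i) (\<lambda>i. y $ i) + (\<Sum>i\<in>UNIV. x $ i) * (\<Sum>i\<in>UNIV. y $ i)" for x y
  proof -
    have "x \<bullet> A y = (\<Sum>i\<in>UNIV. x $ i * (\<Sum>j\<in>nbrs E i. y $ i - y $ j)) + (\<Sum>i\<in>UNIV. x $ i) * (\<Sum>i\<in>UNIV. y $ i)"
      by (simp add: A_def inner_vec_def distrib_left sum.distrib sum_distrib_right)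
    then show ?thesis
      using sum_laplacian[OF assms(1), of "\<lambda>i. x $ i" "\<lambda>i. y $ i"] by simp
  qed
  have A_sym: "x \<bullet> A y = A x \<bullet> y" for x y
    unfolding inner inner_commute[of "A x"] by (simp add: dirichlet_def mult.commute)
  obtain C where C: "C > 0" "\<And>z i j. (z i - z j)\<^sup>2 \<le> C * dirichlet E z z"
    using poincare[OF assms(2)] by metis
  have A_pos: "0 < x \<bullet> A x" if "x \<noteq> 0" for x
  proof -
    have d: "0 \<le> dirichlet E (\<lambda>i. x $ i) (\<lambda>i. x $ i)"
      unfolding dirichlet_def by (auto intro!: sum_nonneg)
    have "0 \<le> x \<bullet> A x"
      using d by (simp add: inner)
    moreover have "x = 0" if "x \<bullet> A x = 0"
    proof -
      have z: "dirichlet E (\<lambda>i. x $ i) (\<lambda>i. x $ i) = 0" "(\<Sum>i\<in>UNIV. x $ i) = 0"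
        using that d zero_le_square[of "\<Sum>i\<in>UNIV. x $ i"] unfolding inner
        by (auto simp: add_nonneg_eq_0_iff)
      have eq: "x $ i = x $ j" for i j
        using C(2)[of "\<lambda>i. x $ i" i j] z(1) by simp
      have "x $ i = 0" for i
      proof -
        have "(\<Sum>j\<in>UNIV. x $ j) = (\<Sum>j\<in>(UNIV::'n set). x $ i)"
          by (intro sum.cong refl eq)
        then show ?thesis using z(2) by simp
      qed
      then show ?thesis by (simp add: vec_eq_iff)
    qed
    ultimately show ?thesis using that by fastforce
  qed
  have "inj A"
    using A_pos by (subst linear_injective_0[OF lin]) fastforce
  then obtain q where q: "linear q" "\<And>x. q (A x) = x" "\<And>x. A (q x) = x"
    using linear_injective_isomorphism[OF lin] by blast
  have q_sym: "q a \<bullet> b = a \<bullet> q b" for a b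
    using A_sym[of "q a" "q b"] by (simp add: q)
  have q_pos: "0 < a \<bullet> q a" if "a \<noteq> 0" for a
  proof -
    have "q a \<noteq> 0"
      using that q(3)[of a] linear_0[OF lin] by force
    then show ?thesis
      using A_pos[of "q a"] by (simp add: q inner_commute)
  qed
  have q_const: "q (\<chi> i. s) = (\<chi> i. s / real CARD('n))" for s
  proof -
    have "A (\<chi> i. s / real CARD('n)) = (\<chi> i. s)"
      by (simp add: A_def vec_eq_iff)
    then show ?thesis
      using q(2) by metis
  qed
  have q_lap: "q (\<chi> i. \<Sum>j\<in>nbrs E i. z i - z j) = (\<chi> i. z i - (\<Sum>i\<in>UNIV. z i) / real CARD('n))" for z
  proof -
    have "A (\<chi> i. z i - (\<Sum>i\<in>UNIV. z i) / real CARD('n)) = (\<chi> i. \<Sum>j\<in>nbrs E i. z i - z j)"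
      by (simp add: A_def vec_eq_iff sum_subtractf)
    then show ?thesis
      using q(2) by metis
  qed
  show thesis
    by (rule that[OF q(1) q_sym q_pos q_lap q_const])
qed

context consensus_flow
begin

text \<open>Under \<open>q\<close> the drift becomes \<open>- c\<close> times \<open>w\<close> minus
  its mean, plus a multiple of the excess. Pairing with \<open>x - y\<close> yields the favourable
  terms \<open>z $ i * W i\<close> and a cross term of the mean with the excess. As
  \<open>w i\<close> is monotone, Lipschitz and zero at \<open>y\<close>, the square of
  \<open>W i\<close> is at most \<open>\<Lambda>' * (z $ i * W i)\<close>; a Young-type bound then
  leaves a multiple of the squared excess, and \<open>\<beta>\<close> is chosen to absorb
  it.\<close>

lemma energy:
  obtains Q :: "real^'n \<Rightarrow> real^'n" where "linear Q" "\<And>a b. Q a \<bullet> b = a \<bullet> Q b"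
    "\<And>a. a \<noteq> 0 \<Longrightarrow> 0 < a \<bullet> Q a"
    "\<And>x y. y \<in> Sol \<Longrightarrow> (x - y) \<bullet> Q (\<chi> i. vel x i) \<le> 0"
proof -
  define n where "n = real CARD('n)"
  have n: "n \<ge> 1"
    unfolding n_def by (simp add: Suc_leI)
  obtain q :: "real^'n \<Rightarrow> real^'n" where q: "linear q" "\<And>a b. q a \<bullet> b = a \<bullet> q b"
    "\<And>a. a \<noteq> 0 \<Longrightarrow> 0 < a \<bullet> q a"
    "\<And>z. q (\<chi> i. \<Sum>j\<in>nbrs E i. z i - z j) = (\<chi> i. z i - (\<Sum>i\<in>UNIV. z i) / n)"
    "\<And>s. q (\<chi> i. s) = (\<chi> i. s / n)"
    by (rule laplacian_inverse[OF sym connected, folded n_def]) blast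
  \<comment> \<open>Strictly positive, since the bound for the cross term is obtained by cancelling
    this factor.\<close>
  define \<Lambda>' where "\<Lambda>' = \<Lambda> + 1"
  have \<Lambda>': "\<Lambda>' > 0"
    using Lambda_nonneg by (simp add: \<Lambda>'_def)
  define \<beta> where "\<beta> = c * \<Lambda>'"
  have \<beta>: "\<beta> > 0"
    using c_pos \<Lambda>' by (simp add: \<beta>_def)
  define Q :: "real^'n \<Rightarrow> real^'n" where "Q a = q a + (\<chi> i. \<beta> * (\<Sum>i\<in>UNIV. a $ i))" for a
  have inner_Q: "b \<bullet> Q a = b \<bullet> q a + \<beta> * (\<Sum>i\<in>UNIV. b $ i) * (\<Sum>i\<in>UNIV. a $ i)" for a b
  proof -
    have "b \<bullet> (\<chi> i. s) = (\<Sum>i\<in>UNIV. b $ i) * s" for s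
      by (simp add: inner_vec_def sum_distrib_right)
    then show ?thesis
      by (simp add: Q_def inner_add_right mult.assoc mult.left_commute)
  qed
  show thesis
  proof (rule that[of Q])
    show "linear Q"
    proof (rule linearI)
      show "Q (a + b) = Q a + Q b" for a b
        by (simp add: Q_def linear_add[OF q(1)] vec_eq_iff sum.distrib algebra_simps)
      show "Q (r *\<^sub>R a) = r *\<^sub>R Q a" for r a
        by (simp add: Q_def linear_scale[OF q(1)] vec_eq_iff sum_distrib_left[symmetric] algebra_simps)
    qed
    show "Q a \<bullet> b = a \<bullet> Q b" for a b
      unfolding inner_commute[of "Q a"] inner_Q using q(2)[of a b] by (simp add: inner_commute)
    show "0 < a \<bullet> Q a" if "a \<noteq> 0" for a
      unfolding inner_Q mult.assoc using q(3)[OF that] \<beta> by (intro add_pos_nonneg) auto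
    show "(x - y) \<bullet> Q (\<chi> i. vel x i) \<le> 0" if y: "y \<in> Sol" for x y
    proof -
      define W where "W i = w i (x $ i)" for i
      define z where "z = x - y"
      define \<sigma> where "\<sigma> = excess x"
      define SW where "SW = (\<Sum>i\<in>UNIV. W i)"
      have sum_z: "(\<Sum>i\<in>UNIV. z $ i) = \<sigma>"
        using y excess_diff[of x y] by (simp add: z_def \<sigma>_def Sol_def)
      have vel_eq: "(\<chi> i. vel x i) = (- c) *\<^sub>R (\<chi> i. \<Sum>j\<in>nbrs E i. W i - W j) + (\<chi> i. - \<sigma>)"
        by (simp add: vec_eq_iff vel_def W_def \<sigma>_def)
      have q_vel: "q (\<chi> i. vel x i) = (- c) *\<^sub>R (\<chi> i. W i - SW / n) + (\<chi> i. - \<sigma> / n)"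
        unfolding vel_eq linear_add[OF q(1)] linear_scale[OF q(1)] q(4) q(5) SW_def ..
      have sum_vel: "(\<Sum>i\<in>UNIV. vel x i) = - n * \<sigma>"
        using sum_vel[of "\<lambda>_. 0" 1 x] by (simp add: dirichlet_def n_def \<sigma>_def)
      have "z \<bullet> q (\<chi> i. vel x i) = (\<Sum>i\<in>UNIV. - c * (z $ i * W i) + (c * SW / n - \<sigma> / n) * z $ i)"
        unfolding q_vel inner_vec_def by (intro sum.cong refl) (simp add: algebra_simps)
      also have "\<dots> = - c * (\<Sum>i\<in>UNIV. z $ i * W i) + (c * SW / n - \<sigma> / n) * \<sigma>"
        unfolding sum.distrib sum_distrib_left[symmetric] sum_z ..
      finally have zq: "z \<bullet> q (\<chi> i. vel x i) = - c * (\<Sum>i\<in>UNIV. z $ i * W i) + c * SW / n * \<sigma> - \<sigma>\<^sup>2 / n"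
        by (simp add: algebra_simps power2_eq_square)
      have cross: "\<sigma> / n * W i \<le> z $ i * W i + \<Lambda>' * \<sigma>\<^sup>2" for i
      proof -
        have w0: "w i (y $ i) = 0"
          using y by (simp add: Sol_def)
        have sign: "0 \<le> z $ i * W i"
        proof (cases "y $ i \<le> x $ i")
          case True
          then show ?thesis
            using w_mono[OF True, of i] by (simp add: z_def W_def w0)
        next
          case False
          then have "W i \<le> 0"
            using w_mono[of "x $ i" "y $ i" i] by (simp add: W_def w0)
          then show ?thesis
            using False by (intro mult_nonpos_nonpos) (auto simp: z_def)
        qed
        have "\<bar>W i\<bar> \<le> \<Lambda> * \<bar>z $ i\<bar>"
          using w_lip[of i "x $ i" "y $ i"] by (simp add: W_def w0 z_def)
        then have "\<bar>W i\<bar> \<le> \<Lambda>' * \<bar>z $ i\<bar>"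
          by (simp add: \<Lambda>'_def distrib_right)
        then have "\<bar>W i\<bar> * \<bar>W i\<bar> \<le> \<Lambda>' * \<bar>z $ i\<bar> * \<bar>W i\<bar>"
          by (rule mult_right_mono) simp
        then have co: "W i * W i \<le> \<Lambda>' * (z $ i * W i)"
          using sign by (simp add: mult.assoc abs_mult[symmetric])
        have "2 * (W i * (\<Lambda>' * (\<sigma> / n))) \<le> W i * W i + (\<Lambda>' * (\<sigma> / n)) * (\<Lambda>' * (\<sigma> / n))"
          using sum_squares_bound[of "W i" "\<Lambda>' * (\<sigma> / n)"] by (simp add: power2_eq_square mult.assoc)
        moreover have "0 \<le> (W i - \<Lambda>' * (\<sigma> / n)) * (W i - \<Lambda>' * (\<sigma> / n)) + W i * W i + (\<Lambda>' * (\<sigma> / n)) * (\<Lambda>' * (\<sigma> / n))"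
          by (intro add_nonneg_nonneg zero_le_square)
        ultimately have "W i * (\<Lambda>' * (\<sigma> / n)) \<le> W i * W i + (\<Lambda>' * (\<sigma> / n)) * (\<Lambda>' * (\<sigma> / n))"
          using zero_le_square[of "W i"] zero_le_square[of "\<Lambda>' * (\<sigma> / n)"] by linarith
        also have "\<dots> \<le> \<Lambda>' * (z $ i * W i) + \<Lambda>' * (\<Lambda>' * (\<sigma> / n)\<^sup>2)"
          using co by (simp add: power2_eq_square mult_ac)
        finally have "\<Lambda>' * (\<sigma> / n * W i) \<le> \<Lambda>' * (z $ i * W i + \<Lambda>' * (\<sigma> / n)\<^sup>2)"
          by (simp add: algebra_simps)
        then have "\<sigma> / n * W i \<le> z $ i * W i + \<Lambda>' * (\<sigma> / n)\<^sup>2"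
          using \<Lambda>' by (simp only: mult_le_cancel_left_pos)
        moreover have "(\<sigma> / n)\<^sup>2 \<le> \<sigma>\<^sup>2"
        proof -
          have "\<sigma>\<^sup>2 / n\<^sup>2 \<le> \<sigma>\<^sup>2 / 1"
            using n by (intro divide_left_mono) auto
          then show ?thesis by (simp add: power_divide)
        qed
        then have "\<Lambda>' * (\<sigma> / n)\<^sup>2 \<le> \<Lambda>' * \<sigma>\<^sup>2"
          using \<Lambda>' by (intro mult_left_mono) auto
        ultimately show ?thesis by linarith
      qed
      have "(\<Sum>i\<in>UNIV. \<sigma> / n * W i) \<le> (\<Sum>i\<in>UNIV. z $ i * W i + \<Lambda>' * \<sigma>\<^sup>2)"
        by (intro sum_mono cross)
      then have "\<sigma> / n * SW \<le> (\<Sum>i\<in>UNIV. z $ i * W i) + n * (\<Lambda>' * \<sigma>\<^sup>2)"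
        by (simp add: SW_def n_def sum_distrib_left sum.distrib)
      then have "c * (\<sigma> / n * SW) \<le> c * ((\<Sum>i\<in>UNIV. z $ i * W i) + n * (\<Lambda>' * \<sigma>\<^sup>2))"
        using c_pos by (intro mult_left_mono) auto
      then have "c * SW / n * \<sigma> \<le> c * (\<Sum>i\<in>UNIV. z $ i * W i) + \<beta> * \<sigma> * (n * \<sigma>)"
        by (simp add: \<beta>_def power2_eq_square algebra_simps)
      moreover have "0 \<le> \<sigma>\<^sup>2 / n"
        using n by simp
      moreover have "z \<bullet> Q (\<chi> i. vel x i) = z \<bullet> q (\<chi> i. vel x i) - \<beta> * \<sigma> * (n * \<sigma>)"
        unfolding inner_Q sum_z by (simp add: sum_vel)
      ultimately show ?thesis
        using zq unfolding z_def[symmetric] by linarith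
    qed
  qed
qed

text \<open>The energy relative to \<open>x\<close> decreases up to summable terms and hence
  converges; along \<open>r\<close> it tends to 0, so its limit is 0.\<close>

lemma converges_to_cluster_point:
  fixes X :: "nat \<Rightarrow> real^'n" and e :: "nat \<Rightarrow> 'n \<Rightarrow> real" and \<gamma> :: "nat \<Rightarrow> real"
  assumes XB: "\<And>k. X k \<in> Box"
    and X: "\<And>k. X (Suc k) = proj (\<chi> i. X k $ i + \<gamma> k * (vel (X k) i + e k i))"
    and ev_int: "eventually (\<lambda>k. \<forall>i. lo $ i < X k $ i \<and> X k $ i < hi $ i) sequentially"
    and x: "x \<in> Sol" and r: "strict_mono r" "(X \<circ> r) \<longlonglongrightarrow> x"
    and \<gamma>: "\<And>k. \<gamma> k > 0" "summable (\<lambda>k. (\<gamma> k)\<^sup>2)"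
    and e2: "\<And>i. summable (\<lambda>k. (\<gamma> k)\<^sup>2 * (e k i)\<^sup>2)"
    and e1: "\<And>i. summable (\<lambda>k. \<gamma> k * e k i)"
    and Xe: "\<And>i j. summable (\<lambda>k. \<gamma> k * (X k $ j * e k i))"
  shows "X \<longlonglongrightarrow> x"
proof -
  obtain Q :: "real^'n \<Rightarrow> real^'n" where Q: "linear Q" "\<And>a b. Q a \<bullet> b = a \<bullet> Q b"
    "\<And>a. a \<noteq> 0 \<Longrightarrow> 0 < a \<bullet> Q a"
    "\<And>x y. y \<in> Sol \<Longrightarrow> (x - y) \<bullet> Q (\<chi> i. vel x i) \<le> 0"
    by (rule energy) blast
  define H where "H k = (X k - x) \<bullet> Q (X k - x)" for k
  obtain b where b: "b > 0" "\<And>a. norm (Q a) \<le> b * norm a"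
    using linear_bounded_pos[OF Q(1)] by blast
  obtain B where B: "\<And>x i. x \<in> Box \<Longrightarrow> (vel x i)\<^sup>2 \<le> B"
    using vel_bounded by metis
  define n where "n = real CARD('n)"
  define m where "m i j = Q (axis i 1) $ j" for i j :: 'n
  \<comment> \<open>The cluster point \<open>x\<close> depends on the whole path, so a weight
    containing it would not be predictable. Expanding with the matrix \<open>m\<close> of
    \<open>Q\<close> turns its coordinates into fixed factors; the noise itself is weighted only by
    1 and by coordinates of \<open>X k\<close>.\<close>
  define s where "s k = 2 * (\<Sum>i\<in>UNIV. \<Sum>j\<in>UNIV. m i j * (\<gamma> k * (X k $ j * e k i) - x $ j * (\<gamma> k * e k i)))
      + b * (2 * (n * B * (\<gamma> k)\<^sup>2 + (\<Sum>i\<in>UNIV. (\<gamma> k)\<^sup>2 * (e k i)\<^sup>2)))" for k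
  have s: "summable s"
    unfolding s_def[abs_def]
    by (intro summable_add summable_mult summable_sum summable_diff \<gamma> e1 e2 Xe)
  obtain k0 where k0: "\<And>k. k \<ge> k0 \<Longrightarrow> \<forall>i. lo $ i < X k $ i \<and> X k $ i < hi $ i"
    using ev_int by (auto simp: eventually_sequentially)
  have step: "H (Suc k) \<le> H k + s k" if "k \<ge> k0" for k
  proof -
    define y where "y = X k - x"
    define v where "v = (\<chi> i. vel (X k) i)"
    define u where "u = (\<chi> i. e k i)"
    define d where "d = \<gamma> k *\<^sub>R (v + u)"
    \<comment> \<open>Interiority is used at \<open>Suc k\<close>: a projected point inside the open
      box shows that nothing was clipped in the step leading to it.\<close>
    have int: "\<forall>i. lo $ i < X (Suc k) $ i \<and> X (Suc k) $ i < hi $ i"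
      by (rule k0) (use that in simp)
    have "X (Suc k) = (\<chi> i. X k $ i + \<gamma> k * (vel (X k) i + e k i))"
      using int unfolding X[of k] by (intro proj_interior) blast+
    then have "X (Suc k) - x = y + d"
      by (simp add: y_def d_def v_def u_def vec_eq_iff)
    then have "H (Suc k) = (y + d) \<bullet> Q (y + d)"
      by (simp add: H_def)
    also have "\<dots> = y \<bullet> Q y + 2 * (y \<bullet> Q d) + d \<bullet> Q d"
      using Q(2)[of y d] by (simp add: linear_add[OF Q(1)] inner_add_left inner_add_right inner_commute)
    also have "y \<bullet> Q d \<le> \<gamma> k * (y \<bullet> Q u)"
    proof -
      have "y \<bullet> Q d = \<gamma> k * (y \<bullet> Q v) + \<gamma> k * (y \<bullet> Q u)"
        by (simp add: d_def linear_add[OF Q(1)] linear_scale[OF Q(1)] inner_add_right distrib_left)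
      moreover have "\<gamma> k * (y \<bullet> Q v) \<le> 0"
        using Q(4)[OF x, of "X k"] \<gamma>(1)[of k] by (simp add: y_def v_def mult_nonneg_nonpos)
      ultimately show ?thesis by simp
    qed
    also have "\<gamma> k * (y \<bullet> Q u) = (\<Sum>i\<in>UNIV. \<Sum>j\<in>UNIV. m i j * (\<gamma> k * (X k $ j * e k i) - x $ j * (\<gamma> k * e k i)))"
    proof -
      have Qy: "Q y $ i = (\<Sum>j\<in>UNIV. y $ j * m i j)" for i
      proof -
        have "Q y $ i = Q y \<bullet> axis i 1"
          by (simp add: inner_axis)
        also have "\<dots> = y \<bullet> Q (axis i 1)"
          by (rule Q(2))
        also have "\<dots> = (\<Sum>j\<in>UNIV. y $ j * m i j)"
          by (simp add: inner_vec_def m_def)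
        finally show ?thesis .
      qed
      have "y \<bullet> Q u = (\<Sum>i\<in>UNIV. Q y $ i * e k i)"
        using Q(2)[of y u] by (simp add: inner_vec_def u_def)
      then show ?thesis
        unfolding Qy sum_distrib_left sum_distrib_right
        by (simp add: y_def algebra_simps sum_distrib_left)
    qed
    also have "d \<bullet> Q d \<le> b * (2 * (n * B * (\<gamma> k)\<^sup>2 + (\<Sum>i\<in>UNIV. (\<gamma> k)\<^sup>2 * (e k i)\<^sup>2)))"
    proof -
      have "d \<bullet> Q d \<le> norm d * norm (Q d)"
        by (rule norm_cauchy_schwarz)
      also have "\<dots> \<le> norm d * (b * norm d)"
        using b(2) by (intro mult_left_mono) auto
      also have "\<dots> = b * (d \<bullet> d)"
        by (simp add: power2_norm_eq_inner[symmetric] power2_eq_square)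
      also have "d \<bullet> d = (\<Sum>i\<in>UNIV. (\<gamma> k * (vel (X k) i + e k i))\<^sup>2)"
        by (simp add: inner_vec_def d_def v_def u_def power2_eq_square)
      also have "b * \<dots> \<le> b * (2 * (\<gamma> k)\<^sup>2 * (n * B + (\<Sum>i\<in>UNIV. (e k i)\<^sup>2)))"
        unfolding n_def using b(1) by (intro mult_left_mono quadratic_error B XB) auto
      also have "\<dots> = b * (2 * (n * B * (\<gamma> k)\<^sup>2 + (\<Sum>i\<in>UNIV. (\<gamma> k)\<^sup>2 * (e k i)\<^sup>2)))"
        by (simp add: sum_distrib_left[symmetric] algebra_simps)
      finally show ?thesis .
    qed
    finally show ?thesis
      by (simp add: H_def y_def s_def)
  qed
  have H_nonneg: "0 \<le> H k" for k
    using Q(3)[of "X k - x"] linear_0[OF Q(1)] by (cases "X k - x = 0") (auto simp: H_def)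
  have "convergent (\<lambda>k. H (k + k0))"
  proof (rule quasi_decreasing(1)[where d = "\<lambda>_. 0" and s = "\<lambda>k. s (k + k0)" and b = 0])
    show "H (Suc k + k0) \<le> H (k + k0) - 0 + s (k + k0)" for k
      using step[of "k + k0"] by simp
    show "summable (\<lambda>k. s (k + k0))"
      using s by (simp add: summable_iff_shift)
  qed (use H_nonneg in auto)
  then obtain l where "(\<lambda>k. H (k + k0)) \<longlonglongrightarrow> l"
    by (auto simp: convergent_def)
  then have l: "H \<longlonglongrightarrow> l"
    by (rule LIMSEQ_offset)
  have Q_cont: "continuous_on A (\<lambda>z. (z - x) \<bullet> Q (z - x))" for A
    by (intro continuous_intros linear_continuous_on_compose[OF _ Q(1)])
  have "(\<lambda>k. H (r k)) \<longlonglongrightarrow> (x - x) \<bullet> Q (x - x)"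
    using continuous_on_tendsto_compose[OF Q_cont[of UNIV] r(2)] by (simp add: H_def o_def)
  moreover have "(\<lambda>k. H (r k)) \<longlonglongrightarrow> l"
    using LIMSEQ_subseq_LIMSEQ[OF l r(1)] by (simp add: o_def)
  ultimately have "l = 0"
    using LIMSEQ_unique by fastforce
  show ?thesis
  proof (rule tendstoI)
    fix \<epsilon> :: real assume "\<epsilon> > 0"
    \<comment> \<open>On this compact set the positive definite form has a positive minimum, so
      small energy forces closeness to \<open>x\<close>.\<close>
    define D where "D = Box \<inter> {z. \<epsilon> \<le> dist z x}"
    have "closed {z. \<epsilon> \<le> dist z x}"
      by (intro closed_Collect_le continuous_intros)
    then have "compact D"
      unfolding D_def by (intro compact_Int_closed compact_box_domain)
    have "\<exists>\<mu>>0. \<forall>z\<in>D. \<mu> \<le> (z - x) \<bullet> Q (z - x)"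
    proof (cases "D = {}")
      case True
      then show ?thesis by (auto intro: zero_less_one)
    next
      case False
      then obtain z0 where z0: "z0 \<in> D" "\<And>z. z \<in> D \<Longrightarrow> (z0 - x) \<bullet> Q (z0 - x) \<le> (z - x) \<bullet> Q (z - x)"
        using continuous_attains_inf[OF \<open>compact D\<close> False Q_cont] by blast
      have "z0 - x \<noteq> 0"
        using z0(1) \<open>\<epsilon> > 0\<close> by (auto simp: D_def)
      then show ?thesis
        using Q(3) z0(2) by blast
    qed
    then obtain \<mu> where \<mu>: "\<mu> > 0" "\<And>z. z \<in> D \<Longrightarrow> \<mu> \<le> (z - x) \<bullet> Q (z - x)"
      by blast
    have "eventually (\<lambda>k. H k < \<mu>) sequentially"
      using l \<mu>(1) unfolding \<open>l = 0\<close> by (rule order_tendstoD(2))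
    then show "eventually (\<lambda>k. dist (X k) x < \<epsilon>) sequentially"
    proof eventually_elim
      case (elim k)
      then have "X k \<notin> D"
        using \<mu>(2)[of "X k"] by (auto simp: H_def)
      then show ?case
        using XB[of k] by (auto simp: D_def)
    qed
  qed
qed

lemma projected_trajectory_converges:
  obtains g :: "real^'n \<Rightarrow> 'n \<Rightarrow> real" where "\<And>i. continuous_on UNIV (\<lambda>x. g x i)"
    "\<And>X e \<gamma>. X 0 \<in> Box \<Longrightarrow> (\<And>k. X (Suc k) = proj (\<chi> i. X k $ i + \<gamma> k * (vel (X k) i + e k i))) \<Longrightarrow>
      (\<And>k. \<gamma> k > 0) \<Longrightarrow> \<not> summable \<gamma> \<Longrightarrow> summable (\<lambda>k. (\<gamma> k)\<^sup>2) \<Longrightarrow>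
      (\<And>i. summable (\<lambda>k. (\<gamma> k)\<^sup>2 * (e k i)\<^sup>2)) \<Longrightarrow> (\<And>i. summable (\<lambda>k. \<gamma> k * (g (X k) i * e k i))) \<Longrightarrow>
      (\<And>i. summable (\<lambda>k. \<gamma> k * e k i)) \<Longrightarrow> (\<And>i j. summable (\<lambda>k. \<gamma> k * (X k $ j * e k i))) \<Longrightarrow>
      \<exists>x\<in>Sol. X \<longlonglongrightarrow> x"
proof (rule confinement)
  fix g :: "real^'n \<Rightarrow> 'n \<Rightarrow> real"
  assume g: "\<And>i. continuous_on UNIV (\<lambda>x. g x i)"
    and conf: "\<And>X e \<gamma>. X 0 \<in> Box \<Longrightarrow> (\<And>k. X (Suc k) = proj (\<chi> i. X k $ i + \<gamma> k * (vel (X k) i + e k i))) \<Longrightarrow>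
      (\<And>k. \<gamma> k > 0) \<Longrightarrow> \<not> summable \<gamma> \<Longrightarrow> summable (\<lambda>k. (\<gamma> k)\<^sup>2) \<Longrightarrow>
      (\<And>i. summable (\<lambda>k. (\<gamma> k)\<^sup>2 * (e k i)\<^sup>2)) \<Longrightarrow> (\<And>i. summable (\<lambda>k. \<gamma> k * (g (X k) i * e k i))) \<Longrightarrow>
      (\<forall>k. X k \<in> Box) \<and> eventually (\<lambda>k. \<forall>i. lo $ i < X k $ i \<and> X k $ i < hi $ i) sequentially \<and>
      (\<exists>x r. x \<in> Sol \<and> strict_mono r \<and> (X \<circ> r) \<longlonglongrightarrow> x)"
  show thesis
  proof (rule that[OF g])
    fix X :: "nat \<Rightarrow> real^'n" and e :: "nat \<Rightarrow> 'n \<Rightarrow> real" and \<gamma> :: "nat \<Rightarrow> real"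
    assume X0: "X 0 \<in> Box" and X: "\<And>k. X (Suc k) = proj (\<chi> i. X k $ i + \<gamma> k * (vel (X k) i + e k i))"
      and \<gamma>: "\<And>k. \<gamma> k > 0" "\<not> summable \<gamma>" "summable (\<lambda>k. (\<gamma> k)\<^sup>2)"
      and e2: "\<And>i. summable (\<lambda>k. (\<gamma> k)\<^sup>2 * (e k i)\<^sup>2)"
      and ge: "\<And>i. summable (\<lambda>k. \<gamma> k * (g (X k) i * e k i))"
      and e1: "\<And>i. summable (\<lambda>k. \<gamma> k * e k i)" and Xe: "\<And>i j. summable (\<lambda>k. \<gamma> k * (X k $ j * e k i))"
    have XB: "X k \<in> Box" for k
      using conf[OF X0 X \<gamma> e2 ge, THEN conjunct1] ..
    note ev_int = conf[OF X0 X \<gamma> e2 ge, THEN conjunct2, THEN conjunct1]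
    obtain x r where "x \<in> Sol" "strict_mono r" "(X \<circ> r) \<longlonglongrightarrow> x"
      using conf[OF X0 X \<gamma> e2 ge, THEN conjunct2, THEN conjunct2] by (elim exE conjE)
    then have "X \<longlonglongrightarrow> x"
      by (rule converges_to_cluster_point[OF XB X ev_int _ _ _ \<gamma>(1,3) e2 e1 Xe])
    then show "\<exists>x\<in>Sol. X \<longlonglongrightarrow> x"
      using \<open>x \<in> Sol\<close> by blast
  qed
qed

end

section \<open>Summability of the weighted noise\<close>

lemma integrable_mult_of_squares:
  fixes f g :: "'a \<Rightarrow> real"
  assumes [measurable]: "f \<in> borel_measurable M" "g \<in> borel_measurable M"
    and "integrable M (\<lambda>x. (f x)\<^sup>2)" "integrable M (\<lambda>x. (g x)\<^sup>2)"
  shows "integrable M (\<lambda>x. f x * g x)"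
proof (rule Bochner_Integration.integrable_bound)
  show "integrable M (\<lambda>x. (f x)\<^sup>2 + (g x)\<^sup>2)"
    using assms by simp
  have "\<bar>f x * g x\<bar> \<le> (f x)\<^sup>2 + (g x)\<^sup>2" for x
  proof -
    have "0 \<le> \<bar>f x\<bar> * \<bar>g x\<bar>"
      by simp
    then show ?thesis
      using sum_squares_bound[of "\<bar>f x\<bar>" "\<bar>g x\<bar>"] unfolding abs_mult power2_abs by linarith
  qed
  then show "AE x in M. norm (f x * g x) \<le> norm ((f x)\<^sup>2 + (g x)\<^sup>2)"
    by (auto intro: order_trans[OF _ abs_ge_self])
qed measurable

text \<open>
  Orthogonality to the past replaces the conditional expectation; in this form the property is
  visibly preserved under bounded predictable weights.
\<close>

definition square_mds :: "'a measure \<Rightarrow> (nat \<Rightarrow> 'a measure) \<Rightarrow> (nat \<Rightarrow> 'a \<Rightarrow> real) \<Rightarrow> bool" where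
  "square_mds M F \<xi> \<longleftrightarrow>
     (\<forall>k. subalgebra M (F k) \<and> subalgebra (F (Suc k)) (F k) \<and>
       \<xi> k \<in> borel_measurable (F (Suc k)) \<and> integrable M (\<lambda>\<omega>. (\<xi> k \<omega>)\<^sup>2) \<and>
       (\<forall>Y\<in>borel_measurable (F k). integrable M (\<lambda>\<omega>. Y \<omega> * \<xi> k \<omega>) \<longrightarrow> (\<integral>\<omega>. Y \<omega> * \<xi> k \<omega> \<partial>M) = 0))"

context
  fixes M :: "'a measure" and F :: "nat \<Rightarrow> 'a measure" and \<xi> :: "nat \<Rightarrow> 'a \<Rightarrow> real"
  assumes mds: "square_mds M F \<xi>"
begin

lemma mds_subalgebra: "subalgebra M (F k)"
  using mds by (auto simp: square_mds_def)

lemma mds_filtration: "j \<le> k \<Longrightarrow> subalgebra (F k) (F j)"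
proof (induction k rule: dec_induct)
  case base
  show ?case by (simp add: subalgebra_def)
next
  case (step k)
  moreover have "subalgebra (F (Suc k)) (F k)"
    using mds by (auto simp: square_mds_def)
  ultimately show ?case
    by (auto simp: subalgebra_def)
qed

lemma mds_adapted: "k < n \<Longrightarrow> \<xi> k \<in> borel_measurable (F n)"
  using mds measurable_from_subalg[OF mds_filtration[of "Suc k" n]] by (auto simp: square_mds_def)

lemma mds_measurable: "\<xi> k \<in> borel_measurable M"
  using measurable_from_subalg[OF mds_subalgebra mds_adapted[OF lessI]] .

lemma mds_square: "integrable M (\<lambda>\<omega>. (\<xi> k \<omega>)\<^sup>2)"
  using mds by (auto simp: square_mds_def)

lemma mds_orth:
  "Y \<in> borel_measurable (F k) \<Longrightarrow> integrable M (\<lambda>\<omega>. Y \<omega> * \<xi> k \<omega>) \<Longrightarrow> (\<integral>\<omega>. Y \<omega> * \<xi> k \<omega> \<partial>M) = 0"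
  using mds by (auto simp: square_mds_def)

lemma mds_sum_adapted: "n \<le> k \<Longrightarrow> (\<lambda>\<omega>. \<Sum>l<n. \<xi> l \<omega>) \<in> borel_measurable (F k)"
  by (intro borel_measurable_sum mds_adapted) auto

text \<open>A predictable factor can be moved into the test variable \<open>Y\<close>. This covers
  stopping indicators, the restriction to a tail, and the weights of the noise.\<close>

lemma mds_weight:
  assumes h: "\<And>k. h k \<in> borel_measurable (F k)" "\<And>k \<omega>. \<bar>h k \<omega>\<bar> \<le> K"
  shows "square_mds M F (\<lambda>k \<omega>. h k \<omega> * \<xi> k \<omega>)"
  unfolding square_mds_def
proof (intro allI conjI ballI impI)
  fix k
  show "subalgebra M (F k)" by (rule mds_subalgebra)
  show sub: "subalgebra (F (Suc k)) (F k)" by (rule mds_filtration) simp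
  have [measurable]: "h k \<in> borel_measurable (F (Suc k))"
    by (rule measurable_from_subalg[OF sub h(1)])
  have [measurable]: "\<xi> k \<in> borel_measurable (F (Suc k))"
    by (rule mds_adapted) simp
  show meas: "(\<lambda>\<omega>. h k \<omega> * \<xi> k \<omega>) \<in> borel_measurable (F (Suc k))"
    by measurable
  show "integrable M (\<lambda>\<omega>. (h k \<omega> * \<xi> k \<omega>)\<^sup>2)"
  proof (rule Bochner_Integration.integrable_bound)
    show "integrable M (\<lambda>\<omega>. K\<^sup>2 * (\<xi> k \<omega>)\<^sup>2)"
      using mds_square by simp
    have [measurable]: "(\<lambda>\<omega>. h k \<omega> * \<xi> k \<omega>) \<in> borel_measurable M"
      by (rule measurable_from_subalg[OF mds_subalgebra meas])
    show "(\<lambda>\<omega>. (h k \<omega> * \<xi> k \<omega>)\<^sup>2) \<in> borel_measurable M"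
      by measurable
    have "(h k \<omega>)\<^sup>2 * (\<xi> k \<omega>)\<^sup>2 \<le> K\<^sup>2 * (\<xi> k \<omega>)\<^sup>2" for \<omega>
    proof (rule mult_right_mono)
      show "(h k \<omega>)\<^sup>2 \<le> K\<^sup>2"
        using power_mono[OF h(2)[of k \<omega>], of 2] by simp
    qed simp
    then show "AE \<omega> in M. norm ((h k \<omega> * \<xi> k \<omega>)\<^sup>2) \<le> norm (K\<^sup>2 * (\<xi> k \<omega>)\<^sup>2)"
      by (simp add: power_mult_distrib)
  qed
next
  fix k Y
  assume Y: "Y \<in> borel_measurable (F k)" "integrable M (\<lambda>\<omega>. Y \<omega> * (h k \<omega> * \<xi> k \<omega>))"
  have "(\<integral>\<omega>. (Y \<omega> * h k \<omega>) * \<xi> k \<omega> \<partial>M) = 0"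
    using Y h(1)[of k] by (intro mds_orth) (auto simp: mult.assoc)
  then show "(\<integral>\<omega>. Y \<omega> * (h k \<omega> * \<xi> k \<omega>) \<partial>M) = 0"
    by (simp add: mult.assoc)
qed

text \<open>Pythagoras: each term is orthogonal to the sum of the earlier ones.\<close>

lemma mds_variance:
  "integrable M (\<lambda>\<omega>. (\<Sum>k<n. \<xi> k \<omega>)\<^sup>2) \<and>
   (\<integral>\<omega>. (\<Sum>k<n. \<xi> k \<omega>)\<^sup>2 \<partial>M) = (\<Sum>k<n. \<integral>\<omega>. (\<xi> k \<omega>)\<^sup>2 \<partial>M)"
proof (induction n)
  case 0
  show ?case by simp
next
  case (Suc n)
  let ?S = "\<lambda>\<omega>. \<Sum>k<n. \<xi> k \<omega>"
  have SF: "?S \<in> borel_measurable (F n)"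
    by (rule mds_sum_adapted) simp
  have i: "integrable M (\<lambda>\<omega>. ?S \<omega> * \<xi> n \<omega>)"
    using Suc.IH by (intro integrable_mult_of_squares mds_measurable mds_square borel_measurable_sum) auto
  then have o: "(\<integral>\<omega>. ?S \<omega> * \<xi> n \<omega> \<partial>M) = 0"
    by (rule mds_orth[OF SF])
  have eq: "(\<Sum>k<Suc n. \<xi> k \<omega>)\<^sup>2 = (?S \<omega>)\<^sup>2 + 2 * (?S \<omega> * \<xi> n \<omega>) + (\<xi> n \<omega>)\<^sup>2" for \<omega>
    by (simp add: power2_sum algebra_simps)
  show ?case
    unfolding eq using Suc.IH i o mds_square[of n] by simp
qed

end

section \<open>Maximal inequality and almost sure convergence of martingale sums\<close>

lemma (in prob_space) mds_maximal_inequality: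
  assumes mds: "square_mds M F \<xi>" and "\<delta> > 0"
  shows "prob {\<omega> \<in> space M. \<exists>n\<le>N. \<delta> \<le> \<bar>\<Sum>k<n. \<xi> k \<omega>\<bar>} \<le> (\<Sum>k<N. \<integral>\<omega>. (\<xi> k \<omega>)\<^sup>2 \<partial>M) / \<delta>\<^sup>2"
proof -
  define S where "S n \<omega> = (\<Sum>k<n. \<xi> k \<omega>)" for n \<omega>
  \<comment> \<open>\<open>S k\<close> involves only terms of index below \<open>k\<close>, so this
    indicator that level \<open>\<delta>\<close> has not been reached is measurable for
    \<open>F k\<close>. Weighted by it, the sum freezes at the first crossing, and Chebyshev's
    inequality at time \<open>N\<close> accounts for all earlier times.\<close>
  define h where "h k \<omega> = (if \<forall>j\<le>k. \<bar>S j \<omega>\<bar> < \<delta> then 1 else 0 :: real)" for k \<omega>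
  have hF: "h k \<in> borel_measurable (F k)" for k
  proof -
    have "(\<lambda>\<omega>. if \<bar>S j \<omega>\<bar> < \<delta> then 1 else 0 :: real) \<in> borel_measurable (F k)" if "j \<in> {..k}" for j
    proof -
      have [measurable]: "S j \<in> borel_measurable (F k)"
        unfolding S_def[abs_def] using mds_sum_adapted[OF mds, of j k] that by simp
      show ?thesis
        by measurable
    qed
    then have "(\<lambda>\<omega>. \<Prod>j\<in>{..k}. if \<bar>S j \<omega>\<bar> < \<delta> then 1 else 0 :: real) \<in> borel_measurable (F k)"
      by (rule borel_measurable_prod)
    moreover have "(\<lambda>\<omega>. \<Prod>j\<in>{..k}. if \<bar>S j \<omega>\<bar> < \<delta> then 1 else 0 :: real) = h k"
      by (auto simp: h_def fun_eq_iff intro!: prod.neutral prod_zero)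
    ultimately show ?thesis
      by simp
  qed
  have h1: "\<bar>h k \<omega>\<bar> \<le> 1" for k \<omega>
    by (simp add: h_def)
  let ?\<xi> = "\<lambda>k \<omega>. h k \<omega> * \<xi> k \<omega>"
  have mds': "square_mds M F ?\<xi>"
    by (rule mds_weight[OF mds hF h1])
  note var = mds_variance[OF mds', of N]
  have [measurable]: "(\<lambda>\<omega>. \<Sum>k<n. ?\<xi> k \<omega>) \<in> borel_measurable M" for n
    by (intro borel_measurable_sum mds_measurable[OF mds'])
  have stop: "\<delta>\<^sup>2 \<le> (\<Sum>k<N. ?\<xi> k \<omega>)\<^sup>2" if ex: "\<exists>n\<le>N. \<delta> \<le> \<bar>S n \<omega>\<bar>" for \<omega>
  proof -
    obtain n where n1: "\<delta> \<le> \<bar>S n \<omega>\<bar>" and least: "\<forall>j<n. \<not> \<delta> \<le> \<bar>S j \<omega>\<bar>"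
      using ex exists_least_iff[of "\<lambda>n. \<delta> \<le> \<bar>S n \<omega>\<bar>"] by blast
    have n2: "n \<le> N"
      using ex least by (meson le_trans not_le)
    have less: "\<bar>S j \<omega>\<bar> < \<delta>" if "j < n" for j
      using least that by (meson not_le)
    have h_ge: "h k \<omega> = 0" if "n \<le> k" for k
    proof -
      have "\<not> (\<forall>j\<le>k. \<bar>S j \<omega>\<bar> < \<delta>)"
        using n1 that not_le by blast
      then show ?thesis
        by (simp only: h_def if_False)
    qed
    have h_less: "h k \<omega> = 1" if "k < n" for k
    proof -
      have "\<forall>j\<le>k. \<bar>S j \<omega>\<bar> < \<delta>"
        using less that by (meson le_less_trans)
      then show ?thesis
        by (simp add: h_def)
    qed
    have "(\<Sum>k<N. ?\<xi> k \<omega>) = (\<Sum>k<n. \<xi> k \<omega>)"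
    proof (rule sum.mono_neutral_cong_right)
      show "\<forall>k\<in>{..<N} - {..<n}. ?\<xi> k \<omega> = 0"
        by (auto simp: h_ge)
      show "?\<xi> k \<omega> = \<xi> k \<omega>" if "k \<in> {..<n}" for k
        using that by (simp add: h_less)
    qed (use n2 in auto)
    then have "\<delta> \<le> \<bar>\<Sum>k<N. ?\<xi> k \<omega>\<bar>"
      using n1 by (simp add: S_def)
    then show ?thesis
      using power_mono[of \<delta> "\<bar>\<Sum>k<N. ?\<xi> k \<omega>\<bar>" 2] \<open>\<delta> > 0\<close> by simp
  qed
  have "prob {\<omega> \<in> space M. \<exists>n\<le>N. \<delta> \<le> \<bar>S n \<omega>\<bar>} \<le> prob {\<omega> \<in> space M. \<delta>\<^sup>2 \<le> (\<Sum>k<N. ?\<xi> k \<omega>)\<^sup>2}"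
  proof (rule finite_measure_mono)
    show "{\<omega> \<in> space M. \<exists>n\<le>N. \<delta> \<le> \<bar>S n \<omega>\<bar>} \<subseteq> {\<omega> \<in> space M. \<delta>\<^sup>2 \<le> (\<Sum>k<N. ?\<xi> k \<omega>)\<^sup>2}"
      using stop by blast
  qed measurable
  also have "\<dots> \<le> (\<integral>\<omega>. (\<Sum>k<N. ?\<xi> k \<omega>)\<^sup>2 \<partial>M) / \<delta>\<^sup>2"
    using var \<open>\<delta> > 0\<close> by (intro integral_Markov_inequality_measure[where A = "space M"]) auto
  also have "\<dots> \<le> (\<Sum>k<N. \<integral>\<omega>. (\<xi> k \<omega>)\<^sup>2 \<partial>M) / \<delta>\<^sup>2"
  proof (intro divide_right_mono)
    have "(?\<xi> k \<omega>)\<^sup>2 \<le> (\<xi> k \<omega>)\<^sup>2" for k \<omega>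
      by (simp add: h_def)
    then show "(\<integral>\<omega>. (\<Sum>k<N. ?\<xi> k \<omega>)\<^sup>2 \<partial>M) \<le> (\<Sum>k<N. \<integral>\<omega>. (\<xi> k \<omega>)\<^sup>2 \<partial>M)"
      unfolding var[THEN conjunct2]
      by (intro sum_mono integral_mono mds_square[OF mds] mds_square[OF mds'])
  qed simp
  finally show ?thesis
    by (simp add: S_def)
qed

lemma (in prob_space) mds_AE_summable:
  assumes mds: "square_mds M F \<xi>" and sq: "summable (\<lambda>k. \<integral>\<omega>. (\<xi> k \<omega>)\<^sup>2 \<partial>M)"
  shows "AE \<omega> in M. summable (\<lambda>k. \<xi> k \<omega>)"
proof -
  have [measurable]: "\<xi> k \<in> borel_measurable M" for k
    by (rule mds_measurable[OF mds])
  \<comment> \<open>Partial sums of the tail from \<open>m\<close> on, written as 0-1 weights on all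
    indices so that the maximal inequality applies without a shifted filtration.\<close>
  define T where "T m n \<omega> = (\<Sum>k<n. (if m \<le> k then 1 else 0) * \<xi> k \<omega>)" for m n \<omega>
  define v where "v k = (\<integral>\<omega>. (\<xi> k \<omega>)\<^sup>2 \<partial>M)" for k
  have v0: "v k \<ge> 0" for k
    by (simp add: v_def)
  have v_sum: "summable v"
    using sq by (simp add: v_def[abs_def])
  have [measurable]: "T m n \<in> borel_measurable M" for m n
    unfolding T_def[abs_def] by measurable
  have tail: "prob {\<omega> \<in> space M. \<exists>n. \<delta> \<le> \<bar>T m n \<omega>\<bar>} \<le> (\<Sum>k. v (k + m)) / \<delta>\<^sup>2" if "\<delta> > 0" for \<delta> m
  proof -
    define A where "A N = {\<omega> \<in> space M. \<exists>n\<le>N. \<delta> \<le> \<bar>T m n \<omega>\<bar>}" for N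
    have mds': "square_mds M F (\<lambda>k \<omega>. (if m \<le> k then 1 else 0) * \<xi> k \<omega>)"
      by (rule mds_weight[OF mds, where K = 1]) auto
    have "prob (A N) \<le> (\<Sum>k. v (k + m)) / \<delta>\<^sup>2" for N
    proof -
      have "prob (A N) \<le> (\<Sum>k<N. \<integral>\<omega>. ((if m \<le> k then 1 else 0) * \<xi> k \<omega>)\<^sup>2 \<partial>M) / \<delta>\<^sup>2"
        unfolding A_def T_def by (rule mds_maximal_inequality[OF mds' that])
      also have "\<dots> \<le> (\<Sum>k. v (k + m)) / \<delta>\<^sup>2"
      proof (intro divide_right_mono)
        have "(\<Sum>k<N. \<integral>\<omega>. ((if m \<le> k then 1 else 0) * \<xi> k \<omega>)\<^sup>2 \<partial>M) = (\<Sum>k<N. if m \<le> k then v k else 0)"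
          by (intro sum.cong refl) (simp add: v_def)
        also have "\<dots> \<le> (\<Sum>k<N + m. if m \<le> k then v k else 0)"
          using v0 by (intro sum_mono2) auto
        also have "\<dots> = (\<Sum>k\<in>{m..<N + m}. v k)"
          by (intro sum.mono_neutral_cong_right) auto
        also have "\<dots> = (\<Sum>k<N. v (k + m))"
          using sum.shift_bounds_nat_ivl[of v 0 m N] by (simp add: atLeast0LessThan)
        also have "\<dots> \<le> (\<Sum>k. v (k + m))"
          using v_sum v0 by (intro sum_le_suminf) (auto simp: summable_iff_shift)
        finally show "(\<Sum>k<N. \<integral>\<omega>. ((if m \<le> k then 1 else 0) * \<xi> k \<omega>)\<^sup>2 \<partial>M) \<le> (\<Sum>k. v (k + m))" .
      qed simp
      finally show ?thesis .
    qed
    moreover have "(\<lambda>N. prob (A N)) \<longlonglongrightarrow> prob (\<Union>N. A N)"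
      by (intro finite_Lim_measure_incseq) (auto simp: A_def incseq_def intro: order_trans)
    ultimately have "prob (\<Union>N. A N) \<le> (\<Sum>k. v (k + m)) / \<delta>\<^sup>2"
      by (intro LIMSEQ_le_const2) auto
    moreover have "(\<Union>N. A N) = {\<omega> \<in> space M. \<exists>n. \<delta> \<le> \<bar>T m n \<omega>\<bar>}"
      by (auto simp: A_def)
    ultimately show ?thesis
      by simp
  qed
  have ae: "AE \<omega> in M. \<exists>m. \<forall>n. \<bar>T m n \<omega>\<bar> < \<delta>" if "\<delta> > 0" for \<delta>
  proof -
    \<comment> \<open>This exceptional set lies in every tail event, and their probabilities tend to
      0 with the tails of the variance series.\<close>
    define D where "D = {\<omega> \<in> space M. \<forall>m. \<exists>n. \<delta> \<le> \<bar>T m n \<omega>\<bar>}"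
    have [measurable]: "D \<in> sets M"
      unfolding D_def by measurable
    have "prob D \<le> (\<Sum>k. v (k + m)) / \<delta>\<^sup>2" for m
      by (rule order_trans[OF _ tail[OF that, of m]], rule finite_measure_mono) (auto simp: D_def)
    moreover have "(\<lambda>m. (\<Sum>k. v (k + m)) / \<delta>\<^sup>2) \<longlonglongrightarrow> 0 / \<delta>\<^sup>2"
      using suminf_exist_split2[OF v_sum] that by (intro tendsto_intros) auto
    ultimately have "prob D \<le> 0 / \<delta>\<^sup>2"
      by (intro LIMSEQ_le_const) auto
    then have "prob D = 0"
      by (simp add: measure_le_0_iff)
    then have "AE \<omega> in M. \<omega> \<notin> D"
      by (intro AE_not_in) (simp add: null_sets_def emeasure_eq_measure)
    then show ?thesis
      by (rule AE_mp) (auto simp: D_def not_le intro!: AE_I2)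
  qed
  have "AE \<omega> in M. \<forall>r::nat. \<exists>m. \<forall>n. \<bar>T m n \<omega>\<bar> < 1 / (real r + 1)"
    unfolding AE_all_countable by (intro allI ae) auto
  then show ?thesis
  proof (rule AE_mp, intro AE_I2 impI)
    fix \<omega> assume *: "\<forall>r::nat. \<exists>m. \<forall>n. \<bar>T m n \<omega>\<bar> < 1 / (real r + 1)"
    show "summable (\<lambda>k. \<xi> k \<omega>)"
      unfolding summable_Cauchy
    proof (intro allI impI)
      fix e :: real assume "e > 0"
      then obtain r :: nat where r: "1 / (real r + 1) < e / 2"
        using reals_Archimedean[of "e / 2"] by (auto simp: field_simps inverse_eq_divide)
      obtain m where m: "\<And>n. \<bar>T m n \<omega>\<bar> < 1 / (real r + 1)"
        using * by blast
      have "norm (\<Sum>k\<in>{a..<b}. \<xi> k \<omega>) < e" if "a \<ge> m" for a b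
      proof (cases "a \<le> b")
        case True
        have "{..<b} = {..<a} \<union> {a..<b}" "{..<a} \<inter> {a..<b} = {}"
          using True by auto
        then have "T m b \<omega> = T m a \<omega> + (\<Sum>k\<in>{a..<b}. (if m \<le> k then 1 else 0) * \<xi> k \<omega>)"
          unfolding T_def by (simp add: sum.union_disjoint)
        also have "(\<Sum>k\<in>{a..<b}. (if m \<le> k then 1 else 0) * \<xi> k \<omega>) = (\<Sum>k\<in>{a..<b}. \<xi> k \<omega>)"
          using that by (intro sum.cong) auto
        finally show ?thesis
          using m[of a] m[of b] r by simp
      qed (use \<open>e > 0\<close> in simp)
      then show "\<exists>N. \<forall>a\<ge>N. \<forall>b. norm (\<Sum>k\<in>{a..<b}. \<xi> k \<omega>) < e"
        by blast
    qed
  qed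
qed

lemma (in prob_space) AE_summable_of_integrals:
  fixes X :: "nat \<Rightarrow> 'a \<Rightarrow> real"
  assumes [measurable]: "\<And>k. X k \<in> borel_measurable M" and X0: "\<And>k \<omega>. X k \<omega> \<ge> 0"
    and v: "\<And>k. (\<integral>\<^sup>+\<omega>. X k \<omega> \<partial>M) \<le> ennreal (v k)" "\<And>k. v k \<ge> 0" "summable v"
  shows "AE \<omega> in M. summable (\<lambda>k. X k \<omega>)"
proof -
  have "(\<integral>\<^sup>+\<omega>. (\<Sum>k. ennreal (X k \<omega>)) \<partial>M) = (\<Sum>k. \<integral>\<^sup>+\<omega>. X k \<omega> \<partial>M)"
    by (rule nn_integral_suminf) simp
  also have "\<dots> \<le> (\<Sum>k. ennreal (v k))"
    by (intro suminf_le v) auto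
  also have "\<dots> = ennreal (\<Sum>k. v k)"
    using v by (intro suminf_ennreal2) auto
  finally have "(\<integral>\<^sup>+\<omega>. (\<Sum>k. ennreal (X k \<omega>)) \<partial>M) \<noteq> \<infinity>"
    by (auto simp: top_unique)
  then have "AE \<omega> in M. (\<Sum>k. ennreal (X k \<omega>)) \<noteq> \<infinity>"
    by (intro nn_integral_PInf_AE) auto
  then show ?thesis
    by (rule AE_mp) (auto intro!: AE_I2 summable_suminf_not_top X0)
qed

lemma (in prob_space) weighted_noise_summable:
  fixes e b :: "nat \<Rightarrow> 'a \<Rightarrow> real" and \<gamma> :: "nat \<Rightarrow> real"
  assumes F: "\<And>k. subalgebra M (F k)" "\<And>k. subalgebra (F (Suc k)) (F k)"
    and e: "\<And>k. e k \<in> borel_measurable (F (Suc k))" "\<And>k. integrable M (e k)"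
      "\<And>k. AE \<omega> in M. real_cond_exp M (F k) (e k) \<omega> = 0"
      "AE \<omega> in M. \<exists>L<\<infinity>. (\<lambda>k. nn_cond_exp M (F k) (\<lambda>\<omega>. ennreal ((e k \<omega>)\<^sup>2)) \<omega>) \<longlonglongrightarrow> L"
    and \<gamma>: "summable (\<lambda>k. (\<gamma> k)\<^sup>2)"
    and b: "\<And>k. b k \<in> borel_measurable (F k)" "\<And>k \<omega>. \<bar>b k \<omega>\<bar> \<le> K"
  shows "AE \<omega> in M. summable (\<lambda>k. \<gamma> k * (b k \<omega> * e k \<omega>))"
    and "AE \<omega> in M. summable (\<lambda>k. (\<gamma> k)\<^sup>2 * (e k \<omega>)\<^sup>2)"
proof -
  define W where "W k = nn_cond_exp M (F k) (\<lambda>\<omega>. ennreal ((e k \<omega>)\<^sup>2))" for k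
  \<comment> \<open>\<open>W k\<close> is measurable for \<open>F k\<close>, so \<open>J B k\<close>
    is a predictable weight. It makes the product with \<open>e k\<close> square integrable even if
    \<open>e k\<close> is not.\<close>
  define J where "J B k \<omega> = (if W k \<omega> \<le> ennreal (real B) then 1 else 0 :: real)" for B k \<omega>
  have sig: "sigma_finite_subalgebra M (F k)" for k
    using F(1)[of k] by (intro finite_measure_subalgebra_is_sigma_finite)
      (simp add: finite_measure_subalgebra_def finite_measure_subalgebra_axioms_def finite_measure_axioms)
  have [measurable]: "W k \<in> borel_measurable (F k)" for k
    unfolding W_def by simp
  have JF: "J B k \<in> borel_measurable (F k)" for B k
    unfolding J_def[abs_def] by measurable
  have [measurable]: "e k \<in> borel_measurable M" for k
    using e(2) by simp
  have [measurable]: "J B k \<in> borel_measurable M" for B k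
    by (rule measurable_from_subalg[OF F(1) JF])
  have J01: "\<bar>J B k \<omega>\<bar> \<le> 1" for B k \<omega>
    by (simp add: J_def)
  have bound: "(\<integral>\<^sup>+\<omega>. (J B k \<omega> * e k \<omega>)\<^sup>2 \<partial>M) \<le> ennreal (real B)" for B k
  proof -
    interpret s: sigma_finite_subalgebra M "F k" by (rule sig)
    have "(\<integral>\<^sup>+\<omega>. (J B k \<omega> * e k \<omega>)\<^sup>2 \<partial>M) = (\<integral>\<^sup>+\<omega>. ennreal (J B k \<omega>) * ennreal ((e k \<omega>)\<^sup>2) \<partial>M)"
      by (intro nn_integral_cong) (simp add: J_def)
    also have "\<dots> = (\<integral>\<^sup>+\<omega>. ennreal (J B k \<omega>) * W k \<omega> \<partial>M)"
      unfolding W_def using JF[of B k] by (intro s.nn_cond_exp_intg[symmetric]) auto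
    also have "\<dots> \<le> (\<integral>\<^sup>+\<omega>. ennreal (real B) \<partial>M)"
      by (intro nn_integral_mono) (simp add: J_def)
    finally show ?thesis
      by (simp add: emeasure_space_1)
  qed
  have sq_int: "integrable M (\<lambda>\<omega>. (J B k \<omega> * e k \<omega>)\<^sup>2)" for B k
    by (rule integrableI_bounded) (auto intro: le_less_trans[OF bound])
  have sq_le: "(\<integral>\<omega>. (J B k \<omega> * e k \<omega>)\<^sup>2 \<partial>M) \<le> real B" for B k
    using bound[of B k] by (subst (asm) nn_integral_eq_integral[OF sq_int]) auto
  have mds: "square_mds M F (\<lambda>k \<omega>. J B k \<omega> * e k \<omega>)" for B
    unfolding square_mds_def
  proof (intro allI conjI ballI impI F sq_int)
    fix k
    have [measurable]: "J B k \<in> borel_measurable (F (Suc k))" "e k \<in> borel_measurable (F (Suc k))"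
      by (rule measurable_from_subalg[OF F(2) JF], rule e(1))
    show "(\<lambda>\<omega>. J B k \<omega> * e k \<omega>) \<in> borel_measurable (F (Suc k))"
      by measurable
  next
    fix k Y
    assume Y: "Y \<in> borel_measurable (F k)" "integrable M (\<lambda>\<omega>. Y \<omega> * (J B k \<omega> * e k \<omega>))"
    interpret s: sigma_finite_subalgebra M "F k" by (rule sig)
    have "(\<integral>\<omega>. (Y \<omega> * J B k \<omega>) * e k \<omega> \<partial>M) = (\<integral>\<omega>. (Y \<omega> * J B k \<omega>) * real_cond_exp M (F k) (e k) \<omega> \<partial>M)"
      using Y JF[of B k] by (intro s.real_cond_exp_intg(2)[symmetric]) (auto simp: mult.assoc)
    also have "\<dots> = (\<integral>\<omega>. 0 \<partial>M)"
    proof (rule integral_cong_AE)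
      have [measurable]: "Y \<in> borel_measurable M" "real_cond_exp M (F k) (e k) \<in> borel_measurable M"
        using Y(1) by (auto intro: measurable_from_subalg[OF F(1)])
      show "(\<lambda>\<omega>. Y \<omega> * J B k \<omega> * real_cond_exp M (F k) (e k) \<omega>) \<in> borel_measurable M"
        by measurable
      show "AE \<omega> in M. Y \<omega> * J B k \<omega> * real_cond_exp M (F k) (e k) \<omega> = 0"
        using e(3)[of k] by eventually_elim simp
    qed simp
    finally show "(\<integral>\<omega>. Y \<omega> * (J B k \<omega> * e k \<omega>) \<partial>M) = 0"
      by (simp add: mult.assoc)
  qed
  \<comment> \<open>Square summability bounds the step sizes through |t| \<le> 1 + t^2, which makes
    the product with \<open>b\<close> a bounded weight.\<close>
  have gb: "\<bar>\<gamma> k * b k \<omega>\<bar> \<le> (1 + (\<Sum>k. (\<gamma> k)\<^sup>2)) * K" for k \<omega>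
  proof -
    have "(\<gamma> k)\<^sup>2 \<le> (\<Sum>k. (\<gamma> k)\<^sup>2)"
      using sum_le_suminf[OF \<gamma>, of "{k}"] by simp
    moreover have "\<bar>\<gamma> k\<bar> \<le> 1 + (\<gamma> k)\<^sup>2"
      using sum_squares_bound[of "\<bar>\<gamma> k\<bar>" 1] zero_le_power2[of "\<gamma> k"] unfolding power2_abs by simp
    ultimately show ?thesis
      unfolding abs_mult by (intro mult_mono b) auto
  qed
  have mds1: "square_mds M F (\<lambda>k \<omega>. (\<gamma> k * b k \<omega>) * (J B k \<omega> * e k \<omega>))" for B
    using b(1) by (intro mds_weight[OF mds _ gb]) auto
  have bM [measurable]: "b k \<in> borel_measurable M" for k
    by (rule measurable_from_subalg[OF F(1) b(1)])
  have ae1: "AE \<omega> in M. summable (\<lambda>k. (\<gamma> k * b k \<omega>) * (J B k \<omega> * e k \<omega>))" for B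
  proof (rule mds_AE_summable[OF mds1])
    have "(\<integral>\<omega>. ((\<gamma> k * b k \<omega>) * (J B k \<omega> * e k \<omega>))\<^sup>2 \<partial>M) \<le> (\<gamma> k)\<^sup>2 * (K\<^sup>2 * real B)" for k
    proof -
      have "(\<integral>\<omega>. ((\<gamma> k * b k \<omega>) * (J B k \<omega> * e k \<omega>))\<^sup>2 \<partial>M) \<le> (\<integral>\<omega>. ((\<gamma> k)\<^sup>2 * K\<^sup>2) * (J B k \<omega> * e k \<omega>)\<^sup>2 \<partial>M)"
      proof (rule integral_mono)
        show "integrable M (\<lambda>\<omega>. ((\<gamma> k * b k \<omega>) * (J B k \<omega> * e k \<omega>))\<^sup>2)"
          by (rule mds_square[OF mds1])
        show "integrable M (\<lambda>\<omega>. ((\<gamma> k)\<^sup>2 * K\<^sup>2) * (J B k \<omega> * e k \<omega>)\<^sup>2)"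
          using sq_int by simp
        show "((\<gamma> k * b k \<omega>) * (J B k \<omega> * e k \<omega>))\<^sup>2 \<le> ((\<gamma> k)\<^sup>2 * K\<^sup>2) * (J B k \<omega> * e k \<omega>)\<^sup>2" for \<omega>
          unfolding power_mult_distrib[of "\<gamma> k * b k \<omega>"] power_mult_distrib[of "\<gamma> k"]
          using power_mono[OF b(2)[of k \<omega>], of 2] by (intro mult_right_mono mult_left_mono) auto
      qed
      also have "\<dots> \<le> (\<gamma> k)\<^sup>2 * K\<^sup>2 * real B"
        using sq_le by (simp add: mult_left_mono)
      finally show ?thesis
        by (simp add: mult.assoc)
    qed
    then show "summable (\<lambda>k. \<integral>\<omega>. ((\<gamma> k * b k \<omega>) * (J B k \<omega> * e k \<omega>))\<^sup>2 \<partial>M)"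
      by (intro summable_comparison_test'[OF summable_mult2[OF \<gamma>]]) auto
  qed
  have ae2: "AE \<omega> in M. summable (\<lambda>k. (\<gamma> k)\<^sup>2 * (J B k \<omega> * e k \<omega>)\<^sup>2)" for B
  proof (rule AE_summable_of_integrals[where v = "\<lambda>k. (\<gamma> k)\<^sup>2 * real B"])
    show "(\<integral>\<^sup>+\<omega>. ennreal ((\<gamma> k)\<^sup>2 * (J B k \<omega> * e k \<omega>)\<^sup>2) \<partial>M) \<le> ennreal ((\<gamma> k)\<^sup>2 * real B)" for k
      using mult_left_mono[OF bound[of B k], of "ennreal ((\<gamma> k)\<^sup>2)"]
      by (simp add: ennreal_mult nn_integral_cmult)
  qed (use \<gamma> in \<open>auto intro: summable_mult2\<close>)
  have ev: "\<exists>B. eventually (\<lambda>k. J B k \<omega> = 1) sequentially"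
    if lim: "\<exists>L<\<infinity>. (\<lambda>k. W k \<omega>) \<longlonglongrightarrow> L" for \<omega>
  proof -
    obtain L where L: "L < \<infinity>" "(\<lambda>k. W k \<omega>) \<longlonglongrightarrow> L"
      using lim by blast
    obtain l where l: "L = ennreal l" "l \<ge> 0"
      using L(1) by (cases L) auto
    obtain B :: nat where "l < real B"
      using reals_Archimedean2 by blast
    then have "L < ennreal (real B)"
      using l by (simp add: ennreal_lessI)
    then have "eventually (\<lambda>k. W k \<omega> < ennreal (real B)) sequentially"
      using L(2) by (rule order_tendstoD(2)[rotated])
    then show ?thesis
      by (intro exI[of _ B]) (auto elim!: eventually_mono simp: J_def)
  qed
  have cond: "AE \<omega> in M. \<exists>L<\<infinity>. (\<lambda>k. W k \<omega>) \<longlonglongrightarrow> L"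
    using e(4) by (simp add: W_def)
  \<comment> \<open>The bound that works depends on \<omega>, so the null sets of all natural
    numbers \<open>B\<close> are discarded together.\<close>
  have "AE \<omega> in M. \<forall>B. summable (\<lambda>k. (\<gamma> k * b k \<omega>) * (J B k \<omega> * e k \<omega>))"
    unfolding AE_all_countable using ae1 by blast
  with cond show "AE \<omega> in M. summable (\<lambda>k. \<gamma> k * (b k \<omega> * e k \<omega>))"
  proof eventually_elim
    case (elim \<omega>)
    obtain B where "eventually (\<lambda>k. J B k \<omega> = 1) sequentially"
      using ev[OF elim(1)] by blast
    then have "eventually (\<lambda>k. (\<gamma> k * b k \<omega>) * (J B k \<omega> * e k \<omega>) = \<gamma> k * (b k \<omega> * e k \<omega>)) sequentially"
      by eventually_elim simp
    from summable_cong[OF this] show ?case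
      using elim(2) by blast
  qed
  have "AE \<omega> in M. \<forall>B. summable (\<lambda>k. (\<gamma> k)\<^sup>2 * (J B k \<omega> * e k \<omega>)\<^sup>2)"
    unfolding AE_all_countable using ae2 by blast
  with cond show "AE \<omega> in M. summable (\<lambda>k. (\<gamma> k)\<^sup>2 * (e k \<omega>)\<^sup>2)"
  proof eventually_elim
    case (elim \<omega>)
    obtain B where "eventually (\<lambda>k. J B k \<omega> = 1) sequentially"
      using ev[OF elim(1)] by blast
    then have "eventually (\<lambda>k. (\<gamma> k)\<^sup>2 * (J B k \<omega> * e k \<omega>)\<^sup>2 = (\<gamma> k)\<^sup>2 * (e k \<omega>)\<^sup>2) sequentially"
      by eventually_elim simp
    from summable_cong[OF this] show ?case
      using elim(2) by blast
  qed
qed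

section \<open>Convergence of the algorithm\<close>

lemma closest_point_interval:
  fixes a b t :: real
  assumes "a \<le> b"
  shows "closest_point {a..b} t = max a (min b t)"
proof (rule closest_point_unique[symmetric])
  show "\<forall>z\<in>{a..b}. dist t (max a (min b t)) \<le> dist t z"
    using assms by (auto simp: dist_real_def max_def min_def)
qed (use assms in auto)

lemma interior_box_domain: "interior (box_domain lo hi) = {x. \<forall>i. lo $ i < x $ i \<and> x $ i < hi $ i}"
proof -
  have "box_domain lo hi = cbox lo hi"
    by (auto simp: mem_box_domain mem_box_cart)
  then show ?thesis
    by (auto simp: interior_cbox mem_box_cart)
qed

lemma disutilityD:
  assumes "disutility h"
  shows "(h has_real_derivative deriv h x) (at x)" "h y \<ge> h x + deriv h x * (y - x)"
    "mono (deriv h)"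
proof -
  have d: "(h has_real_derivative deriv h x) (at x)" for x
    using assms by (auto simp: disutility_def field_differentiable_derivI)
  then show "(h has_real_derivative deriv h x) (at x)" .
  have t: "h y \<ge> h x + deriv h x * (y - x)" for x y
    using convex_on_imp_above_tangent[of UNIV h x y "deriv h x"] assms d[of x]
    by (auto simp: disutility_def)
  then show "h y \<ge> h x + deriv h x * (y - x)" .
  show "mono (deriv h)"
  proof (rule monoI)
    fix x y :: real assume "x \<le> y"
    show "deriv h x \<le> deriv h y"
    proof (cases "x = y")
      case False
      then have "0 < y - x" using \<open>x \<le> y\<close> by simp
      moreover have "0 \<le> (y - x) * (deriv h y - deriv h x)"
        using t[of x y] t[of y x] by (simp add: algebra_simps)
      ultimately show ?thesis
        by (simp add: zero_le_mult_iff)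
    qed simp
  qed
qed

text \<open>Shifting a small amount between loads \<open>i\<close> and \<open>j\<close> keeps the
  total and, from an interior point, stays in the box. Along this line the cost has a local minimum
  at 0.\<close>

lemma solution_equal_derivatives:
  fixes f :: "'n::finite \<Rightarrow> real \<Rightarrow> real"
  assumes f: "\<And>i. disutility (f i)" and sol: "is_solution f lo hi g xs"
    and int: "xs \<in> interior (box_domain lo hi)"
  shows "deriv (f i) (xs $ i) = deriv (f j) (xs $ j)"
proof -
  define \<delta> where "\<delta> k = (if k = i then 1 else 0) - (if k = j then 1 else 0 :: real)" for k
  have sum_\<delta>: "(\<Sum>k\<in>UNIV. a k * \<delta> k) = a i - a j" for a :: "'n \<Rightarrow> real"
  proof -
    have "(\<Sum>k\<in>UNIV. a k * \<delta> k) = (\<Sum>k\<in>UNIV. (if k = i then a k else 0) - (if k = j then a k else 0))"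
      by (intro sum.cong) (auto simp: \<delta>_def)
    then show ?thesis
      by (simp add: sum_subtractf)
  qed
  define \<Phi> where "\<Phi> t = (\<Sum>k\<in>UNIV. f k (xs $ k + t * \<delta> k))" for t
  obtain r where r: "r > 0" "ball xs r \<subseteq> box_domain lo hi"
    using int by (auto simp: mem_interior)
  let ?D = "(\<chi> k. \<delta> k) :: real^'n"
  have "((\<lambda>t. f k (xs $ k + t * \<delta> k)) has_real_derivative deriv (f k) (xs $ k) * \<delta> k) (at 0)" for k
  proof -
    have "((\<lambda>t. xs $ k + t * \<delta> k) has_real_derivative \<delta> k) (at 0)"
      by (auto intro!: derivative_eq_intros)
    then show ?thesis
      using DERIV_chain2[of "f k" "deriv (f k) (xs $ k)" "\<lambda>t. xs $ k + t * \<delta> k" 0 "\<delta> k"]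
        disutilityD(1)[OF f[of k], of "xs $ k"] by simp
  qed
  then have "(\<Phi> has_real_derivative (\<Sum>k\<in>UNIV. deriv (f k) (xs $ k) * \<delta> k)) (at 0)"
    unfolding \<Phi>_def by (intro DERIV_sum)
  \<comment> \<open>The added 1 keeps the denominator positive when \<open>i = j\<close>, where the
    direction is 0.\<close>
  moreover have "\<Phi> 0 \<le> \<Phi> t" if t: "\<bar>0 - t\<bar> < r / (norm ?D + 1)" for t
  proof -
    have n0: "norm ?D + 1 > 0"
      by (smt (verit) norm_ge_zero)
    have "norm (t *\<^sub>R ?D) \<le> \<bar>t\<bar> * (norm ?D + 1)"
      by (simp add: distrib_left)
    also have "\<dots> < r"
      using t n0 by (simp add: pos_less_divide_eq)
    finally have "xs + t *\<^sub>R ?D \<in> ball xs r"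
      by (simp add: dist_norm)
    then have "xs + t *\<^sub>R ?D \<in> box_domain lo hi"
      using r by blast
    moreover have "(\<Sum>k\<in>UNIV. (xs + t *\<^sub>R ?D) $ k) = g"
      using sum_\<delta>[of "\<lambda>_. t"] sol by (simp add: sum.distrib is_solution_def is_arg_min_def)
    ultimately have "\<not> (\<Sum>k\<in>UNIV. f k ((xs + t *\<^sub>R ?D) $ k)) < (\<Sum>k\<in>UNIV. f k (xs $ k))"
      using sol unfolding is_solution_def is_arg_min_def by blast
    then show ?thesis
      by (simp add: \<Phi>_def not_less)
  qed
  moreover have "0 < r / (norm ?D + 1)"
    using r(1) by (intro divide_pos_pos add_nonneg_pos) auto
  ultimately have "(\<Sum>k\<in>UNIV. deriv (f k) (xs $ k) * \<delta> k) = 0"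
    using DERIV_local_min by blast
  then show ?thesis
    by (simp add: sum_\<delta>)
qed

text \<open>With one common slope, the first-order terms of the tangent inequalities cancel on the
  constraint set.\<close>

lemma equal_derivatives_solution:
  fixes f :: "'n::finite \<Rightarrow> real \<Rightarrow> real"
  assumes f: "\<And>i. disutility (f i)" and x: "x \<in> box_domain lo hi" "(\<Sum>i\<in>UNIV. x $ i) = g"
    and eq: "\<And>i. deriv (f i) (x $ i) = \<mu>"
  shows "is_solution f lo hi g x"
  unfolding is_solution_def is_arg_min_def
proof (intro conjI notI x)
  assume "\<exists>y. ((\<Sum>i\<in>UNIV. y $ i) = g \<and> y \<in> box_domain lo hi) \<and>
    (\<Sum>i\<in>UNIV. f i (y $ i)) < (\<Sum>i\<in>UNIV. f i (x $ i))"
  then obtain y where y: "(\<Sum>i\<in>UNIV. y $ i) = g" "(\<Sum>i\<in>UNIV. f i (y $ i)) < (\<Sum>i\<in>UNIV. f i (x $ i))"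
    by blast
  have "(\<Sum>i\<in>UNIV. f i (x $ i) + \<mu> * (y $ i - x $ i)) \<le> (\<Sum>i\<in>UNIV. f i (y $ i))"
    using disutilityD(2)[OF f] eq by (intro sum_mono) metis
  moreover have "(\<Sum>i\<in>UNIV. \<mu> * (y $ i - x $ i)) = 0"
    by (simp add: sum_distrib_left[symmetric] sum_subtractf x y)
  ultimately show False
    using y(2) by (simp add: sum.distrib)
qed

section \<open>Measurability of the noise and of the iterates\<close>

lemma borel_measurable_vecI:
  fixes X :: "'a \<Rightarrow> real^'n"
  assumes "\<And>i. (\<lambda>\<omega>. X \<omega> $ i) \<in> borel_measurable N"
  shows "X \<in> borel_measurable N"
  unfolding borel_measurable_euclidean_space[of X]
proof
  fix b :: "real^'n" assume "b \<in> Basis"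
  then obtain i where "b = axis i 1"
    by (auto simp: Basis_vec_def)
  then show "(\<lambda>\<omega>. X \<omega> \<bullet> b) \<in> borel_measurable N"
    using assms[of i] by (simp add: inner_axis)
qed

lemma noise_filt_properties:
  assumes "\<And>k i. (\<lambda>\<omega>. \<epsilon> k \<omega> $ i) \<in> borel_measurable M"
  shows "subalgebra M (noise_filt M \<epsilon> k)" "subalgebra (noise_filt M \<epsilon> (Suc k)) (noise_filt M \<epsilon> k)"
    "(\<lambda>\<omega>. \<epsilon> k \<omega> $ i) \<in> borel_measurable (noise_filt M \<epsilon> (Suc k))"
proof -
  define G where "G k = (\<Union>i. \<Union>l<k. {(\<lambda>\<omega>. \<epsilon> l \<omega> $ i) -` A \<inter> space M | A. A \<in> sets borel})" for k
  have G_sets: "G k \<subseteq> sets M" for k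
    unfolding G_def using measurable_sets[OF assms] by blast
  have sp: "space (noise_filt M \<epsilon> k) = space M" for k
    unfolding noise_filt_def by (simp add: space_measure_of_conv)
  have st: "sets (noise_filt M \<epsilon> k) = sigma_sets (space M) (G k)" for k
    unfolding noise_filt_def G_def[symmetric]
    by (rule sets_measure_of) (use G_sets sets.space_closed in blast)
  show "subalgebra M (noise_filt M \<epsilon> k)"
    unfolding subalgebra_def sp st using sets.sigma_sets_subset[OF G_sets] by blast
  have "G k \<subseteq> G (Suc k)"
    unfolding G_def by (intro UN_mono) auto
  then show "subalgebra (noise_filt M \<epsilon> (Suc k)) (noise_filt M \<epsilon> k)"
    unfolding subalgebra_def sp st by (intro conjI refl sigma_sets_mono') auto
  show "(\<lambda>\<omega>. \<epsilon> k \<omega> $ i) \<in> borel_measurable (noise_filt M \<epsilon> (Suc k))"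
  proof (rule measurableI)
    fix A :: "real set" assume "A \<in> sets borel"
    then show "(\<lambda>\<omega>. \<epsilon> k \<omega> $ i) -` A \<inter> space (noise_filt M \<epsilon> (Suc k)) \<in> sets (noise_filt M \<epsilon> (Suc k))"
      unfolding sp st by (intro sigma_sets.Basic) (auto simp: G_def)
  qed simp
qed

theorem theorem4p4:
  fixes M :: "'a measure"
    and f :: "'n::finite \<Rightarrow> real \<Rightarrow> real"
    and E :: "('n \<times> 'n) set"
    and lo hi x0 :: "real^'n"
    and \<Delta>g \<alpha> \<gamma> :: "nat \<Rightarrow> real"
    and gbar c :: real
    and x uhat \<epsilon> :: "nat \<Rightarrow> 'a \<Rightarrow> real^'n"
  assumes "prob_space M"
    \<comment> \<open>the DGP algorithm\<close>
    and "x0 \<in> box_domain lo hi"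
    and "\<And>k. \<alpha> k > 0" and "\<And>k. \<gamma> k > 0"
    and "\<And>k \<omega>. x k \<omega> = dgp f E lo hi \<alpha> \<gamma> x0 (\<lambda>l. uhat l \<omega>) k"
    and "\<And>k \<omega> i. \<epsilon> k \<omega> $ i = uhat k \<omega> $ i - mismatch \<Delta>g (\<lambda>l. x l \<omega>) k"
    \<comment> \<open>disutilities\<close>
    and "\<And>i. disutility (f i)"
    \<comment> \<open>geometry\<close>
    and "compact (box_domain lo hi)"
    and "sym E" and "connected_graph E"
    and "\<And>k. \<Delta>g k = gbar"
    \<comment> \<open>technical\<close>
    and "c > 0" and "\<And>k. \<alpha> k = c * \<gamma> k"
    and "\<gamma> \<longlonglongrightarrow> 0"
    and "filterlim (\<lambda>N. \<Sum>k<N. \<gamma> k) at_top sequentially"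
    and "summable (\<lambda>k. (\<gamma> k)\<^sup>2)"
    and "martingale_difference M \<epsilon>"
    and "\<And>i. AE \<omega> in M. \<exists>L<\<infinity>. (\<lambda>k. cond_second_moment M \<epsilon> i k \<omega>) \<longlonglongrightarrow> L"
    \<comment> \<open>solvability and strict feasibility\<close>
    and "\<exists>y. is_solution f lo hi gbar y"
    and "\<And>y. is_solution f lo hi gbar y \<Longrightarrow> y \<in> interior (box_domain lo hi)"
  shows "AE \<omega> in M. \<exists>y. is_solution f lo hi gbar y \<and> (\<lambda>k. x k \<omega>) \<longlonglongrightarrow> y"
proof -
  note x_dgp = assms(5) and \<epsilon>_def = assms(6) and f = assms(7) and \<gamma>_pos = assms(4)
    and strict = assms(20)
  interpret prob_space M by fact
  obtain xs where xs: "is_solution f lo hi gbar xs"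
    using assms(19) by blast
  have xs_int: "lo $ i < xs $ i" "xs $ i < hi $ i" for i
    using strict[OF xs] by (auto simp: interior_box_domain)
  have xs_sum: "(\<Sum>i\<in>UNIV. xs $ i) = gbar"
    using xs by (auto simp: is_solution_def is_arg_min_def)
  \<comment> \<open>Any index would do, as all derivatives agree at \<open>xs\<close>;
    \<open>undefined\<close> just names one.\<close>
  define \<mu> where "\<mu> = deriv (f undefined) (xs $ undefined)"
  define w where "w i t = deriv (f i) t - \<mu>" for i t
  have w_xs: "w i (xs $ i) = 0" for i
    unfolding w_def \<mu>_def using solution_equal_derivatives[OF f xs strict[OF xs]] by simp
  have "\<exists>L. L-lipschitz_on UNIV (deriv (f i))" for i
    using f[of i] by (auto simp: disutility_def)
  then obtain L where L: "\<And>i. (L i)-lipschitz_on UNIV (deriv (f i))"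
    by metis
  define \<Lambda> where "\<Lambda> = (\<Sum>i\<in>UNIV. L i)"
  have sol: "is_solution f lo hi gbar y"
    if "y \<in> box_domain lo hi" "\<And>j. w j (y $ j) = 0" "(\<Sum>j\<in>UNIV. y $ j) = gbar" for y
    using that by (intro equal_derivatives_solution[OF f, where \<mu> = \<mu>]) (auto simp: w_def)
  interpret consensus_flow w E lo hi xs c gbar \<Lambda>
  proof unfold_locales
    show "mono (w i)" for i
      using disutilityD(3)[OF f[of i]] by (auto simp: mono_def w_def)
    show "\<Lambda>-lipschitz_on UNIV (w i)" for i
    proof -
      have "L i \<le> \<Lambda>"
        unfolding \<Lambda>_def by (rule member_le_sum) (use lipschitz_on_nonneg[OF L] in auto)
      then have "\<Lambda>-lipschitz_on UNIV (deriv (f i))"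
        by (rule lipschitz_on_le[OF L])
      then show ?thesis
        by (auto simp: lipschitz_on_def w_def dist_real_def)
    qed
    show "lo $ i < y $ i \<and> y $ i < hi $ i"
      if "y \<in> box_domain lo hi" "\<And>j. w j (y $ j) = 0" "(\<Sum>j\<in>UNIV. y $ j) = gbar" for y i
      using strict[OF sol[OF that]] by (auto simp: interior_box_domain)
  qed (use assms xs_int xs_sum w_xs in auto)
  have x_0: "x 0 \<omega> = x0" for \<omega>
    by (simp add: x_dgp)
  \<comment> \<open>The multiplier cancels in the differences of \<open>consensus_dir\<close>, the
    mismatch is the negated excess, and \<open>\<alpha> k = c * \<gamma> k\<close> lets
    \<open>\<gamma> k\<close> be factored out.\<close>
  have x_Suc: "x (Suc k) \<omega> = proj (\<chi> i. x k \<omega> $ i + \<gamma> k * (vel (x k \<omega>) i + \<epsilon> k \<omega> $ i))" for k \<omega>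
  proof -
    have dir: "consensus_dir f E (x k \<omega>) i = - (\<Sum>j\<in>nbrs E i. w i (x k \<omega> $ i) - w j (x k \<omega> $ j))" for i
      by (simp add: consensus_dir_def w_def sum_subtractf)
    have est: "uhat k \<omega> $ i = \<epsilon> k \<omega> $ i - excess (x k \<omega>)" for i
      using \<epsilon>_def[of k \<omega> i] by (simp add: mismatch_def excess_def assms(11))
    have "x k \<omega> $ i + \<alpha> k * consensus_dir f E (x k \<omega>) i + \<gamma> k * (uhat k \<omega> $ i)
        = x k \<omega> $ i + \<gamma> k * (vel (x k \<omega>) i + \<epsilon> k \<omega> $ i)" for i
      unfolding dir est vel_def assms(13) by (simp add: algebra_simps)
    moreover have "x (Suc k) \<omega> = (\<chi> i. closest_point {lo $ i..hi $ i}
        (x k \<omega> $ i + \<alpha> k * consensus_dir f E (x k \<omega>) i + \<gamma> k * (uhat k \<omega> $ i)))"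
      unfolding x_dgp[of "Suc k"] x_dgp[of k] by (simp add: Let_def)
    ultimately show ?thesis
      by (simp only: proj_def closest_point_interval[OF lo_le_hi] vec_lambda_beta)
  qed
  have x_box: "x k \<omega> \<in> Box" for k \<omega>
    by (cases k) (auto simp: x_0 x_Suc proj_in_box assms(2))
  obtain g :: "real^'n \<Rightarrow> 'n \<Rightarrow> real" where g: "\<And>i. continuous_on UNIV (\<lambda>x. g x i)" and
    converges: "\<And>X e \<gamma>. X 0 \<in> Box \<Longrightarrow> (\<And>k. X (Suc k) = proj (\<chi> i. X k $ i + \<gamma> k * (vel (X k) i + e k i))) \<Longrightarrow>
      (\<And>k. \<gamma> k > 0) \<Longrightarrow> \<not> summable \<gamma> \<Longrightarrow> summable (\<lambda>k. (\<gamma> k)\<^sup>2) \<Longrightarrow>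
      (\<And>i. summable (\<lambda>k. (\<gamma> k)\<^sup>2 * (e k i)\<^sup>2)) \<Longrightarrow> (\<And>i. summable (\<lambda>k. \<gamma> k * (g (X k) i * e k i))) \<Longrightarrow>
      (\<And>i. summable (\<lambda>k. \<gamma> k * e k i)) \<Longrightarrow> (\<And>i j. summable (\<lambda>k. \<gamma> k * (X k $ j * e k i))) \<Longrightarrow>
      \<exists>x\<in>Sol. X \<longlonglongrightarrow> x"
    by (rule projected_trajectory_converges) blast
  let ?F = "noise_filt M \<epsilon>"
  have \<epsilon>_int: "integrable M (\<lambda>\<omega>. \<epsilon> k \<omega> $ i)" for k i
    using assms(17) by (simp add: martingale_difference_def)
  note F = noise_filt_properties[of \<epsilon> M, OF borel_measurable_integrable[OF \<epsilon>_int]]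
  \<comment> \<open>\<open>?F k\<close> is generated by the noise before time \<open>k\<close>,
    which is all that has entered \<open>x k\<close>; functions of \<open>x k\<close> are therefore
    predictable weights for the noise at time \<open>k\<close>.\<close>
  have x_meas: "x k \<in> borel_measurable (?F k)" for k
  proof (induction k)
    case 0
    have "x 0 = (\<lambda>_. x0)"
      by (auto simp: x_0)
    then show ?case
      by simp
  next
    case (Suc k)
    have [measurable]: "x k \<in> borel_measurable (?F (Suc k))"
      by (rule measurable_from_subalg[OF F(2) Suc])
    have [measurable]: "(\<lambda>\<omega>. \<epsilon> k \<omega> $ i) \<in> borel_measurable (?F (Suc k))" for i
      by (rule F(3))
    have [measurable]: "(\<lambda>\<omega>. vel (x k \<omega>) i) \<in> borel_measurable (?F (Suc k))" for i
      by (rule borel_measurable_continuous_on[OF vel_continuous]) measurable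
    have [measurable]: "(\<lambda>\<omega>. x k \<omega> $ i) \<in> borel_measurable (?F (Suc k))" for i
      by (rule borel_measurable_continuous_on[where f = "\<lambda>z. z $ i"]) (auto intro!: continuous_intros)
    show ?case
    proof (rule borel_measurable_vecI)
      fix i
      show "(\<lambda>\<omega>. x (Suc k) \<omega> $ i) \<in> borel_measurable (?F (Suc k))"
        unfolding x_Suc proj_def vec_lambda_beta by measurable
    qed
  qed
  \<comment> \<open>A continuous \<open>b\<close> is bounded on the compact box, which contains all
    iterates. It will be a component of \<open>g\<close>, a coordinate or a constant.\<close>
  have noise: "AE \<omega> in M. summable (\<lambda>k. \<gamma> k * (b (x k \<omega>) * \<epsilon> k \<omega> $ i))"
      "AE \<omega> in M. summable (\<lambda>k. (\<gamma> k)\<^sup>2 * (\<epsilon> k \<omega> $ i)\<^sup>2)"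
    if b: "continuous_on UNIV b" for b :: "real^'n \<Rightarrow> real" and i
  proof -
    have "bounded (b ` Box)"
      using compact_continuous_image[OF continuous_on_subset[OF b] compact_box_domain]
      by (intro compact_imp_bounded) auto
    then obtain K where K: "\<And>z. z \<in> Box \<Longrightarrow> \<bar>b z\<bar> \<le> K"
      by (auto simp: bounded_iff)
    have cond: "AE \<omega> in M. \<exists>L<\<infinity>. (\<lambda>k. nn_cond_exp M (?F k) (\<lambda>\<omega>. ennreal ((\<epsilon> k \<omega> $ i)\<^sup>2)) \<omega>) \<longlonglongrightarrow> L"
      using assms(18)[of i] by (simp add: cond_second_moment_def)
    have mean: "AE \<omega> in M. real_cond_exp M (?F k) (\<lambda>\<omega>. \<epsilon> k \<omega> $ i) \<omega> = 0" for k
      using assms(17) by (simp add: martingale_difference_def)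
    have bm: "(\<lambda>\<omega>. b (x k \<omega>)) \<in> borel_measurable (?F k)" for k
      by (rule borel_measurable_continuous_on[OF b x_meas])
    note res = weighted_noise_summable[of ?F "\<lambda>k \<omega>. \<epsilon> k \<omega> $ i" \<gamma> "\<lambda>k \<omega>. b (x k \<omega>)" K,
        OF F(1) F(2) F(3) \<epsilon>_int mean cond assms(16) bm K[OF x_box]]
    show "AE \<omega> in M. summable (\<lambda>k. \<gamma> k * (b (x k \<omega>) * \<epsilon> k \<omega> $ i))"
      by (rule res(1))
    show "AE \<omega> in M. summable (\<lambda>k. (\<gamma> k)\<^sup>2 * (\<epsilon> k \<omega> $ i)\<^sup>2)"
      by (rule res(2))
  qed
  have "\<not> summable \<gamma>"
  proof
    assume "summable \<gamma>"
    then have "(\<lambda>N. \<Sum>k<N. \<gamma> k) \<longlonglongrightarrow> suminf \<gamma>"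
      by (rule summable_LIMSEQ)
    then show False
      using not_tendsto_and_filterlim_at_infinity[OF trivial_limit_sequentially]
        filterlim_at_top_imp_at_infinity[OF assms(15)] by blast
  qed
  have ae_g: "AE \<omega> in M. \<forall>i\<in>UNIV. summable (\<lambda>k. \<gamma> k * (g (x k \<omega>) i * \<epsilon> k \<omega> $ i))"
    by (intro AE_finite_allI noise(1) g) simp
  have ae_x: "AE \<omega> in M. \<forall>i\<in>UNIV. \<forall>j\<in>UNIV. summable (\<lambda>k. \<gamma> k * (x k \<omega> $ j * \<epsilon> k \<omega> $ i))"
    by (intro AE_finite_allI noise(1) continuous_intros) auto
  have ae_1: "AE \<omega> in M. \<forall>i\<in>UNIV. summable (\<lambda>k. \<gamma> k * (1 * \<epsilon> k \<omega> $ i))"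
    by (intro AE_finite_allI noise(1) continuous_intros) auto
  have ae_2: "AE \<omega> in M. \<forall>i\<in>UNIV. summable (\<lambda>k. (\<gamma> k)\<^sup>2 * (\<epsilon> k \<omega> $ i)\<^sup>2)"
    by (intro AE_finite_allI noise(2)[OF continuous_on_const]) auto
  from ae_g ae_x ae_1 ae_2 show ?thesis
  proof eventually_elim
    case (elim \<omega>)
    have "\<exists>y\<in>Sol. (\<lambda>k. x k \<omega>) \<longlonglongrightarrow> y"
      by (rule converges[of "\<lambda>k. x k \<omega>" \<gamma> "\<lambda>k i. \<epsilon> k \<omega> $ i",
            OF x_box x_Suc \<gamma>_pos \<open>\<not> summable \<gamma>\<close> assms(16)]) (use elim in auto)
    then show ?case
      using sol by (auto simp: Sol_def excess_def)
  qed
qed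

end
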